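(* Let $\Bbbk$ be a field of characteristic zero and let $A$ be a noetherian Poisson domain over $\Bbbk$. (a) If $A$ is either Poisson simple of finite Krull dimension with all units in $\Bbbk$ (i.e. $A^\times=\Bbbk^\times$), or affine of Krull dimension one, then $A$ is Poisson $\alpha$-cancellative. (b) If the Poisson Makar-Limanov invariant of $A$ equals $A$, i.e. $\mathrm{PML}(A)=A$, then $A$ is Poisson $\delta$-cancellative. (c) If $A$ has finite Krull dimension and the $1$-divisor Poisson subalgebra of $A$ equals $A$, i.e. $\mathbb D(1)=A$, then $A$ is Poisson skew cancellative. (d) If $A$ is Poisson stratiform and the $1$-divisor Poisson subalgebra of $A$ equals $A$, i.e. $\mathbb D(1)=A$, then $A$ is Poisson skew cancellative in the category of noetherian Poisson stratiform domains.
   Context: A Poisson algebra is a commutative $\Bbbk$-algebra with a $\Bbbk$-bilinear bracket that is a Lie bracket and a biderivation; a Poisson domain is a Poisson algebra that is a domain. Affine means finitely generated as a $\Bbbk$-algebra. A Poisson ideal $I$ is an ideal with $\{I,A\}\subseteq I$; $A$ is Poisson simple if $A\neq 0$ and its only Poisson ideals are $0$ and $A$. Isomorphisms of Poisson algebras preserve products and brackets. Poisson-Ore extensions. A Poisson derivation of $A$ is a $\Bbbk$-linear derivation $\alpha$ with $\alpha(\{a,b\})=\{\alpha(a),b\}+\{a,\alpha(b)\}$. Given such $\alpha$, a Poisson $\alpha$-derivation is a $\Bbbk$-linear derivation $\delta$ with $\delta(\{a,b\})=\{\delta(a),b\}+\{a,\delta(b)\}+\delta(a)\alpha(b)-\alpha(a)\delta(b)$.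 The Poisson-Ore extension $A[t;\alpha,\delta]_P$ is the polynomial ring $A[t]$ with the Poisson bracket extending that of $A$ and satisfying $\{a,t\}=\alpha(a)t+\delta(a)$ for $a\in A$. One writes $A[t;\alpha]_P$ if $\delta=0$ and $A[t;\delta]_P$ if $\alpha=0$. Cancellation. $A$ is Poisson skew cancellative if any Poisson isomorphism $A[t;\alpha,\delta]_P\cong A'[t';\alpha',\delta']_P$, with $A'$ a Poisson algebra, implies a Poisson isomorphism $A\cong A'$. It is Poisson $\alpha$-cancellative if this holds whenever $\delta=\delta'=0$, and Poisson $\delta$-cancellative if this holds whenever $\alpha=\alpha'=0$. "In the category of noetherian Poisson stratiform domains" means that $A'$ is only allowed to range over noetherian Poisson stratiform domains. Poisson Makar-Limanov invariant. $\mathrm{PML}(A)=\bigcap_{\partial}\ker\partial$, where $\partial$ ranges over all locally nilpotent Poisson derivations of $A$ (for every $a\in A$, $\partial^n(a)=0$ for $n\gg0$). Divisor subalgebra. For a nonempty $F\subseteq A$ with $F\ne\{0\}$, let $\mathrm{Sw}(F)$ be the set of all $g\in A$ such that $f=gb$ for some $0\neq f\in F$ and $b\in A$. Put $D_0(F)=F$ and, for $n\ge1$, let $D_n(F)$ be the Poisson $\Bbbk$-subalgebra of $A$ generated by $\mathrm{Sw}(D_{n-1}(F))$. The $F$-divisor Poisson subalgebra is $\mathbb D(F)=\bigcup_{n\ge0}D_n(F)$, and the $1$-divisor Poisson subalgebra is $\mathbb D(1)=\mathbb D(\{1\})$. Stratiform. An artinian Poisson algebra $S$ is Poisson stratiform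 over $\Bbbk$ if there is a chain of artinian Poisson algebras $S=S_n\supseteq S_{n-1}\supseteq\cdots\supseteq S_0=\Bbbk$ such that for every $i$ either $S_{i+1}$ is finite over $S_i$, or $S_{i+1}=S_i(t_i;\alpha_i,\delta_i)_P$ for some $\alpha_i,\delta_i$. Here $S_i(t_i;\alpha_i,\delta_i)_P$ is the algebra of rational functions $S_i(t_i)$ with coefficients in $S_i$, with the unique extension of the Poisson bracket of $S_i[t_i;\alpha_i,\delta_i]_P$. A Poisson domain $A$ is Poisson stratiform if its field of fractions $Q(A)$, with the extended bracket, is. *)

theory Defs
  imports
    "HOL-Algebra.Algebraic_Closure_Type"
    "HOL-Algebra.Ring_Divisibility"
    "HOL-Computational_Algebra.Polynomial"
    "HOL-Computational_Algebra.Fraction_Field"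
    "HOL-Library.Extended_Nat"
    "HOL-Library.FuncSet"
begin

text \<open>
  A commutative algebra over a field is a type \<open>'a\<close> of class \<open>comm_ring_1\<close> (\<open>idom\<close> for
  domains) together with a scalar multiplication \<open>sc\<close> by the field type \<open>'k\<close>; \<open>br\<close> is the
  bracket.  Subalgebras are subsets of \<open>'a\<close>.  Ideal-theoretic notions are those of HOL-Algebra,
  applied to \<^const>\<open>ring_of_type_algebra\<close> and to its restrictions to subrings.
\<close>

locale poisson_algebra = vector_space sc
  for sc :: "'k::field \<Rightarrow> 'a::comm_ring_1 \<Rightarrow> 'a" +
  fixes br :: "'a \<Rightarrow> 'a \<Rightarrow> 'a"
  assumes scale_mult: "sc l (a * b) = sc l a * b"
    and bracket_linear_left: "Vector_Spaces.linear sc sc (\<lambda>a. br a b)"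
    and bracket_linear_right: "Vector_Spaces.linear sc sc (\<lambda>b. br a b)"
    and bracket_self: "br a a = 0"
    and jacobi: "br a (br b c) + br b (br c a) + br c (br a b) = 0"
    and leibniz_left: "br (a * b) c = a * br b c + br a c * b"
    and leibniz_right: "br a (b * c) = b * br a c + br a b * c"

definition poisson_iso ::
  "('k::field \<Rightarrow> 'a::comm_ring_1 \<Rightarrow> 'a) \<Rightarrow> ('a \<Rightarrow> 'a \<Rightarrow> 'a) \<Rightarrow>
   ('k \<Rightarrow> 'b::comm_ring_1 \<Rightarrow> 'b) \<Rightarrow> ('b \<Rightarrow> 'b \<Rightarrow> 'b) \<Rightarrow> ('a \<Rightarrow> 'b) \<Rightarrow> bool" where
  "poisson_iso sc br sc' br' \<phi> \<longleftrightarrow>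
     bij \<phi> \<and> Vector_Spaces.linear sc sc' \<phi> \<and> \<phi> 1 = 1 \<and>
     (\<forall>x y. \<phi> (x * y) = \<phi> x * \<phi> y) \<and> (\<forall>x y. \<phi> (br x y) = br' (\<phi> x) (\<phi> y))"

definition poisson_isomorphic ::
  "('k::field \<Rightarrow> 'a::comm_ring_1 \<Rightarrow> 'a) \<Rightarrow> ('a \<Rightarrow> 'a \<Rightarrow> 'a) \<Rightarrow>
   ('k \<Rightarrow> 'b::comm_ring_1 \<Rightarrow> 'b) \<Rightarrow> ('b \<Rightarrow> 'b \<Rightarrow> 'b) \<Rightarrow> bool" where
  "poisson_isomorphic sc br sc' br' \<longleftrightarrow> (\<exists>\<phi>. poisson_iso sc br sc' br' \<phi>)"


subsection \<open>Subalgebras, ideals and dimension\<close>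

definition k_subalgebra :: "('k::field \<Rightarrow> 'a::comm_ring_1 \<Rightarrow> 'a) \<Rightarrow> 'a set \<Rightarrow> bool" where
  "k_subalgebra sc S \<longleftrightarrow> module.subspace sc S \<and> 1 \<in> S \<and> (\<forall>x\<in>S. \<forall>y\<in>S. x * y \<in> S)"

definition poisson_subalgebra ::
  "('k::field \<Rightarrow> 'a::comm_ring_1 \<Rightarrow> 'a) \<Rightarrow> ('a \<Rightarrow> 'a \<Rightarrow> 'a) \<Rightarrow> 'a set \<Rightarrow> bool" where
  "poisson_subalgebra sc br S \<longleftrightarrow> k_subalgebra sc S \<and> (\<forall>x\<in>S. \<forall>y\<in>S. br x y \<in> S)"

definition affine_algebra :: "('k::field \<Rightarrow> 'a::comm_ring_1 \<Rightarrow> 'a) \<Rightarrow> bool" where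
  "affine_algebra sc \<longleftrightarrow> (\<exists>G. finite G \<and> k_subalgebra sc hull G = UNIV)"

definition subring_of_type :: "'a::comm_ring_1 set \<Rightarrow> 'a ring" where
  "subring_of_type S = ring_of_type_algebra\<lparr>carrier := S\<rparr>"

definition artinian_ring :: "('a, 'm) ring_scheme \<Rightarrow> bool" where
  "artinian_ring R \<longleftrightarrow> ring R \<and>
     (\<forall>I :: nat \<Rightarrow> 'a set. (\<forall>n. ideal (I n) R \<and> I (Suc n) \<subseteq> I n) \<longrightarrow> (\<exists>N. \<forall>n\<ge>N. I n = I N))"

definition krull_dim :: "('a, 'm) ring_scheme \<Rightarrow> enat" where
  "krull_dim R = Sup {enat n | n. \<exists>P :: nat \<Rightarrow> 'a set.
     (\<forall>i\<le>n. primeideal (P i) R) \<and> (\<forall>i<n. P i \<subset> P (Suc i))}"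

definition poisson_ideal :: "('a::comm_ring_1 \<Rightarrow> 'a \<Rightarrow> 'a) \<Rightarrow> 'a set \<Rightarrow> bool" where
  "poisson_ideal br I \<longleftrightarrow> ideal I (ring_of_type_algebra :: 'a ring) \<and> (\<forall>x\<in>I. \<forall>a. br x a \<in> I)"

text \<open>The requirement that the algebra be nonzero is part of the class \<open>comm_ring_1\<close>.\<close>

definition poisson_simple :: "('a::comm_ring_1 \<Rightarrow> 'a \<Rightarrow> 'a) \<Rightarrow> bool" where
  "poisson_simple br \<longleftrightarrow> (\<forall>I. poisson_ideal br I \<longrightarrow> I = {0} \<or> I = UNIV)"


subsection \<open>Derivations and Poisson-Ore extensions\<close>

text \<open>
  All derivations are taken relative to a subalgebra \<open>S\<close>, because the chain in the definition
  of stratiform algebras consists of subalgebras.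
\<close>

definition derivation_on ::
  "'a set \<Rightarrow> ('k::field \<Rightarrow> 'a::comm_ring_1 \<Rightarrow> 'a) \<Rightarrow> ('a \<Rightarrow> 'a) \<Rightarrow> bool" where
  "derivation_on S sc d \<longleftrightarrow> (\<forall>a\<in>S. d a \<in> S) \<and>
     (\<forall>a\<in>S. \<forall>b\<in>S. d (a + b) = d a + d b) \<and> (\<forall>c. \<forall>a\<in>S. d (sc c a) = sc c (d a)) \<and>
     (\<forall>a\<in>S. \<forall>b\<in>S. d (a * b) = a * d b + d a * b)"

definition poisson_derivation_on ::
  "'a set \<Rightarrow> ('k::field \<Rightarrow> 'a::comm_ring_1 \<Rightarrow> 'a) \<Rightarrow> ('a \<Rightarrow> 'a \<Rightarrow> 'a) \<Rightarrow> ('a \<Rightarrow> 'a) \<Rightarrow> bool" where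
  "poisson_derivation_on S sc br \<alpha> \<longleftrightarrow> derivation_on S sc \<alpha> \<and>
     (\<forall>a\<in>S. \<forall>b\<in>S. \<alpha> (br a b) = br (\<alpha> a) b + br a (\<alpha> b))"

definition poisson_alpha_derivation_on ::
  "'a set \<Rightarrow> ('k::field \<Rightarrow> 'a::comm_ring_1 \<Rightarrow> 'a) \<Rightarrow> ('a \<Rightarrow> 'a \<Rightarrow> 'a) \<Rightarrow> ('a \<Rightarrow> 'a) \<Rightarrow> ('a \<Rightarrow> 'a) \<Rightarrow> bool"
  where
  "poisson_alpha_derivation_on S sc br \<alpha> \<delta> \<longleftrightarrow> derivation_on S sc \<delta> \<and>
     (\<forall>a\<in>S. \<forall>b\<in>S. \<delta> (br a b) = br (\<delta> a) b + br a (\<delta> b) + \<delta> a * \<alpha> b - \<alpha> a * \<delta> b)"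

definition poly_scale :: "('k::field \<Rightarrow> 'a::comm_ring_1 \<Rightarrow> 'a) \<Rightarrow> 'k \<Rightarrow> 'a poly \<Rightarrow> 'a poly" where
  "poly_scale sc c p = smult (sc c 1) p"

text \<open>
  \<open>poisson_ore sc br \<alpha> \<delta> P\<close>: the polynomial ring over \<open>(sc, br)\<close> with bracket \<open>P\<close> is the
  Poisson-Ore extension for \<open>\<alpha>\<close> and \<open>\<delta>\<close>.  Such a \<open>P\<close> exists and is unique; it is characterised
  by extending \<open>br\<close> and by its values \<open>{a, t} = \<alpha>(a) t + \<delta>(a)\<close>.
\<close>

definition poisson_ore ::
  "('k::field \<Rightarrow> 'a::comm_ring_1 \<Rightarrow> 'a) \<Rightarrow> ('a \<Rightarrow> 'a \<Rightarrow> 'a) \<Rightarrow> ('a \<Rightarrow> 'a) \<Rightarrow> ('a \<Rightarrow> 'a) \<Rightarrow>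
   ('a poly \<Rightarrow> 'a poly \<Rightarrow> 'a poly) \<Rightarrow> bool" where
  "poisson_ore sc br \<alpha> \<delta> P \<longleftrightarrow>
     poisson_derivation_on UNIV sc br \<alpha> \<and> poisson_alpha_derivation_on UNIV sc br \<alpha> \<delta> \<and>
     poisson_algebra (poly_scale sc) P \<and>
     (\<forall>a b. P [:a:] [:b:] = [:br a b:]) \<and> (\<forall>a. P [:a:] [:0, 1:] = [:\<delta> a, \<alpha> a:])"


subsection \<open>Makar-Limanov invariant and divisor subalgebras\<close>

definition locally_nilpotent :: "('a::comm_ring_1 \<Rightarrow> 'a) \<Rightarrow> bool" where
  "locally_nilpotent d \<longleftrightarrow> (\<forall>a. \<exists>N. \<forall>n\<ge>N. (d ^^ n) a = 0)"

definition PML ::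
  "('k::field \<Rightarrow> 'a::comm_ring_1 \<Rightarrow> 'a) \<Rightarrow> ('a \<Rightarrow> 'a \<Rightarrow> 'a) \<Rightarrow> 'a set" where
  "PML sc br = (\<Inter>d \<in> {d. poisson_derivation_on UNIV sc br d \<and> locally_nilpotent d}. {a. d a = 0})"

definition Sw :: "'a::comm_ring_1 set \<Rightarrow> 'a set" where
  "Sw F = {g. \<exists>f\<in>F. \<exists>b. f \<noteq> 0 \<and> f = g * b}"

primrec divisor_step ::
  "('k::field \<Rightarrow> 'a::comm_ring_1 \<Rightarrow> 'a) \<Rightarrow> ('a \<Rightarrow> 'a \<Rightarrow> 'a) \<Rightarrow> 'a set \<Rightarrow> nat \<Rightarrow> 'a set" where
  "divisor_step sc br F 0 = F"
| "divisor_step sc br F (Suc n) = poisson_subalgebra sc br hull (Sw (divisor_step sc br F n))"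

definition divisor_subalgebra ::
  "('k::field \<Rightarrow> 'a::comm_ring_1 \<Rightarrow> 'a) \<Rightarrow> ('a \<Rightarrow> 'a \<Rightarrow> 'a) \<Rightarrow> 'a set \<Rightarrow> 'a set" where
  "divisor_subalgebra sc br F = (\<Union>n. divisor_step sc br F n)"


subsection \<open>Stratiform Poisson algebras\<close>

definition finite_over :: "'a::comm_ring_1 set \<Rightarrow> 'a set \<Rightarrow> bool" where
  "finite_over T S \<longleftrightarrow>
     (\<exists>G. finite G \<and> G \<subseteq> T \<and> T = {(\<Sum>x\<in>G. c x * x) | c. c \<in> G \<rightarrow> S})"

definition polys_over :: "'a::comm_ring_1 set \<Rightarrow> 'a poly set" where
  "polys_over S = {p. \<forall>i. coeff p i \<in> S}"

text \<open>
  \<open>rational_functions_over T S t\<close>: the subring \<open>T\<close> is the algebra \<open>S(t)\<close> of rational functions,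
  that is, \<open>t\<close> is transcendental over \<open>S\<close> and \<open>T\<close> consists of the fractions of polynomials in \<open>t\<close>
  whose denominators are the nonzerodivisors of the polynomial ring over \<open>S\<close> (all nonzero
  polynomials if \<open>S\<close> is a field).
\<close>

definition regular_polys_over :: "'a::comm_ring_1 set \<Rightarrow> 'a poly set" where
  "regular_polys_over S = {q \<in> polys_over S. \<forall>r \<in> polys_over S. q * r = 0 \<longrightarrow> r = 0}"

definition rational_functions_over :: "'a::comm_ring_1 set \<Rightarrow> 'a set \<Rightarrow> 'a \<Rightarrow> bool" where
  "rational_functions_over T S t \<longleftrightarrow> S \<subseteq> T \<and> t \<in> T \<and>
     (\<forall>p \<in> polys_over S. poly p t = 0 \<longrightarrow> p = 0) \<and>
     (\<forall>q \<in> regular_polys_over S. \<exists>u\<in>T. poly q t * u = 1) \<and>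
     (\<forall>x\<in>T. \<exists>p \<in> polys_over S. \<exists>q \<in> regular_polys_over S. x * poly q t = poly p t)"

definition poisson_rational_extension ::
  "('k::field \<Rightarrow> 'a::comm_ring_1 \<Rightarrow> 'a) \<Rightarrow> ('a \<Rightarrow> 'a \<Rightarrow> 'a) \<Rightarrow> 'a set \<Rightarrow> 'a set \<Rightarrow> bool" where
  "poisson_rational_extension sc br T S \<longleftrightarrow>
     (\<exists>t \<alpha> \<delta>. rational_functions_over T S t \<and>
        poisson_derivation_on S sc br \<alpha> \<and> poisson_alpha_derivation_on S sc br \<alpha> \<delta> \<and>
        (\<forall>a\<in>S. br a t = \<alpha> a * t + \<delta> a))"

definition poisson_stratiform ::
  "('k::field \<Rightarrow> 'a::comm_ring_1 \<Rightarrow> 'a) \<Rightarrow> ('a \<Rightarrow> 'a \<Rightarrow> 'a) \<Rightarrow> bool" where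
  "poisson_stratiform sc br \<longleftrightarrow> poisson_algebra sc br \<and>
     (\<exists>n. \<exists>S :: nat \<Rightarrow> 'a set. S n = UNIV \<and> S 0 = range (\<lambda>c. sc c 1) \<and>
        (\<forall>i\<le>n. poisson_subalgebra sc br (S i) \<and> artinian_ring (subring_of_type (S i))) \<and>
        (\<forall>i<n. S i \<subseteq> S (Suc i) \<and>
           (finite_over (S (Suc i)) (S i) \<or> poisson_rational_extension sc br (S (Suc i)) (S i))))"

definition fract_scale :: "('k::field \<Rightarrow> 'a::idom \<Rightarrow> 'a) \<Rightarrow> 'k \<Rightarrow> 'a fract \<Rightarrow> 'a fract" where
  "fract_scale sc c x = Fract (sc c 1) 1 * x"

text \<open>The extension \<open>B\<close> of the bracket to the field of fractions exists and is unique.\<close>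

definition poisson_stratiform_domain ::
  "('k::field \<Rightarrow> 'a::idom \<Rightarrow> 'a) \<Rightarrow> ('a \<Rightarrow> 'a \<Rightarrow> 'a) \<Rightarrow> bool" where
  "poisson_stratiform_domain sc br \<longleftrightarrow> poisson_algebra sc br \<and>
     (\<exists>B. poisson_algebra (fract_scale sc) B \<and>
        (\<forall>a b. B (Fract a 1) (Fract b 1) = Fract (br a b) 1) \<and>
        poisson_stratiform (fract_scale sc) B)"

definition noetherian_poisson_stratiform_domain ::
  "('k::field \<Rightarrow> 'a::idom \<Rightarrow> 'a) \<Rightarrow> ('a \<Rightarrow> 'a \<Rightarrow> 'a) \<Rightarrow> bool" where
  "noetherian_poisson_stratiform_domain sc br \<longleftrightarrow>
     noetherian_ring (ring_of_type_algebra :: 'a ring) \<and> poisson_stratiform_domain sc br"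


subsection \<open>Cancellation\<close>

text \<open>
  The competing algebra \<open>A'\<close> lives on a type \<open>'b\<close>, passed as a type argument where it is not
  determined otherwise; leaving \<open>'b\<close> free in a theorem quantifies over all \<open>A'\<close>.  (The zero ring
  is not covered by \<open>comm_ring_1\<close>, but its polynomial ring is zero, hence never isomorphic to
  one over the nonzero ring \<open>'a\<close>.)
\<close>

definition poisson_skew_cancellative_in ::
  "(('k::field \<Rightarrow> 'b::comm_ring_1 \<Rightarrow> 'b) \<Rightarrow> ('b \<Rightarrow> 'b \<Rightarrow> 'b) \<Rightarrow> bool) \<Rightarrow>
   ('k \<Rightarrow> 'a::comm_ring_1 \<Rightarrow> 'a) \<Rightarrow> ('a \<Rightarrow> 'a \<Rightarrow> 'a) \<Rightarrow> bool" where
  "poisson_skew_cancellative_in \<C> sc br \<longleftrightarrow>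
     (\<forall>sc' br' \<alpha> \<delta> \<alpha>' \<delta>' P P'.
        poisson_algebra sc' br' \<longrightarrow> \<C> sc' br' \<longrightarrow>
        poisson_ore sc br \<alpha> \<delta> P \<longrightarrow> poisson_ore sc' br' \<alpha>' \<delta>' P' \<longrightarrow>
        poisson_isomorphic (poly_scale sc) P (poly_scale sc') P' \<longrightarrow>
        poisson_isomorphic sc br sc' br')"

definition poisson_skew_cancellative ::
  "'b::comm_ring_1 itself \<Rightarrow> ('k::field \<Rightarrow> 'a::comm_ring_1 \<Rightarrow> 'a) \<Rightarrow> ('a \<Rightarrow> 'a \<Rightarrow> 'a) \<Rightarrow> bool" where
  "poisson_skew_cancellative _ sc br \<longleftrightarrow>
     poisson_skew_cancellative_in (\<lambda>(sc' :: 'k \<Rightarrow> 'b \<Rightarrow> 'b) br'. True) sc br"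

definition poisson_alpha_cancellative ::
  "'b::comm_ring_1 itself \<Rightarrow> ('k::field \<Rightarrow> 'a::comm_ring_1 \<Rightarrow> 'a) \<Rightarrow> ('a \<Rightarrow> 'a \<Rightarrow> 'a) \<Rightarrow> bool" where
  "poisson_alpha_cancellative _ sc br \<longleftrightarrow>
     (\<forall>(sc' :: 'k \<Rightarrow> 'b \<Rightarrow> 'b) br' \<alpha> \<alpha>' P P'.
        poisson_algebra sc' br' \<longrightarrow>
        poisson_ore sc br \<alpha> (\<lambda>_. 0) P \<longrightarrow> poisson_ore sc' br' \<alpha>' (\<lambda>_. 0) P' \<longrightarrow>
        poisson_isomorphic (poly_scale sc) P (poly_scale sc') P' \<longrightarrow>
        poisson_isomorphic sc br sc' br')"

definition poisson_delta_cancellative ::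
  "'b::comm_ring_1 itself \<Rightarrow> ('k::field \<Rightarrow> 'a::comm_ring_1 \<Rightarrow> 'a) \<Rightarrow> ('a \<Rightarrow> 'a \<Rightarrow> 'a) \<Rightarrow> bool" where
  "poisson_delta_cancellative _ sc br \<longleftrightarrow>
     (\<forall>(sc' :: 'k \<Rightarrow> 'b \<Rightarrow> 'b) br' \<delta> \<delta>' P P'.
        poisson_algebra sc' br' \<longrightarrow>
        poisson_ore sc br (\<lambda>_. 0) \<delta> P \<longrightarrow> poisson_ore sc' br' (\<lambda>_. 0) \<delta>' P' \<longrightarrow>
        poisson_isomorphic (poly_scale sc) P (poly_scale sc') P' \<longrightarrow>
        poisson_isomorphic sc br sc' br')"

end

theory Submission imports Defs begin

text \<open>
  Let \<open>\<phi> : A[t] \<rightarrow> A'[t']\<close> be an isomorphism of Poisson-Ore extensions with inverse \<open>\<psi>\<close>. Transporting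
  \<open>d/dt'\<close> to \<open>A[t]\<close> gives a locally nilpotent derivation \<open>d = \<psi> \<circ> d/dt' \<circ> \<phi>\<close> whose ring of constants is
  \<open>\<psi>(A')\<close>. If \<open>d\<close> vanishes on \<open>A\<close>, then \<open>\<phi>\<close> maps \<open>A\<close> onto \<open>A'\<close> and is the wanted isomorphism
  (\<open>isomorphic_if_constants_to_constants\<close>). Each of the four parts either proves \<open>d(A) = 0\<close> or
  produces an isomorphism by another argument.

  Divisor subalgebra: over a domain of characteristic zero the constants of a locally nilpotent
  derivation are closed under nonzero divisors, because the last nonzero iterated derivatives of two
  elements multiply to a nonzero one. The constants \<open>\<psi>(A')\<close> also form a Poisson subalgebra. Hence the
  elements of \<open>A\<close> killed by \<open>d\<close> contain every step of the construction of \<open>\<D>(1)\<close>, and \<open>\<D>(1) = A\<close> gives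
  \<open>d(A) = 0\<close>. This settles both skew cancellation statements.

  Makar-Limanov invariant: suppose that \<open>d(A) \<noteq> 0\<close> and that the degrees of \<open>d(a)\<close>, \<open>a \<in> A\<close>, are bounded and let \<open>N\<close> be the
  largest. The coefficient of \<open>t\<^sup>N\<close> in \<open>d(a)\<close> is then a nonzero derivation \<open>D\<close> of \<open>A\<close>; it is locally
  nilpotent since it is the top homogeneous part of \<open>d\<close>, and when \<open>\<alpha> = \<alpha>' = 0\<close> it is a Poisson
  derivation, contradicting \<open>PML(A) = A\<close>. So all depends on the bound, which is immediate for a
  finitely generated algebra but not for a noetherian one. It is obtained as follows. Let \<open>\<Omega>\<close> be the
  algebraic closure of the field of fractions of \<open>A[t]\<close>. Starting from the inclusion, consider all
  homomorphisms \<open>x : A[t] \<rightarrow> \<Omega>\<close> reached in finitely many steps, each of which changes \<open>x\<close> but keeps its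
  restriction either to \<open>A\<close> or to \<open>\<psi>(A')\<close>. As \<open>A\<close> is noetherian, one of them has a maximal kernel on
  \<open>A\<close>. For this \<open>x\<close> every \<open>x(a)\<close> is algebraic over \<open>A\<close> and over \<open>\<psi>(A')\<close>, since otherwise \<open>x(a)\<close> could be
  specialised to an integer (\<open>orb_specialise\<close>), enlarging the kernel. So the minimal
  polynomial of \<open>x(a)\<close> has coefficients that are constants for \<open>d/dt\<close> and for \<open>d\<close>, and therefore
  constants for each coefficient of \<open>d\<close>. On the other hand each step adjoins only one element, so \<open>A\<close>
  lies in the ring generated by \<open>x(A)\<close> and finitely many elements of \<open>\<Omega>\<close>, and any finite set in \<open>\<Omega>\<close> is
  algebraic over the constants of the \<open>n\<close>-th coefficient of \<open>d\<close> as soon as \<open>n\<close> is large, because the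
  minimal polynomials involve only finitely many elements of \<open>A\<close>. For such \<open>n\<close>
  all of \<open>A\<close> is algebraic over these constants and the coefficient vanishes on \<open>A\<close>
  (\<open>derivation_degree_bounded\<close>).

  Poisson simple algebras: \<open>\<delta>' = 0\<close> makes \<open>t'\<close> divide each bracket with \<open>t'\<close>, hence \<open>q = \<psi>(t')\<close> divides
  each bracket with \<open>q\<close>. Comparing coefficients of \<open>t\<close>, each coefficient of \<open>q\<close> generates a
  Poisson ideal of \<open>A\<close> and so is zero or a unit, that is, a scalar. If \<open>\<alpha> \<noteq> 0\<close> then \<open>q\<close> is a
  monomial, and if \<open>\<alpha> = 0\<close> a divisibility argument is available; in both cases \<open>q\<close> has degree one in
  \<open>t\<close> and \<open>A \<cong> A[t]/(q) \<cong> A'[t']/(t') \<cong> A'\<close> (\<open>isomorphic_if_poisson_simple\<close>).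

  Affine curves: if \<open>d(A) \<noteq> 0\<close>, then \<open>A\<close> has a nonzero locally nilpotent derivation as above. Dimension
  one forces its ring of constants \<open>K\<close> to be a field (\<open>constants_are_units\<close>), algebraic over the
  ground field, and then \<open>A = K[s]\<close> is a polynomial ring with zero bracket. The same holds for
  \<open>A' = K'[s']\<close>, with \<open>K' \<cong> K\<close> (\<open>isomorphic_if_affine_curve\<close>).
\<close>

section \<open>Subrings and homomorphisms into an algebraically closed field\<close>

definition subring_set :: "'r::comm_ring_1 set \<Rightarrow> bool" where
  "subring_set S \<longleftrightarrow> 1 \<in> S \<and> (\<forall>x\<in>S. \<forall>y\<in>S. x + y \<in> S \<and> x * y \<in> S) \<and> (\<forall>x\<in>S. - x \<in> S)"

inductive_set generated_subring :: "'r::comm_ring_1 set \<Rightarrow> 'r set" for G where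
  base: "x \<in> G \<Longrightarrow> x \<in> generated_subring G"
| one: "1 \<in> generated_subring G"
| add: "x \<in> generated_subring G \<Longrightarrow> y \<in> generated_subring G \<Longrightarrow> x + y \<in> generated_subring G"
| mult: "x \<in> generated_subring G \<Longrightarrow> y \<in> generated_subring G \<Longrightarrow> x * y \<in> generated_subring G"
| uminus: "x \<in> generated_subring G \<Longrightarrow> - x \<in> generated_subring G"

lemma subring_set_generated: "subring_set (generated_subring G)"
  unfolding subring_set_def by (auto intro: generated_subring.intros)

lemma generated_subring_minimal:
  assumes "subring_set S" "G \<subseteq> S" shows "generated_subring G \<subseteq> S"
proof
  fix x assume "x \<in> generated_subring G"
  then show "x \<in> S"
    by induction (use assms in \<open>auto simp: subring_set_def\<close>)
qed

lemma generated_subring_mono: "G \<subseteq> Y \<Longrightarrow> generated_subring G \<subseteq> generated_subring Y"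
  by (meson generated_subring.base generated_subring_minimal subring_set_generated subset_iff)

context
  fixes S :: "'r::comm_ring_1 set"
  assumes S: "subring_set S"
begin

lemma subring_set_simps:
  "1 \<in> S" "0 \<in> S" "x \<in> S \<Longrightarrow> y \<in> S \<Longrightarrow> x + y \<in> S" "x \<in> S \<Longrightarrow> y \<in> S \<Longrightarrow> x * y \<in> S"
  "x \<in> S \<Longrightarrow> - x \<in> S" "x \<in> S \<Longrightarrow> y \<in> S \<Longrightarrow> x - y \<in> S"
proof -
  have "1 + - 1 \<in> S" using S unfolding subring_set_def by blast
  then show 0: "0 \<in> S" by simp
  show "x - y \<in> S" if "x \<in> S" "y \<in> S"
    using S that unfolding subring_set_def by (metis diff_conv_add_uminus)
qed (use S in \<open>simp_all add: subring_set_def\<close>)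

lemma subring_set_sum: "(\<And>i. i \<in> I \<Longrightarrow> f i \<in> S) \<Longrightarrow> sum f I \<in> S"
  by (induction I rule: infinite_finite_induct) (auto intro: subring_set_simps)

lemma subring_set_power: "x \<in> S \<Longrightarrow> x ^ n \<in> S"
  by (induction n) (auto intro: subring_set_simps)

lemma subring_set_of_nat: "of_nat n \<in> S"
  by (induction n) (auto intro: subring_set_simps)

lemma polys_over_simps:
  "0 \<in> polys_over S" "1 \<in> polys_over S"
  "p \<in> polys_over S \<Longrightarrow> q \<in> polys_over S \<Longrightarrow> p + q \<in> polys_over S"
  "p \<in> polys_over S \<Longrightarrow> q \<in> polys_over S \<Longrightarrow> p - q \<in> polys_over S"
  "p \<in> polys_over S \<Longrightarrow> q \<in> polys_over S \<Longrightarrow> p * q \<in> polys_over S"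
  "p \<in> polys_over S \<Longrightarrow> - p \<in> polys_over S"
  "a \<in> S \<Longrightarrow> p \<in> polys_over S \<Longrightarrow> smult a p \<in> polys_over S"
  "a \<in> S \<Longrightarrow> p \<in> polys_over S \<Longrightarrow> pCons a p \<in> polys_over S"
  "a \<in> S \<Longrightarrow> monom a n \<in> polys_over S"
  by (auto simp: polys_over_def coeff_mult coeff_pCons coeff_1 split: nat.splits
      intro!: subring_set_simps subring_set_sum)

lemma poly_polys_over_closed: "p \<in> polys_over S \<Longrightarrow> x \<in> S \<Longrightarrow> poly p x \<in> S"
  unfolding poly_altdef by (auto simp: polys_over_def intro!: subring_set_sum subring_set_simps subring_set_power)

end

lemma pderiv_polys_over:
  fixes S :: "'r::idom set"
  assumes S: "subring_set S" and p: "p \<in> polys_over S"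
  shows "pderiv p \<in> polys_over S"
  using p by (simp add: polys_over_def coeff_pderiv subring_set_simps[OF S] subring_set_of_nat[OF S] del: of_nat_Suc)

lemma polys_over_mono: "S \<subseteq> T \<Longrightarrow> polys_over S \<subseteq> polys_over T"
  by (auto simp: polys_over_def)

definition ring_hom_on :: "'r::comm_ring_1 set \<Rightarrow> ('r \<Rightarrow> 's::comm_ring_1) \<Rightarrow> bool" where
  "ring_hom_on S h \<longleftrightarrow> h 1 = 1 \<and> (\<forall>x\<in>S. \<forall>y\<in>S. h (x + y) = h x + h y \<and> h (x * y) = h x * h y)"

context
  fixes S :: "'r::comm_ring_1 set" and h :: "'r \<Rightarrow> 's::comm_ring_1"
  assumes S: "subring_set S" and h: "ring_hom_on S h"
begin

lemma ring_hom_on_simps: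
  "h 0 = 0" "h 1 = 1" "x \<in> S \<Longrightarrow> y \<in> S \<Longrightarrow> h (x + y) = h x + h y"
  "x \<in> S \<Longrightarrow> y \<in> S \<Longrightarrow> h (x * y) = h x * h y"
  "x \<in> S \<Longrightarrow> h (- x) = - h x"
proof -
  have "h (0 + 0) = h 0 + h 0" using h subring_set_simps(2)[OF S] unfolding ring_hom_on_def by blast
  then show 0: "h 0 = 0" by simp
  show "h (- x) = - h x" if "x \<in> S"
  proof -
    have "h (x + - x) = h x + h (- x)"
      using h that subring_set_simps(5)[OF S] unfolding ring_hom_on_def by blast
    then show ?thesis using 0 by (simp add: eq_neg_iff_add_eq_0 add.commute)
  qed
qed (use h in \<open>auto simp: ring_hom_on_def\<close>)

lemma ring_hom_on_sum: "(\<And>i. i \<in> I \<Longrightarrow> f i \<in> S) \<Longrightarrow> h (sum f I) = (\<Sum>i\<in>I. h (f i))"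
proof (induction I rule: infinite_finite_induct)
  case (insert i I)
  have "sum f I \<in> S" using insert by (auto intro: subring_set_sum[OF S])
  then show ?case using insert by (simp add: ring_hom_on_simps)
qed (auto simp: ring_hom_on_simps)

lemma ring_hom_on_power: "x \<in> S \<Longrightarrow> h (x ^ n) = h x ^ n"
  by (induction n) (auto simp: ring_hom_on_simps subring_set_power[OF S])

lemma ring_hom_on_of_nat: "h (of_nat n) = of_nat n"
  by (induction n) (auto simp: ring_hom_on_simps subring_set_of_nat[OF S] subring_set_simps[OF S])

lemma map_poly_ring_hom_on:
  assumes "p \<in> polys_over S" "q \<in> polys_over S"
  shows "map_poly h (p + q) = map_poly h p + map_poly h q"
    and "map_poly h (p * q) = map_poly h p * map_poly h q"
proof -
  note c = coeff_map_poly[of h, OF ring_hom_on_simps(1)]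
  have "coeff p i \<in> S" "coeff q i \<in> S" for i
    using assms by (auto simp: polys_over_def)
  then show "map_poly h (p + q) = map_poly h p + map_poly h q"
    and "map_poly h (p * q) = map_poly h p * map_poly h q"
    by (auto intro!: poly_eqI sum.cong simp: c ring_hom_on_simps coeff_mult ring_hom_on_sum
        subring_set_simps[OF S])
qed

lemma poly_map_poly_ring_hom_on:
  assumes "p \<in> polys_over S" "x \<in> S"
  shows "h (poly p x) = poly (map_poly h p) (h x)"
  using assms(1)
proof (induction p rule: pCons_induct)
  case 0
  then show ?case by (simp add: ring_hom_on_simps)
next
  case (pCons a p)
  have "coeff (pCons a p) i \<in> S" for i using pCons.prems by (simp add: polys_over_def)
  from this[of 0] this[of "Suc _"] have a: "a \<in> S" and p: "p \<in> polys_over S"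
    by (auto simp: polys_over_def)
  have "h (poly (pCons a p) x) = h a + h x * h (poly p x)"
    using a assms(2) poly_polys_over_closed[OF S p assms(2)]
    by (simp add: ring_hom_on_simps subring_set_simps[OF S])
  then show ?case using pCons.IH[OF p] pCons.hyps
    by (simp add: map_poly_pCons ring_hom_on_simps)
qed

end

lemma ring_hom_on_subset: "ring_hom_on T h \<Longrightarrow> S \<subseteq> T \<Longrightarrow> ring_hom_on S h"
  by (auto simp: ring_hom_on_def)

lemma subring_set_image:
  assumes S: "subring_set S" and h: "ring_hom_on S h"
  shows "subring_set (h ` S)"
proof -
  note * = subring_set_simps[OF S] and ** = ring_hom_on_simps[OF S h]
  have "h a + h b \<in> h ` S" "h a * h b \<in> h ` S" "- h a \<in> h ` S" if "a \<in> S" "b \<in> S" for a b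
    using that * by (simp_all flip: **)
  moreover have "1 \<in> h ` S" using *(1) **(2) by (metis image_eqI)
  ultimately show ?thesis unfolding subring_set_def by auto
qed

definition adjoin :: "'r::comm_ring_1 set \<Rightarrow> 'r \<Rightarrow> 'r set" where
  "adjoin U g = {poly p g | p. p \<in> polys_over U}"

lemma subring_set_adjoin:
  assumes U: "subring_set U" shows "subring_set (adjoin U g)"
proof -
  note * = polys_over_simps[OF U]
  have "1 \<in> adjoin U g" unfolding adjoin_def using *(2) by force
  moreover have "x + y \<in> adjoin U g" "x * y \<in> adjoin U g" "- x \<in> adjoin U g"
    if xy: "x \<in> adjoin U g" "y \<in> adjoin U g" for x y
  proof -
    obtain p q where pq: "p \<in> polys_over U" "q \<in> polys_over U" "x = poly p g" "y = poly q g"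
      using xy by (auto simp: adjoin_def)
    show "x + y \<in> adjoin U g" "x * y \<in> adjoin U g" "- x \<in> adjoin U g"
      unfolding adjoin_def mem_Collect_eq
      using *(3)[OF pq(1,2)] *(5)[OF pq(1,2)] *(6)[OF pq(1)] pq(3,4)
      by (intro exI[of _ "p + q"] exI[of _ "p * q"] exI[of _ "- p"]; simp)+
  qed
  ultimately show ?thesis unfolding subring_set_def by simp
qed

lemma adjoin_superset:
  assumes U: "subring_set U" shows "U \<subseteq> adjoin U g" "g \<in> adjoin U g"
proof
  fix u assume "u \<in> U"
  then have "[:u:] \<in> polys_over U" using polys_over_simps[OF U] by auto
  then show "u \<in> adjoin U g" unfolding adjoin_def by force
next
  have "[:0, 1:] \<in> polys_over U" using polys_over_simps[OF U] subring_set_simps[OF U] by auto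
  then show "g \<in> adjoin U g" unfolding adjoin_def by force
qed

lemma generated_subring_adjoin:
  assumes U: "subring_set U"
  shows "generated_subring (U \<union> insert g G) = generated_subring (adjoin U g \<union> G)"
proof
  show "generated_subring (U \<union> insert g G) \<subseteq> generated_subring (adjoin U g \<union> G)"
    using adjoin_superset[OF U, of g] by (intro generated_subring_mono) auto
  have "adjoin U g \<subseteq> generated_subring (U \<union> insert g G)"
  proof
    fix x assume "x \<in> adjoin U g"
    then obtain p where p: "p \<in> polys_over U" "x = poly p g" by (auto simp: adjoin_def)
    have "U \<subseteq> generated_subring (U \<union> insert g G)" by (auto intro: generated_subring.base)
    then have "p \<in> polys_over (generated_subring (U \<union> insert g G))"
      using p polys_over_mono by blast
    then show "x \<in> generated_subring (U \<union> insert g G)"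
      unfolding p(2) by (intro poly_polys_over_closed subring_set_generated) (auto intro: generated_subring.base)
  qed
  then show "generated_subring (adjoin U g \<union> G) \<subseteq> generated_subring (U \<union> insert g G)"
    by (intro generated_subring_minimal subring_set_generated) (auto intro: generated_subring.base)
qed

lemma ring_hom_on_adjoin:
  fixes U :: "'r::comm_ring_1 set" and \<xi> :: "'r \<Rightarrow> 's::comm_ring_1"
  assumes U: "subring_set U" and \<xi>: "ring_hom_on U \<xi>"
    and ker: "\<forall>q\<in>polys_over U. poly q g = 0 \<longrightarrow> poly (map_poly \<xi> q) \<gamma> = 0"
  obtains \<xi>' where "ring_hom_on (adjoin U g) \<xi>'"
    "\<And>q. q \<in> polys_over U \<Longrightarrow> \<xi>' (poly q g) = poly (map_poly \<xi> q) \<gamma>" "\<And>u. u \<in> U \<Longrightarrow> \<xi>' u = \<xi> u"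
proof -
  define \<xi>' where "\<xi>' x = poly (map_poly \<xi> (SOME q. q \<in> polys_over U \<and> x = poly q g)) \<gamma>" for x
  note hom = map_poly_ring_hom_on[OF U \<xi>]
  note c = coeff_map_poly[of \<xi>, OF ring_hom_on_simps(1)[OF U \<xi>]]
  have neg: "map_poly \<xi> (- q) = - map_poly \<xi> q" if "q \<in> polys_over U" for q
    by (rule poly_eqI) (use that in \<open>simp add: c ring_hom_on_simps[OF U \<xi>] polys_over_def\<close>)
  have eval: "\<xi>' (poly q g) = poly (map_poly \<xi> q) \<gamma>" if q: "q \<in> polys_over U" for q
  proof -
    define q' where "q' = (SOME q'. q' \<in> polys_over U \<and> poly q g = poly q' g)"
    have q': "q' \<in> polys_over U \<and> poly q g = poly q' g"
      unfolding q'_def by (rule someI[of _ q]) (use q in auto)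
    have "poly (map_poly \<xi> (q + - q')) \<gamma> = 0"
      by (rule ker[rule_format]) (use q q' polys_over_simps[OF U] in auto)
    then have "poly (map_poly \<xi> q) \<gamma> = poly (map_poly \<xi> q') \<gamma>"
      using q q' by (simp add: hom neg polys_over_simps[OF U] add_eq_0_iff2 del: add_uminus_conv_diff)
    then show ?thesis unfolding \<xi>'_def q'_def by simp
  qed
  show thesis
  proof (rule that)
    show "\<xi>' u = \<xi> u" if "u \<in> U" for u
    proof -
      have "[:u:] \<in> polys_over U" using that polys_over_simps[OF U] by auto
      from eval[OF this] show ?thesis
        by (cases "u = 0") (auto simp: map_poly_pCons ring_hom_on_simps[OF U \<xi>])
    qed
    then have "\<xi>' 1 = 1" using subring_set_simps[OF U] ring_hom_on_simps[OF U \<xi>] by auto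
    moreover have "\<xi>' (x + y) = \<xi>' x + \<xi>' y" "\<xi>' (x * y) = \<xi>' x * \<xi>' y"
      if xy: "x \<in> adjoin U g" "y \<in> adjoin U g" for x y
    proof -
      obtain p q where pq: "p \<in> polys_over U" "q \<in> polys_over U" "x = poly p g" "y = poly q g"
        using xy by (auto simp: adjoin_def)
      show "\<xi>' (x + y) = \<xi>' x + \<xi>' y" "\<xi>' (x * y) = \<xi>' x * \<xi>' y"
        using eval[of "p + q"] eval[of "p * q"] pq polys_over_simps[OF U] by (simp_all add: eval hom)
    qed
    ultimately show "ring_hom_on (adjoin U g) \<xi>'" by (auto simp: ring_hom_on_def)
  qed (rule eval)
qed

lemma pseudo_division_over:
  fixes U :: "'r::idom set"
  assumes U: "subring_set U" and m: "m \<in> polys_over U" "m \<noteq> 0" and q: "q \<in> polys_over U"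
  shows "\<exists>k s r. s \<in> polys_over U \<and> r \<in> polys_over U \<and>
    smult (lead_coeff m ^ k) q = s * m + r \<and> (r = 0 \<or> degree r < degree m)"
  using q
proof (induction "degree q" arbitrary: q rule: less_induct)
  case less
  note * = polys_over_simps[OF U]
  show ?case
  proof (cases "q = 0 \<or> degree q < degree m")
    case True
    then show ?thesis
      using less.prems *(1) by (intro exI[of _ 0] exI[of _ 0] exI[of _ q]) auto
  next
    case False
    define e where "e = monom (lead_coeff q) (degree q - degree m)"
    define q' where "q' = smult (lead_coeff m) q - e * m"
    have lc: "lead_coeff q \<in> U" "lead_coeff m \<in> U" using less.prems m by (auto simp: polys_over_def)
    have e: "e \<in> polys_over U" unfolding e_def using lc * by auto
    have q': "q' \<in> polys_over U" unfolding q'_def using e m less.prems * lc by auto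
    have e0: "e \<noteq> 0" "degree e = degree q - degree m"
      using False by (auto simp: e_def degree_monom_eq)
    have deg: "degree (e * m) = degree q" using e0 m False by (simp add: degree_mult_eq)
    have le: "degree q' \<le> degree q" unfolding q'_def
      using deg by (intro degree_diff_le) auto
    have "coeff (e * m) (degree q) = lead_coeff e * lead_coeff m"
      using deg lead_coeff_mult[of e m] by metis
    then have c0: "coeff q' (degree q) = 0"
      unfolding q'_def using e0 by (simp add: e_def mult.commute)
    have "\<exists>k s r. s \<in> polys_over U \<and> r \<in> polys_over U \<and>
      smult (lead_coeff m ^ k) q' = s * m + r \<and> (r = 0 \<or> degree r < degree m)"
    proof (cases "degree q' < degree q")
      case True
      then show ?thesis using less.hyps[OF True q'] by blast
    next
      case False
      then have "degree q' = degree q" using le by simp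
      then have "q' = 0" using c0 leading_coeff_0_iff[of q'] by simp
      then show ?thesis using *(1) by (intro exI[of _ 0] exI[of _ 0] exI[of _ 0]) auto
    qed
    then obtain k s r where sr: "s \<in> polys_over U" "r \<in> polys_over U"
      "smult (lead_coeff m ^ k) q' = s * m + r" "r = 0 \<or> degree r < degree m" by blast
    have "smult (lead_coeff m ^ Suc k) q = smult (lead_coeff m ^ k) q' + smult (lead_coeff m ^ k) e * m"
      unfolding q'_def by (simp add: smult_diff_right mult.commute)
    also have "\<dots> = (s + smult (lead_coeff m ^ k) e) * m + r"
      by (simp add: sr algebra_simps)
    finally show ?thesis using sr e * subring_set_power[OF U lc(2)]
      by (intro exI[of _ "Suc k"] exI[of _ "s + smult (lead_coeff m ^ k) e"] exI[of _ r]) auto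
  qed
qed

text \<open>For \<open>g\<close> algebraic over a domain \<open>U\<close> there need not be a monic minimal polynomial over \<open>U\<close>. A root
  polynomial \<open>m\<close> of least degree still generates all of them after multiplication by powers of its
  leading coefficient, which is what extending a homomorphism from \<open>U\<close> to \<open>U[g]\<close> requires.\<close>

lemma root_multiple_of_minimal:
  fixes U :: "'r::idom set"
  assumes U: "subring_set U" and m: "m \<in> polys_over U" "m \<noteq> 0" "poly m g = 0"
    and min: "\<And>q. q \<in> polys_over U \<Longrightarrow> poly q g = 0 \<Longrightarrow> degree q < degree m \<Longrightarrow> q = 0"
    and q: "q \<in> polys_over U" "poly q g = 0"
  obtains k s where "s \<in> polys_over U" "smult (lead_coeff m ^ k) q = s * m"
proof -
  obtain k s r where sr: "s \<in> polys_over U" "r \<in> polys_over U"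
    "smult (lead_coeff m ^ k) q = s * m + r" "r = 0 \<or> degree r < degree m"
    using pseudo_division_over[OF U m(1,2) q(1)] by blast
  have "poly (smult (lead_coeff m ^ k) q) g = poly (s * m + r) g" using sr by simp
  then have "poly r g = 0" using m q by simp
  then have "r = 0" using min sr by blast
  then show thesis using that sr by auto
qed

text \<open>A multiple of \<open>poly p g\<close> that is represented by a polynomial of least degree is represented by a
  constant: dividing \<open>m\<close> by a representative \<open>d\<close> of positive degree either gives a multiple represented
  in smaller degree or a polynomial of smaller degree than \<open>m\<close> that vanishes at \<open>g\<close>.\<close>

lemma nonzero_multiple_in_base:
  fixes U :: "'r::idom set"
  assumes U: "subring_set U" and m: "m \<in> polys_over U" "m \<noteq> 0" "poly m g = 0"
    and min: "\<And>q. q \<in> polys_over U \<Longrightarrow> poly q g = 0 \<Longrightarrow> degree q < degree m \<Longrightarrow> q = 0"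
    and p: "p \<in> polys_over U" "poly p g \<noteq> 0"
  obtains a v where "a \<in> polys_over U" "v \<in> U" "v \<noteq> 0" "v = poly a g * poly p g"
proof -
  define Q where "Q d \<longleftrightarrow> d \<in> polys_over U \<and> poly d g \<noteq> 0 \<and> (\<exists>a\<in>polys_over U. poly d g = poly a g * poly p g)" for d
  note * = polys_over_simps[OF U]
  have "Q p" unfolding Q_def using p *(2) by force
  then obtain d where d: "Q d" and dmin: "\<And>e. Q e \<Longrightarrow> degree d \<le> degree e"
    using ex_has_least_nat[of Q p degree] by blast
  then obtain a where a: "a \<in> polys_over U" "poly d g = poly a g * poly p g" by (auto simp: Q_def)
  have dU: "d \<in> polys_over U" "poly d g \<noteq> 0" "d \<noteq> 0" using d by (auto simp: Q_def)
  have le: "degree d \<le> degree m"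
  proof -
    obtain k s r where sr: "s \<in> polys_over U" "r \<in> polys_over U"
      "smult (lead_coeff m ^ k) d = s * m + r" "r = 0 \<or> degree r < degree m"
      using pseudo_division_over[OF U m(1,2) dU(1)] by blast
    have "poly (smult (lead_coeff m ^ k) d) g = poly (s * m + r) g" using sr by simp
    then have e: "poly r g = poly (smult (lead_coeff m ^ k) a) g * poly p g" using m a by (simp add: mult.assoc)
    have "lead_coeff m ^ k \<in> U" using m subring_set_power[OF U] by (auto simp: polys_over_def)
    then have "smult (lead_coeff m ^ k) a \<in> polys_over U" using * a by auto
    moreover have "poly r g \<noteq> 0" using e m a dU by auto
    ultimately have "Q r" unfolding Q_def using sr e by blast
    then have "degree d \<le> degree r" "r \<noteq> 0" using dmin \<open>poly r g \<noteq> 0\<close> by auto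
    then show ?thesis using sr by auto
  qed
  have "degree d = 0"
  proof (rule ccontr)
    assume nz: "degree d \<noteq> 0"
    obtain k s r where sr: "s \<in> polys_over U" "r \<in> polys_over U"
      "smult (lead_coeff d ^ k) m = s * d + r" "r = 0 \<or> degree r < degree d"
      using pseudo_division_over[OF U dU(1,3) m(1)] by blast
    have "poly (smult (lead_coeff d ^ k) m) g = poly (s * d + r) g" using sr by simp
    then have e: "poly r g = poly (- (s * a)) g * poly p g"
      using m a by (simp add: algebra_simps eq_neg_iff_add_eq_0)
    have r0: "poly r g = 0"
    proof (rule ccontr)
      assume "poly r g \<noteq> 0"
      moreover have "- (s * a) \<in> polys_over U" using sr(1) a(1) by (intro *(5,6))
      ultimately have "Q r" unfolding Q_def using sr(2) e by (intro conjI bexI[of _ "- (s * a)"])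
      from dmin[OF this] show False using sr(4) \<open>poly r g \<noteq> 0\<close> by (cases "r = 0") auto
    qed
    then have "r = 0" using min[OF sr(2) r0] sr le by auto
    then have eq: "smult (lead_coeff d ^ k) m = s * d" using sr by simp
    then have "s \<noteq> 0" using m dU by auto
    have "degree m = degree s + degree d"
      using arg_cong[OF eq, of degree] dU \<open>s \<noteq> 0\<close> by (simp add: degree_mult_eq)
    moreover have "poly s g = 0" using arg_cong[OF eq, of "\<lambda>p. poly p g"] m dU by simp
    ultimately show False using min[OF sr(1)] nz \<open>s \<noteq> 0\<close> by simp
  qed
  then obtain v where v: "d = [:v:]" by (meson degree_eq_zeroE)
  have "coeff d 0 \<in> U" using dU(1) unfolding polys_over_def by blast
  then have "v \<in> U" "v \<noteq> 0" "v = poly a g * poly p g" using v dU(3) a(2) by simp_all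
  then show thesis using that a(1) by blast
qed

text \<open>If \<open>g\<close> is transcendental over \<open>U\<close>, a nonzero \<open>w = p(g)\<close> survives as long as one coefficient of \<open>p\<close>
  does, since over an infinite field \<open>g\<close> can be sent to a non-root. If \<open>g\<close> is algebraic, it can be sent
  to any root of the image of its least polynomial \<open>m\<close>, provided the leading coefficient of \<open>m\<close>
  survives, and \<open>w\<close> survives if a multiple of it in \<open>U\<close> does. So \<open>v\<close> is the leading coefficient of \<open>p\<close>
  in the first case and the product of the two elements of \<open>U\<close> in the second.\<close>

lemma extend_hom_adjoin:
  fixes U :: "'o::alg_closed_field set"
  assumes U: "subring_set U" and w: "w \<in> adjoin U g" "w \<noteq> 0"
  obtains v where "v \<in> U" "v \<noteq> 0"
    "\<And>\<xi> :: 'o \<Rightarrow> 'o. ring_hom_on U \<xi> \<Longrightarrow> \<xi> v \<noteq> 0 \<Longrightarrow>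
      \<exists>\<xi>'. ring_hom_on (adjoin U g) \<xi>' \<and> (\<forall>u\<in>U. \<xi>' u = \<xi> u) \<and> \<xi>' w \<noteq> 0"
proof -
  obtain p where p: "p \<in> polys_over U" "w = poly p g" using w by (auto simp: adjoin_def)
  note * = polys_over_simps[OF U]
  show thesis
  proof (cases "\<forall>q\<in>polys_over U. poly q g = 0 \<longrightarrow> q = 0")
    case True
    show thesis
    proof (rule that)
      show "lead_coeff p \<in> U" using p by (auto simp: polys_over_def)
      show "lead_coeff p \<noteq> 0" using w p by auto
      fix \<xi> :: "'o \<Rightarrow> 'o" assume \<xi>: "ring_hom_on U \<xi>" "\<xi> (lead_coeff p) \<noteq> 0"
      define P where "P = map_poly \<xi> p"
      have P: "P \<noteq> 0" using \<xi> coeff_map_poly[of \<xi> p "degree p", OF ring_hom_on_simps(1)[OF U \<xi>(1)]]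
        unfolding P_def by auto
      have "\<exists>\<gamma>. poly P \<gamma> \<noteq> 0"
      proof (cases "degree P = 0")
        case True
        then obtain a where "P = [:a:]" by (meson degree_eq_zeroE)
        then show ?thesis using P by auto
      next
        case False
        \<comment> \<open>An algebraically closed field has a point where the nonconstant \<open>P\<close> takes the value \<open>1\<close>.\<close>
        have "degree (- 1 + P) = degree P" using False
          by (intro degree_add_eq_right) simp
        then have "degree (P - 1) = degree P" by simp
        then obtain \<gamma> where "poly (P - 1) \<gamma> = 0" using False alg_closed_imp_poly_has_root[of "P - 1"] by auto
        then show ?thesis by (intro exI[of _ \<gamma>]) simp
      qed
      then obtain \<gamma> where \<gamma>: "poly P \<gamma> \<noteq> 0" by blast
      obtain \<xi>' where "ring_hom_on (adjoin U g) \<xi>'"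
        "\<And>q. q \<in> polys_over U \<Longrightarrow> \<xi>' (poly q g) = poly (map_poly \<xi> q) \<gamma>" "\<And>u. u \<in> U \<Longrightarrow> \<xi>' u = \<xi> u"
        by (rule ring_hom_on_adjoin[OF U \<xi>(1), of g \<gamma>]) (use True in auto)
      then show "\<exists>\<xi>'. ring_hom_on (adjoin U g) \<xi>' \<and> (\<forall>u\<in>U. \<xi>' u = \<xi> u) \<and> \<xi>' w \<noteq> 0"
        using p \<gamma> unfolding P_def by (intro exI[of _ \<xi>']) auto
    qed
  next
    case False
    define Q where "Q q \<longleftrightarrow> q \<in> polys_over U \<and> poly q g = 0 \<and> q \<noteq> 0" for q
    obtain m where m: "Q m" and mmin: "\<And>e. Q e \<Longrightarrow> degree m \<le> degree e"
    proof -
      obtain q where "Q q" using False unfolding Q_def by blast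
      then show thesis using ex_has_least_nat[of Q q degree] that by blast
    qed
    have mU: "m \<in> polys_over U" "m \<noteq> 0" "poly m g = 0" using m by (auto simp: Q_def)
    have min: "q = 0" if "q \<in> polys_over U" "poly q g = 0" "degree q < degree m" for q
      using that mmin[of q] by (auto simp: Q_def)
    obtain a v where av: "a \<in> polys_over U" "v \<in> U" "v \<noteq> 0" "v = poly a g * poly p g"
      using nonzero_multiple_in_base[OF U mU min p(1)] w p by blast
    show thesis
    proof (rule that)
      show "lead_coeff m * v \<in> U" using av mU subring_set_simps[OF U] by (auto simp: polys_over_def)
      show "lead_coeff m * v \<noteq> 0" using av mU by simp
      fix \<xi> :: "'o \<Rightarrow> 'o" assume \<xi>: "ring_hom_on U \<xi>" "\<xi> (lead_coeff m * v) \<noteq> 0"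
      note c = coeff_map_poly[of \<xi>, OF ring_hom_on_simps(1)[OF U \<xi>(1)]]
      have lm: "lead_coeff m \<in> U" using mU by (auto simp: polys_over_def)
      have nz: "\<xi> (lead_coeff m) \<noteq> 0" "\<xi> v \<noteq> 0"
        using \<xi>(2) av lm by (auto simp: ring_hom_on_simps[OF U \<xi>(1)])
      have "degree m \<noteq> 0"
      proof
        assume "degree m = 0"
        then obtain a where "m = [:a:]" by (meson degree_eq_zeroE)
        then show False using mU by auto
      qed
      moreover have "degree (map_poly \<xi> m) = degree m"
        by (intro map_poly_degree_eq) (use nz in auto)
      ultimately obtain \<gamma> where \<gamma>: "poly (map_poly \<xi> m) \<gamma> = 0"
        using alg_closed_imp_poly_has_root[of "map_poly \<xi> m"] by auto
      have ker: "poly (map_poly \<xi> q) \<gamma> = 0" if q: "q \<in> polys_over U" "poly q g = 0" for q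
      proof -
        obtain k s where ks: "s \<in> polys_over U" "smult (lead_coeff m ^ k) q = s * m"
          using root_multiple_of_minimal[OF U mU min q] by blast
        have "[:lead_coeff m ^ k:] \<in> polys_over U"
          using * subring_set_power[OF U lm] by auto
        then have "map_poly \<xi> ([:lead_coeff m ^ k:] * q) = map_poly \<xi> [:lead_coeff m ^ k:] * map_poly \<xi> q"
          by (intro map_poly_ring_hom_on[OF U \<xi>(1)] q)
        moreover have "map_poly \<xi> (s * m) = map_poly \<xi> s * map_poly \<xi> m"
          by (intro map_poly_ring_hom_on[OF U \<xi>(1)] ks mU)
        moreover have "[:lead_coeff m ^ k:] * q = s * m" using ks by simp
        ultimately have "map_poly \<xi> [:lead_coeff m ^ k:] * map_poly \<xi> q = map_poly \<xi> s * map_poly \<xi> m"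
          by simp
        from arg_cong[OF this, of "\<lambda>p. poly p \<gamma>"]
        have "poly (map_poly \<xi> [:lead_coeff m ^ k:]) \<gamma> * poly (map_poly \<xi> q) \<gamma> = 0"
          using \<gamma> by simp
        moreover have "poly (map_poly \<xi> [:lead_coeff m ^ k:]) \<gamma> = \<xi> (lead_coeff m) ^ k"
          using lm by (simp add: map_poly_pCons ring_hom_on_simps(1)[OF U \<xi>(1)] ring_hom_on_power[OF U \<xi>(1)])
        ultimately show ?thesis using nz by simp
      qed
      obtain \<xi>' where \<xi>': "ring_hom_on (adjoin U g) \<xi>'"
        "\<And>q. q \<in> polys_over U \<Longrightarrow> \<xi>' (poly q g) = poly (map_poly \<xi> q) \<gamma>" "\<And>u. u \<in> U \<Longrightarrow> \<xi>' u = \<xi> u"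
        by (rule ring_hom_on_adjoin[OF U \<xi>(1), of g \<gamma>]) (use ker in auto)
      have "\<xi>' v = \<xi>' (poly a g) * \<xi>' w"
        unfolding av(4) p(2) using av p
        by (intro ring_hom_on_simps(4)[OF subring_set_adjoin[OF U] \<xi>'(1)]) (auto simp: adjoin_def)
      then have "\<xi>' w \<noteq> 0" using \<xi>'(3)[OF av(2)] nz by auto
      then show "\<exists>\<xi>'. ring_hom_on (adjoin U g) \<xi>' \<and> (\<forall>u\<in>U. \<xi>' u = \<xi> u) \<and> \<xi>' w \<noteq> 0"
        using \<xi>' by blast
    qed
  qed
qed

text \<open>The extension theorem behind the Nullstellensatz: a homomorphism to an algebraically closed field
  extends to a finitely generated overring, keeping a given \<open>w\<close> nonzero, as soon as it does not kill a
  certain nonzero \<open>v\<close> of the base. Both rings lie in the target field itself, which suffices below.\<close>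

lemma extend_hom_finitely_generated:
  fixes U :: "'o::alg_closed_field set"
  assumes "finite G" and U: "subring_set U"
    and w: "w \<in> generated_subring (U \<union> G)" "w \<noteq> 0"
  shows "\<exists>v\<in>U. v \<noteq> 0 \<and> (\<forall>\<xi> :: 'o \<Rightarrow> 'o. ring_hom_on U \<xi> \<and> \<xi> v \<noteq> 0 \<longrightarrow>
      (\<exists>\<xi>'. ring_hom_on (generated_subring (U \<union> G)) \<xi>' \<and> (\<forall>u\<in>U. \<xi>' u = \<xi> u) \<and> \<xi>' w \<noteq> 0))"
  using assms
proof (induction G arbitrary: U rule: finite_induct)
  case empty
  have "generated_subring U = U"
    using generated_subring_minimal[OF empty(1), of U] by (auto intro: generated_subring.base)
  then show ?case using empty by auto
next
  case (insert g G)
  note eq = generated_subring_adjoin[OF insert.prems(1)]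
  have "\<exists>v\<in>adjoin U g. v \<noteq> 0 \<and> (\<forall>\<xi> :: 'o \<Rightarrow> 'o. ring_hom_on (adjoin U g) \<xi> \<and> \<xi> v \<noteq> 0 \<longrightarrow>
      (\<exists>\<xi>'. ring_hom_on (generated_subring (adjoin U g \<union> G)) \<xi>' \<and> (\<forall>u\<in>adjoin U g. \<xi>' u = \<xi> u) \<and> \<xi>' w \<noteq> 0))"
    by (rule insert.IH) (use insert.prems subring_set_adjoin eq in auto)
  then obtain v' where v': "v' \<in> adjoin U g" "v' \<noteq> 0" and ext: "\<And>\<xi> :: 'o \<Rightarrow> 'o.
      ring_hom_on (adjoin U g) \<xi> \<Longrightarrow> \<xi> v' \<noteq> 0 \<Longrightarrow>
      \<exists>\<xi>'. ring_hom_on (generated_subring (adjoin U g \<union> G)) \<xi>' \<and> (\<forall>u\<in>adjoin U g. \<xi>' u = \<xi> u) \<and> \<xi>' w \<noteq> 0"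
    by blast
  obtain v where v: "v \<in> U" "v \<noteq> 0" and ext1: "\<And>\<xi> :: 'o \<Rightarrow> 'o. ring_hom_on U \<xi> \<Longrightarrow> \<xi> v \<noteq> 0 \<Longrightarrow>
      \<exists>\<xi>'. ring_hom_on (adjoin U g) \<xi>' \<and> (\<forall>u\<in>U. \<xi>' u = \<xi> u) \<and> \<xi>' v' \<noteq> 0"
    using extend_hom_adjoin[OF insert.prems(1) v'] by metis
  show ?case
  proof (intro bexI[of _ v] conjI allI impI)
    fix \<xi> :: "'o \<Rightarrow> 'o" assume "ring_hom_on U \<xi> \<and> \<xi> v \<noteq> 0"
    then obtain \<xi>1 where 1: "ring_hom_on (adjoin U g) \<xi>1" "\<forall>u\<in>U. \<xi>1 u = \<xi> u" "\<xi>1 v' \<noteq> 0"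
      using ext1 by blast
    then obtain \<xi>' where "ring_hom_on (generated_subring (adjoin U g \<union> G)) \<xi>'"
      "\<forall>u\<in>adjoin U g. \<xi>' u = \<xi>1 u" "\<xi>' w \<noteq> 0" using ext by blast
    then show "\<exists>\<xi>'. ring_hom_on (generated_subring (U \<union> insert g G)) \<xi>' \<and> (\<forall>u\<in>U. \<xi>' u = \<xi> u) \<and> \<xi>' w \<noteq> 0"
      using 1 adjoin_superset(1)[OF insert.prems(1), of g] eq by (intro exI[of _ \<xi>']) auto
  qed (use v in auto)
qed

section \<open>Algebraic elements and constants of derivations\<close>

definition algebraic_over :: "'r::comm_ring_1 set \<Rightarrow> 'r \<Rightarrow> bool" where
  "algebraic_over S x \<longleftrightarrow> (\<exists>p\<in>polys_over S. p \<noteq> 0 \<and> poly p x = 0)"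

definition subfield_set :: "'r::field set \<Rightarrow> bool" where
  "subfield_set S \<longleftrightarrow> subring_set S \<and> (\<forall>x\<in>S. inverse x \<in> S)"

lemma algebraic_over_mono: "algebraic_over S x \<Longrightarrow> S \<subseteq> T \<Longrightarrow> algebraic_over T x"
  unfolding algebraic_over_def using polys_over_mono by blast

lemma algebraic_over_self: "subring_set S \<Longrightarrow> x \<in> S \<Longrightarrow> algebraic_over S x"
  unfolding algebraic_over_def
  by (rule bexI[of _ "[:- x, 1:]"]) (auto intro!: polys_over_simps simp: subring_set_simps)

text \<open>The algebraic elements over a subfield form a field by the theory of finite extensions, which is
  formulated for subsets of a carrier. The next lemmas carry this fact over to types.\<close>

lemma eval_eq_poly:
  "ring.eval (ring_of_type_algebra :: 'r::field ring) p x = poly (Poly (rev p)) x"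
proof -
  let ?R = "ring_of_type_algebra :: 'r ring"
  interpret field ?R by (rule field_from_type_algebra)
  have pow: "x [^]\<^bsub>?R\<^esub> (n::nat) = x ^ n" for n
    by (induction n) (auto simp: ring_of_type_algebra_def nat_pow_def)
  show ?thesis
    by (induction p)
      (auto simp: pow Poly_append poly_monom, auto simp: ring_of_type_algebra_def algebra_simps poly_monom)
qed

lemma subfield_from_type:
  assumes "subfield_set (S :: 'r::field set)"
  shows "subfield S (ring_of_type_algebra :: 'r ring)"
proof -
  let ?R = "ring_of_type_algebra :: 'r ring"
  interpret field ?R by (rule field_from_type_algebra)
  have S: "subring_set S" "\<And>x. x \<in> S \<Longrightarrow> inverse x \<in> S" using assms by (auto simp: subfield_set_def)
  have inv: "inv\<^bsub>?R\<^esub> x = inverse x" if "x \<noteq> 0" for x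
    by (rule comm_inv_char) (use that in \<open>auto simp: ring_of_type_algebra_def\<close>)
  have neg: "\<ominus>\<^bsub>?R\<^esub> x = - x" for x
    by (rule sum_zero_eq_neg[symmetric]) (auto simp: ring_of_type_algebra_def)
  show ?thesis
  proof (rule subfieldI'[OF subringI])
    show "S \<subseteq> carrier ?R" "\<one>\<^bsub>?R\<^esub> \<in> S" using subring_set_simps[OF S(1)] by (auto simp: ring_of_type_algebra_def)
    show "\<ominus>\<^bsub>?R\<^esub> h \<in> S" if "h \<in> S" for h using that subring_set_simps[OF S(1)] by (simp add: neg)
    show "h1 \<otimes>\<^bsub>?R\<^esub> h2 \<in> S" "h1 \<oplus>\<^bsub>?R\<^esub> h2 \<in> S" if "h1 \<in> S" "h2 \<in> S" for h1 h2
      using that subring_set_simps[OF S(1)] by (auto simp: ring_of_type_algebra_def)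
    show "inv\<^bsub>?R\<^esub> k \<in> S" if "k \<in> S - {\<zero>\<^bsub>?R\<^esub>}" for k
      using that S(2) inv[of k] by (simp add: ring_of_type_algebra_def)
  qed
qed

lemma algebraic_over_iff_HOL_Algebra:
  fixes S :: "'r::field set"
  assumes S: "subfield_set S"
  shows "algebraic_over S x \<longleftrightarrow>
    (ring.algebraic (ring_of_type_algebra :: 'r ring) over S) x"
proof -
  let ?R = "ring_of_type_algebra :: 'r ring"
  interpret field ?R by (rule field_from_type_algebra)
  have sr: "subring S ?R" using subfieldE(1)[OF subfield_from_type[OF S]] .
  have S': "subring_set S" using S by (simp add: subfield_set_def)
  show ?thesis
  proof
    assume "algebraic_over S x"
    then obtain p where p: "p \<in> polys_over S" "p \<noteq> 0" "poly p x = 0" by (auto simp: algebraic_over_def)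
    have "set (coeffs p) \<subseteq> S" using p(1) by (auto simp: polys_over_def coeffs_def)
    moreover have "last (coeffs p) \<noteq> 0" "coeffs p \<noteq> []" using p(2) by (simp_all add: last_coeffs_eq_coeff_degree)
    ultimately have "rev (coeffs p) \<in> carrier (S[X]\<^bsub>?R\<^esub>)"
      by (auto simp: univ_poly_def polynomial_def ring_of_type_algebra_def hd_rev)
    moreover have "eval (rev (coeffs p)) x = \<zero>\<^bsub>?R\<^esub>"
      unfolding eval_eq_poly using p(3) by (simp add: ring_of_type_algebra_def)
    ultimately show "(algebraic over S) x"
      using algebraicI \<open>coeffs p \<noteq> []\<close> by blast
  next
    assume "(algebraic over S) x"
    then obtain p where p: "p \<in> carrier (S[X]\<^bsub>?R\<^esub>)" "p \<noteq> []" "eval p x = \<zero>\<^bsub>?R\<^esub>"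
      using algebraicE[OF sr] by (auto simp: ring_of_type_algebra_def)
    have set: "set p \<subseteq> S" "hd p \<noteq> 0"
      using p by (auto simp: univ_poly_def polynomial_def ring_of_type_algebra_def)
    have "Polynomial.coeff (Poly (rev p)) i \<in> S" for i
      using set subring_set_simps(2)[OF S'] by (auto simp: nth_default_def rev_nth)
    then have "Poly (rev p) \<in> polys_over S" by (simp add: polys_over_def)
    moreover have "Poly (rev p) \<noteq> 0"
      using set(2) p(2) by (auto simp: Poly_eq_0 hd_conv_nth rev_swap)
    moreover have "poly (Poly (rev p)) x = 0"
      using p(3) unfolding eval_eq_poly by (simp add: ring_of_type_algebra_def)
    ultimately show "algebraic_over S x" unfolding algebraic_over_def by blast
  qed
qed

lemma subring_set_algebraic_over_subfield:
  fixes S :: "'r::field set"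
  assumes S: "subfield_set S"
  shows "subring_set {x. algebraic_over S x}"
proof -
  let ?R = "ring_of_type_algebra :: 'r ring"
  interpret field ?R by (rule field_from_type_algebra)
  have sf: "subfield {x \<in> carrier ?R. (algebraic over S) x} ?R"
    by (rule subfield_of_algebraics[OF subfield_from_type[OF S]])
  have sr: "subring {x \<in> carrier ?R. (algebraic over S) x} ?R" using subfieldE(1)[OF sf] .
  have eq: "{x \<in> carrier ?R. (algebraic over S) x} = {x. algebraic_over S x}"
    by (auto simp: algebraic_over_iff_HOL_Algebra[OF S] ring_of_type_algebra_def)
  have neg: "\<ominus>\<^bsub>?R\<^esub> x = - x" for x
    by (rule sum_zero_eq_neg[symmetric]) (auto simp: ring_of_type_algebra_def)
  show ?thesis
    using subringE(3,5-7)[OF sr] unfolding eq subring_set_def neg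
    by (auto simp: ring_of_type_algebra_def)
qed

locale ring_derivation =
  fixes d :: "'r::comm_ring_1 \<Rightarrow> 'r"
  assumes deriv_add: "d (x + y) = d x + d y" and deriv_mult: "d (x * y) = x * d y + d x * y"
begin

lemma deriv_0 [simp]: "d 0 = 0"
  using deriv_add[of 0 0] by simp

lemma deriv_1 [simp]: "d 1 = 0"
  using deriv_mult[of 1 1] by simp

lemma deriv_minus [simp]: "d (- x) = - d x"
  using deriv_add[of x "- x"] by (simp add: eq_neg_iff_add_eq_0 add.commute)

lemma deriv_diff: "d (x - y) = d x - d y"
  using deriv_add[of x "- y"] by simp

lemma deriv_of_nat [simp]: "d (of_nat n) = 0"
  by (induction n) (auto simp: deriv_add)

lemma deriv_sum: "d (sum f I) = (\<Sum>i\<in>I. d (f i))"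
  by (induction I rule: infinite_finite_induct) (auto simp: deriv_add)

lemma subring_set_constants: "subring_set {x. d x = 0}"
  by (auto simp: subring_set_def deriv_add deriv_mult)

lemma coeff_map_deriv [simp]: "coeff (map_poly d p) i = d (coeff p i)"
  by (rule coeff_map_poly) simp

lemma map_poly_derivation: "ring_derivation (map_poly d)"
proof
  show "map_poly d (p + q) = map_poly d p + map_poly d q" for p q
    by (rule poly_eqI) (simp add: deriv_add)
  show "map_poly d (p * q) = p * map_poly d q + map_poly d p * q" for p q
    by (rule poly_eqI) (simp add: deriv_mult deriv_sum coeff_mult sum.distrib)
qed

end

lemma subfield_set_constants:
  fixes d :: "'r::field \<Rightarrow> 'r"
  assumes "ring_derivation d" shows "subfield_set {x. d x = 0}"
proof -
  interpret ring_derivation d by fact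
  have "d (inverse x) = 0" if "d x = 0" for x
  proof (cases "x = 0")
    case False
    then have "x * d (inverse x) + d x * inverse x = 0" using deriv_mult[of x "inverse x"] by simp
    then show ?thesis using that False by simp
  qed auto
  then show ?thesis using subring_set_constants by (auto simp: subfield_set_def)
qed

text \<open>The value at a point of the algebraic closure of a polynomial with coefficients in the base field.\<close>

definition ac_root :: "'m::field poly \<Rightarrow> 'm alg_closure \<Rightarrow> 'm alg_closure" where
  "ac_root p l = poly (map_poly to_ac p) l"

lemma ring_hom_on_to_ac: "ring_hom_on S to_ac"
  by (auto simp: ring_hom_on_def)

lemma ac_root_simps:
  "ac_root (p + q) l = ac_root p l + ac_root q l" "ac_root (p * q) l = ac_root p l * ac_root q l"
  "ac_root 0 l = 0"
  using map_poly_ring_hom_on[of UNIV to_ac p q, OF _ ring_hom_on_to_ac]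
  by (simp_all add: ac_root_def subring_set_def polys_over_def)

definition is_min_poly :: "'m::field poly \<Rightarrow> 'm alg_closure \<Rightarrow> bool" where
  "is_min_poly \<mu> l \<longleftrightarrow> lead_coeff \<mu> = 1 \<and> ac_root \<mu> l = 0 \<and>
     (\<forall>p. ac_root p l = 0 \<longrightarrow> degree p < degree \<mu> \<longrightarrow> p = 0)"

lemma min_poly_exists: "\<exists>\<mu>. is_min_poly \<mu> l"
proof -
  define Q where "Q p \<longleftrightarrow> p \<noteq> 0 \<and> ac_root p l = 0" for p
  obtain p where "Q p" using alg_closure_algebraic[of l] unfolding Q_def ac_root_def by blast
  then obtain m where m: "Q m" and min: "\<And>q. Q q \<Longrightarrow> degree m \<le> degree q"
    using ex_has_least_nat[of Q p degree] by blast
  have m0: "m \<noteq> 0" "ac_root m l = 0" using m by (auto simp: Q_def)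
  have "is_min_poly ([:inverse (lead_coeff m):] * m) l"
    unfolding is_min_poly_def ac_root_simps using m0 min
    by (auto simp: Q_def) (metis not_le)
  then show ?thesis by blast
qed

text \<open>An element algebraic over the constants \<open>C\<close> of \<open>d\<close> has its minimal polynomial \<open>\<mu>\<close> over the whole field
  with coefficients in \<open>C\<close>. Take a root polynomial \<open>g\<close> over \<open>C\<close> of least degree; it is separable, so
  \<open>g = \<mu> q\<close> with \<open>q(l) \<noteq> 0\<close>. Differentiating coefficients gives \<open>0 = \<mu> q\<^sup>d + \<mu>\<^sup>d q\<close>, hence \<open>\<mu>\<^sup>d(l) = 0\<close>, and
  \<open>\<mu>\<^sup>d\<close> has smaller degree than the monic \<open>\<mu>\<close>.\<close>

lemma min_poly_coeffs_constant:
  fixes d :: "'m::field \<Rightarrow> 'm"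
  assumes d: "ring_derivation d" and char: "CHAR('m) = 0"
    and \<mu>: "is_min_poly \<mu> l"
    and l: "algebraic_over (to_ac ` {x. d x = 0}) l"
  shows "d (coeff \<mu> i) = 0"
proof -
  interpret ring_derivation d by fact
  interpret D: ring_derivation "map_poly d" by (rule map_poly_derivation)
  note sr = subring_set_constants
  define Q where "Q g \<longleftrightarrow> g \<in> polys_over {x. d x = 0} \<and> g \<noteq> 0 \<and> ac_root g l = 0" for g
  have "\<exists>g. Q g"
  proof -
    obtain p where p: "p \<in> polys_over (to_ac ` {x. d x = 0})" "p \<noteq> 0" "poly p l = 0"
      using l by (auto simp: algebraic_over_def)
    define g where "g = map_poly of_ac p"
    have c: "coeff p i = to_ac (coeff g i)" "d (coeff g i) = 0" for i
    proof -
      obtain x where "coeff p i = to_ac x" "d x = 0" using p(1) unfolding polys_over_def by blast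
      then show "coeff p i = to_ac (coeff g i)" "d (coeff g i) = 0"
        by (simp_all add: g_def coeff_map_poly)
    qed
    have "p = map_poly to_ac g" by (rule poly_eqI) (simp add: coeff_map_poly c)
    then have "Q g" using p c(2) by (auto simp: Q_def polys_over_def ac_root_def)
    then show ?thesis by blast
  qed
  then obtain g where g: "Q g" and min: "\<And>h. Q h \<Longrightarrow> degree g \<le> degree h"
    using ex_has_least_nat[of Q _ degree] by blast
  have \<mu>0: "lead_coeff \<mu> = 1" "ac_root \<mu> l = 0" "\<And>p. ac_root p l = 0 \<Longrightarrow> degree p < degree \<mu> \<Longrightarrow> p = 0"
    using \<mu> by (auto simp: is_min_poly_def)
  then have \<mu>nz: "\<mu> \<noteq> 0" by auto
  have deg: "degree g \<noteq> 0"
  proof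
    assume "degree g = 0"
    then obtain a where "g = [:a:]" by (meson degree_eq_zeroE)
    then show False using g by (auto simp: Q_def ac_root_def map_poly_pCons)
  qed
  have pd: "ac_root (pderiv g) l \<noteq> 0"
  proof
    assume a: "ac_root (pderiv g) l = 0"
    have "coeff (pderiv g) (degree g - 1) = of_nat (degree g) * lead_coeff g"
      using deg by (simp add: coeff_pderiv)
    also have "\<dots> \<noteq> 0" using g deg char by (simp add: Q_def of_nat_eq_0_iff_char_dvd)
    finally have "pderiv g \<noteq> 0" by auto
    then have "Q (pderiv g)" using g a pderiv_polys_over[OF sr] by (auto simp: Q_def)
    moreover have "degree (pderiv g) \<le> degree g - 1"
      by (rule degree_le) (auto simp: coeff_pderiv coeff_eq_0)
    ultimately show False using min[of "pderiv g"] deg by linarith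
  qed
  have dvd: "ac_root (g mod \<mu>) l = 0"
  proof -
    have "ac_root (g div \<mu> * \<mu> + g mod \<mu>) l = 0" using g by (simp add: Q_def)
    then show ?thesis using \<mu>0(2) unfolding ac_root_simps by simp
  qed
  have "g mod \<mu> = 0"
    using \<mu>0(3)[OF dvd] degree_mod_less[OF \<mu>nz, of g] by blast
  then obtain q where q: "g = \<mu> * q" by (metis mod_0_imp_dvd dvdE)
  have "ac_root (pderiv g) l = ac_root q l * ac_root (pderiv \<mu>) l"
    unfolding q pderiv_mult using \<mu>0 by (simp add: ac_root_simps)
  then have q0: "ac_root q l \<noteq> 0" using pd by auto
  have "map_poly d g = 0" by (rule poly_eqI) (use g in \<open>auto simp: Q_def polys_over_def\<close>)
  then have "\<mu> * map_poly d q + map_poly d \<mu> * q = 0" unfolding q D.deriv_mult .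
  then have "ac_root (\<mu> * map_poly d q + map_poly d \<mu> * q) l = 0" by (simp add: ac_root_simps)
  then have r: "ac_root (map_poly d \<mu>) l = 0" using \<mu>0 q0 by (simp add: ac_root_simps)
  have "map_poly d \<mu> = 0"
  proof (rule ccontr)
    assume nz: "map_poly d \<mu> \<noteq> 0"
    have "degree (map_poly d \<mu>) \<noteq> degree \<mu>"
    proof
      assume "degree (map_poly d \<mu>) = degree \<mu>"
      then have "lead_coeff (map_poly d \<mu>) = 0" using \<mu>0(1) by simp
      then show False using nz leading_coeff_0_iff by blast
    qed
    moreover have "degree (map_poly d \<mu>) \<le> degree \<mu>"
      by (rule degree_le) (simp add: coeff_eq_0)
    ultimately show False using \<mu>0(3)[OF r] nz by simp
  qed
  then show ?thesis by (metis coeff_0 coeff_map_deriv)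
qed

lemma algebraic_over_constants:
  fixes d :: "'m::field \<Rightarrow> 'm"
  assumes d: "ring_derivation d" and char: "CHAR('m) = 0"
    and m: "algebraic_over (to_ac ` {x. d x = 0}) (to_ac m)"
  shows "d m = 0"
proof -
  interpret ring_derivation d by fact
  have "is_min_poly [:- m, 1:] (to_ac m)"
    unfolding is_min_poly_def
  proof (intro conjI allI impI)
    fix p assume p: "ac_root p (to_ac m) = 0" "degree p < degree [:- m, 1:]"
    then have "degree p = 0" by simp
    then obtain a where "p = [:a:]" by (rule degree_eq_zeroE)
    then show "p = 0" using p by (simp add: ac_root_def map_poly_pCons)
  qed (auto simp: ac_root_def map_poly_pCons)
  from min_poly_coeffs_constant[OF d char this m, of 0] show ?thesis by simp
qed

text \<open>The extension of a derivation to the field of fractions by the quotient rule.\<close>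

definition fract_deriv :: "('r::idom \<Rightarrow> 'r) \<Rightarrow> 'r fract \<Rightarrow> 'r fract" where
  "fract_deriv d x = (SOME y. \<exists>a b. b \<noteq> 0 \<and> x = Fract a b \<and> y = Fract (d a * b - a * d b) (b * b))"

context
  fixes d :: "'r::idom \<Rightarrow> 'r"
  assumes d: "ring_derivation d"
begin

interpretation ring_derivation d by (rule d)

lemma fract_deriv_Fract:
  assumes b: "b \<noteq> 0"
  shows "fract_deriv d (Fract a b) = Fract (d a * b - a * d b) (b * b)"
proof -
  define P where "P y \<longleftrightarrow> (\<exists>a' b'. b' \<noteq> 0 \<and> Fract a b = Fract a' b' \<and> y = Fract (d a' * b' - a' * d b') (b' * b'))" for y
  have "P (SOME y. P y)" by (rule someI[of P "Fract (d a * b - a * d b) (b * b)"]) (use b in \<open>auto simp: P_def\<close>)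
  then obtain c e where ce: "e \<noteq> 0" "Fract a b = Fract c e"
    "fract_deriv d (Fract a b) = Fract (d c * e - c * d e) (e * e)"
    unfolding P_def fract_deriv_def by blast
  have eq: "a * e = c * b" using ce b by (simp add: eq_fract)
  then have "d (a * e) = d (c * b)" by simp
  then have eq': "a * d e + d a * e = c * d b + d c * b" by (simp add: deriv_mult)
  have "(d c * e - c * d e) * (b * b) - (d a * b - a * d b) * (e * e)
    = b * e * ((c * d b + d c * b) - (a * d e + d a * e)) + (a * e - c * b) * (b * d e + e * d b)"
    by (simp add: algebra_simps)
  also have "\<dots> = 0" using eq eq' by simp
  finally show ?thesis unfolding ce(3) using b ce(1) by (simp add: eq_fract)
qed

lemma ring_derivation_fract_deriv: "ring_derivation (fract_deriv d)"
proof
  show "fract_deriv d (x + y) = fract_deriv d x + fract_deriv d y" for x y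
    by (cases x, cases y) (simp add: fract_deriv_Fract eq_fract deriv_add deriv_mult algebra_simps)
  show "fract_deriv d (x * y) = x * fract_deriv d y + fract_deriv d x * y" for x y
    by (cases x, cases y) (simp add: fract_deriv_Fract eq_fract deriv_add deriv_mult algebra_simps)
qed

lemma fract_deriv_eq_0_iff: "b \<noteq> 0 \<Longrightarrow> fract_deriv d (Fract a b) = 0 \<longleftrightarrow> d a * b = a * d b"
  by (simp add: fract_deriv_Fract Zero_fract_def eq_fract)

end

lemma CHAR_fract: "CHAR('r::idom fract) = CHAR('r)"
proof (rule CHAR_eqI)
  show "of_nat CHAR('r) = (0 :: 'r fract)" by (simp add: of_nat_fract Zero_fract_def)
  show "CHAR('r) dvd n" if "of_nat n = (0 :: 'r fract)" for n
    using that by (simp add: of_nat_fract Zero_fract_def eq_fract of_nat_eq_0_iff_char_dvd)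
qed

section \<open>Points of a ring with two polynomial structures\<close>

lemma inj_of_nat_CHAR_0:
  assumes "CHAR('r::comm_ring_1) = 0" shows "inj (of_nat :: nat \<Rightarrow> 'r)"
proof (rule linorder_injI)
  fix m n :: nat assume "m < n"
  then have "of_nat (n - m) \<noteq> (0 :: 'r)"
    using assms of_nat_eq_0_iff_char_dvd[where 'a = 'r, of "n - m"]
    by (metis dvd_0_left zero_less_diff less_irrefl)
  moreover have "of_nat (n - m) = (of_nat n - of_nat m :: 'r)" using \<open>m < n\<close> by simp
  ultimately show "of_nat m \<noteq> (of_nat n :: 'r)" by auto
qed

text \<open>A transcendental element can be moved, over \<open>K\<close>, to all but finitely many values \<open>z\<close>, in such a way that
  the motion extends to any prescribed finitely generated ring over \<open>K[l]\<close>.\<close>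

lemma specialise_transcendental:
  fixes K :: "'o::alg_closed_field set"
  assumes K: "subring_set K" and l: "\<not> algebraic_over K l" and G: "finite G"
  obtains p where "p \<noteq> 0" "\<And>z. poly p z \<noteq> 0 \<Longrightarrow>
    \<exists>\<xi>. ring_hom_on (generated_subring (adjoin K l \<union> G)) \<xi> \<and> (\<forall>u\<in>K. \<xi> u = u) \<and> \<xi> l = z"
proof -
  let ?W = "adjoin K l"
  have W: "subring_set ?W" "K \<subseteq> ?W" "l \<in> ?W"
    using subring_set_adjoin[OF K] adjoin_superset[OF K] by auto
  have "1 \<in> generated_subring (?W \<union> G)" by (rule generated_subring.one)
  from extend_hom_finitely_generated[OF G W(1) this one_neq_zero]
  obtain v where v: "v \<in> ?W" "v \<noteq> 0" and ext: "\<And>\<xi> :: 'o \<Rightarrow> 'o. ring_hom_on ?W \<xi> \<Longrightarrow> \<xi> v \<noteq> 0 \<Longrightarrow>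
      \<exists>\<xi>'. ring_hom_on (generated_subring (?W \<union> G)) \<xi>' \<and> (\<forall>u\<in>?W. \<xi>' u = \<xi> u)"
    by blast
  obtain p where p: "p \<in> polys_over K" "v = poly p l" using v(1) by (auto simp: adjoin_def)
  have trans: "\<forall>q\<in>polys_over K. poly q l = 0 \<longrightarrow> q = 0"
    using l unfolding algebraic_over_def by blast
  have id: "ring_hom_on K (\<lambda>u. u)" by (simp add: ring_hom_on_def)
  show thesis
  proof (rule that[of p])
    show "p \<noteq> 0" using p(2) v(2) by auto
    fix z assume z: "poly p z \<noteq> 0"
    obtain \<xi> where \<xi>: "ring_hom_on ?W \<xi>"
      "\<And>q. q \<in> polys_over K \<Longrightarrow> \<xi> (poly q l) = poly (map_poly (\<lambda>u. u) q) z" "\<And>u. u \<in> K \<Longrightarrow> \<xi> u = u"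
      by (rule ring_hom_on_adjoin[OF K id, of l z]) (use trans in auto)
    have "\<xi> v \<noteq> 0" using \<xi>(2)[OF p(1)] z p(2) by simp
    then obtain \<xi>' where \<xi>': "ring_hom_on (generated_subring (?W \<union> G)) \<xi>'" "\<And>u. u \<in> ?W \<Longrightarrow> \<xi>' u = \<xi> u"
      using ext \<xi>(1) by blast
    have "[:0, 1:] \<in> polys_over K" by (intro polys_over_simps[OF K] subring_set_simps[OF K])
    from \<xi>(2)[OF this] have "\<xi>' l = z" using \<xi>'(2)[OF W(3)] by simp
    then show "\<exists>\<xi>. ring_hom_on (generated_subring (?W \<union> G)) \<xi> \<and> (\<forall>u\<in>K. \<xi> u = u) \<and> \<xi> l = z"
      using \<xi>' \<xi>(3) W(2) by (intro exI[of _ \<xi>']) auto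
  qed
qed

text \<open>The ring \<open>'r\<close> is generated by one element over the subring \<open>A1\<close> and also over the subring \<open>A2\<close>. Its
  homomorphisms to the field \<open>'o\<close> are regarded as points; the inductive predicate \<open>orb S\<close> describes
  those with values in \<open>S\<close> that are reached from \<open>\<iota>\<close> through points with values in \<open>S\<close>, each step keeping
  the restriction to \<open>A1\<close> or to \<open>A2\<close>. The parameter \<open>S\<close> records a ring on which a homomorphism has to
  be defined in order to act on the whole path.\<close>

locale point_orbit =
  fixes \<iota> :: "'r::comm_ring_1 \<Rightarrow> 'o::alg_closed_field" and A1 A2 :: "'r set" and s1 s2 :: 'r
  assumes A1: "subring_set A1" and A2: "subring_set A2"
    and gen1: "adjoin A1 s1 = UNIV" and gen2: "adjoin A2 s2 = UNIV"
    and \<iota>: "ring_hom_on UNIV \<iota>"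
begin

inductive orb :: "'o set \<Rightarrow> ('r \<Rightarrow> 'o) \<Rightarrow> bool" for S where
  base: "range \<iota> \<subseteq> S \<Longrightarrow> orb S \<iota>"
| step: "orb S x \<Longrightarrow> ring_hom_on UNIV y \<Longrightarrow> range y \<subseteq> S \<Longrightarrow>
    (\<forall>a\<in>A1. y a = x a) \<or> (\<forall>a\<in>A2. y a = x a) \<Longrightarrow> orb S y"

lemma orb_hom: "orb S x \<Longrightarrow> ring_hom_on UNIV x"
  by (induction rule: orb.induct) (auto simp: \<iota>)

lemma orb_range: "orb S x \<Longrightarrow> range x \<subseteq> S"
  by (induction rule: orb.induct) auto

lemma orb_mono: "orb S x \<Longrightarrow> S \<subseteq> T \<Longrightarrow> orb T x"
  by (induction rule: orb.induct) (auto intro: orb.intros)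

lemma range_hom_adjoin:
  fixes A :: "'r set" and x :: "'r \<Rightarrow> 'o"
  assumes A: "subring_set A" "adjoin A s = UNIV" and x: "ring_hom_on UNIV x"
  shows "range x \<subseteq> generated_subring (insert (x s) (x ` A))"
proof clarify
  fix r
  obtain p where p: "p \<in> polys_over A" "r = poly p s" using A(2) by (auto simp: adjoin_def)
  have U: "subring_set (UNIV :: 'r set)" by (simp add: subring_set_def)
  have "p \<in> polys_over UNIV" by (simp add: polys_over_def)
  from poly_map_poly_ring_hom_on[OF U x this, of s] have "x r = poly (map_poly x p) (x s)"
    using p by simp
  also have "\<dots> \<in> generated_subring (insert (x s) (x ` A))"
  proof (rule poly_polys_over_closed[OF subring_set_generated])
    show "map_poly x p \<in> polys_over (generated_subring (insert (x s) (x ` A)))"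
      using p(1) by (auto simp: polys_over_def coeff_map_poly ring_hom_on_simps(1)[OF U x]
          intro!: generated_subring.base)
  qed (auto intro: generated_subring.base)
  finally show "x r \<in> generated_subring (insert (x s) (x ` A))" .
qed

lemma agree_range:
  fixes x y :: "'r \<Rightarrow> 'o"
  assumes "ring_hom_on UNIV x" "ring_hom_on UNIV y" and "(\<forall>a\<in>A1. y a = x a) \<or> (\<forall>a\<in>A2. y a = x a)"
  shows "\<exists>\<sigma>. range y \<subseteq> generated_subring (insert \<sigma> (range x))"
  using assms(3)
proof
  assume "\<forall>a\<in>A1. y a = x a"
  then have "insert (y s1) (y ` A1) \<subseteq> insert (y s1) (range x)" by auto
  from generated_subring_mono[OF this] show ?thesis using range_hom_adjoin[OF A1 gen1 assms(2)] by blast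
next
  assume "\<forall>a\<in>A2. y a = x a"
  then have "insert (y s2) (y ` A2) \<subseteq> insert (y s2) (range x)" by auto
  from generated_subring_mono[OF this] show ?thesis using range_hom_adjoin[OF A2 gen2 assms(2)] by blast
qed

lemma generated_subring_insert_generated:
  assumes "range y \<subseteq> generated_subring (insert \<sigma> Z)" "Z \<subseteq> generated_subring W"
  shows "range y \<subseteq> generated_subring (insert \<sigma> W)"
proof -
  have "insert \<sigma> Z \<subseteq> generated_subring (insert \<sigma> W)"
    using assms(2) generated_subring_mono[of W "insert \<sigma> W"] by (auto intro: generated_subring.base)
  then show ?thesis using assms(1) generated_subring_minimal[OF subring_set_generated] by blast
qed

text \<open>Over either subring a point is determined by one further value, so each step of a path adjoins at
  most one element to the ring of values.\<close>

lemma orb_finitely_generated: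
  assumes "orb UNIV x"
  obtains \<Sigma> where "finite \<Sigma>" "orb (generated_subring (range \<iota> \<union> \<Sigma>)) x"
  using assms
proof (induction arbitrary: thesis rule: orb.induct)
  case base
  show ?case by (rule base(2)[of "{}"]) (auto intro!: orb.base intro: generated_subring.base)
next
  case (step x y)
  obtain \<Sigma> where S: "finite \<Sigma>" "orb (generated_subring (range \<iota> \<union> \<Sigma>)) x" by (rule step.IH)
  obtain \<sigma> where \<sigma>: "range y \<subseteq> generated_subring (insert \<sigma> (range x))"
    using agree_range[OF orb_hom[OF step(1)] step(2,4)] by blast
  have y: "range y \<subseteq> generated_subring (range \<iota> \<union> insert \<sigma> \<Sigma>)"
    using generated_subring_insert_generated[OF \<sigma> orb_range[OF S(2)]] by simp
  have x: "orb (generated_subring (range \<iota> \<union> insert \<sigma> \<Sigma>)) x"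
    by (rule orb_mono[OF S(2)]) (auto intro!: generated_subring_mono)
  show ?case
    by (rule step.prems[of "insert \<sigma> \<Sigma>"]) (use S(1) orb.step[OF x step(2) y step(4)] in auto)
qed

text \<open>Paths can be run backwards, so the values of \<open>\<iota>\<close> are recovered from those of \<open>x\<close> by adjoining finitely
  many elements.\<close>

lemma orb_generates_base:
  assumes "orb UNIV x"
  obtains \<Sigma> where "finite \<Sigma>" "range \<iota> \<subseteq> generated_subring (x ` A1 \<union> \<Sigma>)"
proof -
  have "\<exists>\<Sigma>. finite \<Sigma> \<and> range \<iota> \<subseteq> generated_subring (range x \<union> \<Sigma>)"
    using assms
  proof (induction rule: orb.induct)
    case base
    show ?case by (rule exI[of _ "{}"]) (auto intro: generated_subring.base)
  next
    case (step x y)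
    obtain \<Sigma> where S: "finite \<Sigma>" "range \<iota> \<subseteq> generated_subring (range x \<union> \<Sigma>)" using step.IH by blast
    have "(\<forall>a\<in>A1. x a = y a) \<or> (\<forall>a\<in>A2. x a = y a)" using step(4) by auto
    from agree_range[OF step(2) orb_hom[OF step(1)] this]
    obtain \<sigma> where \<sigma>: "range x \<subseteq> generated_subring (insert \<sigma> (range y))" by blast
    have "range x \<union> \<Sigma> \<subseteq> generated_subring (range y \<union> insert \<sigma> \<Sigma>)"
      using \<sigma> generated_subring_mono[of "insert \<sigma> (range y)" "range y \<union> insert \<sigma> \<Sigma>"]
      by (auto intro: generated_subring.base)
    from generated_subring_minimal[OF subring_set_generated this] show ?case
      using S by (intro exI[of _ "insert \<sigma> \<Sigma>"]) auto
  qed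
  then obtain \<Sigma> where S: "finite \<Sigma>" "range \<iota> \<subseteq> generated_subring (range x \<union> \<Sigma>)" by blast
  have "range x \<union> \<Sigma> \<subseteq> generated_subring (x ` A1 \<union> insert (x s1) \<Sigma>)"
    using range_hom_adjoin[OF A1 gen1 orb_hom[OF assms]]
      generated_subring_mono[of "insert (x s1) (x ` A1)" "x ` A1 \<union> insert (x s1) \<Sigma>"]
    by (auto intro: generated_subring.base)
  from generated_subring_minimal[OF subring_set_generated this] show thesis
    using S by (intro that[of "insert (x s1) \<Sigma>"]) auto
qed

text \<open>A homomorphism \<open>\<xi>\<close> of the ring of values moves a whole path. The moved path starts at \<open>\<xi> \<circ> \<iota>\<close>, which is
  one step away from \<open>\<iota>\<close> because \<open>\<xi>\<close> fixes the values of \<open>\<iota>\<close> on one of the subrings.\<close>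

lemma orb_transport:
  assumes "orb S x" and S: "subring_set S" and \<xi>: "ring_hom_on S \<xi>"
    and agree: "(\<forall>a\<in>A1. \<xi> (\<iota> a) = \<iota> a) \<or> (\<forall>a\<in>A2. \<xi> (\<iota> a) = \<iota> a)"
  shows "orb UNIV (\<xi> \<circ> x)"
proof -
  have hom: "ring_hom_on UNIV (\<xi> \<circ> y)" if "ring_hom_on UNIV y" "range y \<subseteq> S" for y
    using that \<xi> unfolding ring_hom_on_def by (auto simp: image_subset_iff)
  show ?thesis
    using assms(1)
  proof (induction rule: orb.induct)
    case base
    show ?case
      by (rule orb.step[OF orb.base[OF subset_UNIV]]) (use hom[OF \<iota> base] agree in \<open>auto simp: comp_def\<close>)
  next
    case (step x y)
    show ?case
      by (rule orb.step[OF step.IH]) (use hom[OF step(2,3)] step(4) in \<open>auto simp: comp_def\<close>)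
  qed
qed

text \<open>A point \<open>x\<close> with a value \<open>x y\<close> transcendental over \<open>\<iota> A\<close> can be moved along the orbit to a more special
  one: send \<open>x y\<close> to a natural number while fixing \<open>\<iota> A\<close>, on a finitely generated ring that contains
  all values on a path from \<open>\<iota>\<close> to \<open>x\<close>.\<close>

lemma orb_specialise:
  assumes x: "orb UNIV x" and A: "A = A1 \<or> A = A2" and y: "\<not> algebraic_over (\<iota> ` A) (x y)"
    and char: "CHAR('o) = 0"
  obtains x' n where "orb UNIV x'" "\<And>p. x p = 0 \<Longrightarrow> x' p = 0" "x' (y - of_nat n) = 0" "x (y - of_nat n) \<noteq> 0"
proof -
  have U: "subring_set (UNIV :: 'r set)" by (simp add: subring_set_def)
  obtain s where s: "subring_set A" "adjoin A s = UNIV" using A A1 A2 gen1 gen2 by blast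
  define l where "l = x y"
  define K where "K = \<iota> ` A"
  have hA: "ring_hom_on A \<iota>" by (rule ring_hom_on_subset[OF \<iota>]) simp
  have K: "subring_set K"
    unfolding K_def by (rule subring_set_image[OF s(1) hA])
  obtain \<Sigma> where \<Sigma>: "finite \<Sigma>" "orb (generated_subring (range \<iota> \<union> \<Sigma>)) x"
    by (rule orb_finitely_generated[OF x])
  have trans: "\<not> algebraic_over K l" using y by (simp add: K_def l_def)
  have fin: "finite (insert (\<iota> s) \<Sigma>)" using \<Sigma>(1) by simp
  define T where "T = generated_subring (adjoin K l \<union> insert (\<iota> s) \<Sigma>)"
  have T: "subring_set T" unfolding T_def by (rule subring_set_generated)
  have "range \<iota> \<union> \<Sigma> \<subseteq> T"
  proof -
    have "generated_subring (insert (\<iota> s) (\<iota> ` A)) \<subseteq> T"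
      unfolding T_def using adjoin_superset(1)[OF K, of l] by (intro generated_subring_mono) (auto simp: K_def)
    then show ?thesis using range_hom_adjoin[OF s \<iota>] unfolding T_def
      by (auto intro: generated_subring.base)
  qed
  then have orbT: "orb T x" using orb_mono[OF \<Sigma>(2)] generated_subring_minimal[OF T] by blast
  obtain p where p: "p \<noteq> 0" "\<And>z. poly p z \<noteq> 0 \<Longrightarrow> \<exists>\<xi>. ring_hom_on T \<xi> \<and> (\<forall>u\<in>K. \<xi> u = u) \<and> \<xi> l = z"
    using specialise_transcendental[OF K trans fin] unfolding T_def by metis
  have "finite (of_nat -` {z. poly p z = 0} :: nat set)"
    using poly_roots_finite[OF p(1)] inj_of_nat_CHAR_0[OF char] by (intro finite_vimageI)
  then obtain n where n: "poly p (of_nat n) \<noteq> 0" using infinite_UNIV_nat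
    by (metis (mono_tags, lifting) UNIV_eq_I mem_Collect_eq vimageI)
  obtain \<xi>' where \<xi>': "ring_hom_on T \<xi>'" "\<And>u. u \<in> K \<Longrightarrow> \<xi>' u = u" and l: "\<xi>' l = of_nat n"
    using p(2)[OF n] by blast
  have fixA: "\<forall>a\<in>A. \<xi>' (\<iota> a) = \<iota> a" using \<xi>'(2) unfolding K_def by auto
  have orb': "orb UNIV (\<xi>' \<circ> x)"
    by (rule orb_transport[OF orbT T \<xi>'(1)]) (use A fixA in auto)
  note hx = ring_hom_on_simps[OF U orb_hom[OF orb']]
  note hx0 = ring_hom_on_simps[OF U orb_hom[OF x]]
  have diff: "h (y - of_nat n) = h y - of_nat n" if "ring_hom_on UNIV h" for h :: "'r \<Rightarrow> 'o"
    using ring_hom_on_simps(3,5)[OF U that] ring_hom_on_of_nat[OF U that]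
    by (metis UNIV_I diff_conv_add_uminus)
  show thesis
  proof (rule that[of "\<xi>' \<circ> x" n])
    show "(\<xi>' \<circ> x) p = 0" if "x p = 0" for p using that ring_hom_on_simps(1)[OF T \<xi>'(1)] by simp
    show "(\<xi>' \<circ> x) (y - of_nat n) = 0" using diff[OF orb_hom[OF orb']] l by (simp add: l_def)
    show "x (y - of_nat n) \<noteq> 0"
    proof
      assume "x (y - of_nat n) = 0"
      then have "l = of_nat n" using diff[OF orb_hom[OF x]] by (simp add: l_def)
      then have "l \<in> K" using subring_set_of_nat[OF K] by simp
      then show False using algebraic_over_self[OF K] y by (simp add: K_def l_def)
    qed
  qed (rule orb')
qed

end

lemma noetherian_maximal_ideal_in:
  assumes noeth: "noetherian_ring R" and ne: "\<I> \<noteq> {}" and id: "\<And>I. I \<in> \<I> \<Longrightarrow> ideal I R"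
  obtains M where "M \<in> \<I>" "\<And>I. I \<in> \<I> \<Longrightarrow> M \<subseteq> I \<Longrightarrow> I = M"
proof -
  have "\<exists>M\<in>\<I>. \<forall>I\<in>\<I>. M \<subseteq> I \<longrightarrow> I = M"
  proof (rule subset_Zorn_nonempty[OF ne])
    fix \<C> assume C: "\<C> \<noteq> {}" "subset.chain \<I> \<C>"
    then have "subset.chain {I. ideal I R} \<C>" using id by (auto simp: pred_on.chain_def)
    from noetherian_ring.ideal_chain_is_trivial[OF noeth C(1) this]
    show "\<Union>\<C> \<in> \<I>" using C(2) by (auto simp: pred_on.chain_def)
  qed
  then show thesis using that by blast
qed

lemma ideal_type_iff:
  "ideal I (ring_of_type_algebra :: 'r::comm_ring_1 ring) \<longleftrightarrow>
     0 \<in> I \<and> (\<forall>x\<in>I. \<forall>y\<in>I. x + y \<in> I) \<and> (\<forall>x\<in>I. \<forall>r. r * x \<in> I)"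
proof -
  let ?R = "ring_of_type_algebra :: 'r ring"
  interpret cring ?R by (rule cring_from_type_algebra)
  have neg: "\<ominus>\<^bsub>?R\<^esub> x = - x" for x
    by (rule sum_zero_eq_neg[symmetric]) (auto simp: ring_of_type_algebra_def)
  show ?thesis
  proof
    assume "ideal I ?R"
    then interpret ideal I ?R .
    show "0 \<in> I \<and> (\<forall>x\<in>I. \<forall>y\<in>I. x + y \<in> I) \<and> (\<forall>x\<in>I. \<forall>r. r * x \<in> I)"
      using zero_closed a_closed I_l_closed by (auto simp: ring_of_type_algebra_def)
  next
    assume I: "0 \<in> I \<and> (\<forall>x\<in>I. \<forall>y\<in>I. x + y \<in> I) \<and> (\<forall>x\<in>I. \<forall>r. r * x \<in> I)"
    then have m: "- x \<in> I" if "x \<in> I" for x using that by (metis mult_minus1)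
    show "ideal I ?R"
    proof (rule idealI)
      show "ring ?R" by (rule ring_axioms)
      show "subgroup I (add_monoid ?R)"
        by (rule add.subgroupI) (use I m neg in \<open>auto simp: ring_of_type_algebra_def a_inv_def\<close>)
    qed (use I in \<open>auto simp: ring_of_type_algebra_def mult.commute\<close>)
  qed
qed

lemma primeideal_type_iff:
  "primeideal I (ring_of_type_algebra :: 'r::comm_ring_1 ring) \<longleftrightarrow>
    ideal I (ring_of_type_algebra :: 'r ring) \<and> I \<noteq> UNIV \<and> (\<forall>x y. x * y \<in> I \<longrightarrow> x \<in> I \<or> y \<in> I)"
proof -
  have "cring (ring_of_type_algebra :: 'r ring)" by (rule cring_from_type_algebra)
  then show ?thesis unfolding primeideal_def primeideal_axioms_def
    by (auto simp: ring_of_type_algebra_def)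
qed

section \<open>Derivations of a polynomial ring raise degrees by a bounded amount\<close>

definition deriv_coeff :: "('r::comm_ring_1 poly \<Rightarrow> 'r poly) \<Rightarrow> nat \<Rightarrow> 'r \<Rightarrow> 'r" where
  "deriv_coeff d n a = coeff (d [:a:]) n"

lemma ring_derivation_deriv_coeff:
  assumes d: "ring_derivation d" shows "ring_derivation (deriv_coeff d n)"
proof -
  interpret ring_derivation d by fact
  show ?thesis
  proof
    fix x y
    have "d [:x + y:] = d [:x:] + d [:y:]" using deriv_add[of "[:x:]" "[:y:]"] by simp
    then show "deriv_coeff d n (x + y) = deriv_coeff d n x + deriv_coeff d n y"
      by (simp add: deriv_coeff_def)
    have "d [:x * y:] = smult x (d [:y:]) + smult y (d [:x:])"
      using deriv_mult[of "[:x:]" "[:y:]"] by (simp add: mult.commute)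
    then show "deriv_coeff d n (x * y) = x * deriv_coeff d n y + deriv_coeff d n x * y"
      by (simp add: deriv_coeff_def mult.commute)
  qed
qed

lemma adjoin_constants_X: "adjoin (range (\<lambda>a. [:a:])) [:0, 1:] = (UNIV :: 'r::comm_ring_1 poly set)"
proof (intro equalityI subset_UNIV subsetI)
  fix p :: "'r poly"
  define q where "q = map_poly (\<lambda>a. [:a:]) p"
  have "q \<in> polys_over (range (\<lambda>a. [:a:]))" by (simp add: q_def polys_over_def coeff_map_poly)
  moreover have "poly q [:0, 1:] = p"
    unfolding q_def by (induction p) (simp_all add: map_poly_pCons)
  ultimately show "p \<in> adjoin (range (\<lambda>a. [:a:])) [:0, 1:]" unfolding adjoin_def by blast
qed

lemma subring_set_constant_polys: "subring_set (range (\<lambda>a::'r::comm_ring_1. [:a:]))"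
  unfolding subring_set_def by (auto simp: image_iff one_pCons)

lemma coeff_mult_degree_bounds:
  fixes p q :: "'r::comm_ring_1 poly"
  assumes "degree p \<le> m" "degree q \<le> n"
  shows "coeff (p * q) (m + n) = coeff p m * coeff q n"
proof (cases "degree p = m \<and> degree q = n")
  case False
  then have "degree (p * q) < m + n" "degree p < m \<or> degree q < n"
    using assms degree_mult_le[of p q] by linarith+
  then show ?thesis by (auto simp: coeff_eq_0)
qed (auto simp: coeff_mult_degree_sum)

text \<open>A rational function over \<open>A\<close> with zero derivative is a fraction of elements of \<open>A\<close>. If \<open>p' q = p q'\<close> with
  nonzero \<open>p\<close>, \<open>q\<close>, comparing top coefficients gives equal degrees; applied to the combination of \<open>p\<close>
  and \<open>q\<close> in which the top terms cancel, this shows that the combination is zero.\<close>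

lemma fract_constant_if_pderiv_0:
  fixes p q :: "'r::idom poly"
  assumes char: "CHAR('r) = 0" and eq: "pderiv p * q = p * pderiv q" and q: "q \<noteq> 0"
  shows "Fract p q = Fract [:lead_coeff p:] [:lead_coeff q:]"
proof -
  have *: "p = 0" if that: "pderiv p * q = p * pderiv q" "p = 0 \<or> degree p < degree q" and q: "q \<noteq> 0"
    for p q :: "'r poly"
  proof (rule ccontr)
    assume p: "p \<noteq> 0"
    then have lt: "degree p < degree q" using that(2) by simp
    have "coeff (pderiv p * q) (degree p + degree q - 1) = of_nat (degree p) * lead_coeff p * lead_coeff q"
    proof (cases "degree p = 0")
      case True
      then obtain a where "p = [:a:]" by (rule degree_eq_zeroE)
      then show ?thesis by simp
    next
      case False
      have le: "degree (pderiv p) \<le> degree p - 1"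
        by (rule degree_le) (auto simp: coeff_pderiv coeff_eq_0)
      have "degree p + degree q - 1 = (degree p - 1) + degree q" using False by simp
      moreover have "coeff (pderiv p * q) ((degree p - 1) + degree q) = coeff (pderiv p) (degree p - 1) * lead_coeff q"
        by (rule coeff_mult_degree_bounds) (use le in auto)
      ultimately show ?thesis using False by (simp add: coeff_pderiv)
    qed
    moreover have "coeff (p * pderiv q) (degree p + degree q - 1) = of_nat (degree q) * lead_coeff p * lead_coeff q"
    proof -
      have le: "degree (pderiv q) \<le> degree q - 1"
        by (rule degree_le) (auto simp: coeff_pderiv coeff_eq_0)
      have "degree p + degree q - 1 = degree p + (degree q - 1)" using lt by simp
      moreover have "coeff (p * pderiv q) (degree p + (degree q - 1)) = lead_coeff p * coeff (pderiv q) (degree q - 1)"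
        by (rule coeff_mult_degree_bounds) (use le in auto)
      ultimately show ?thesis using lt by (simp add: coeff_pderiv mult_ac)
    qed
    ultimately have "of_nat (degree p) * (lead_coeff p * lead_coeff q) = of_nat (degree q) * (lead_coeff p * lead_coeff q)"
      using that by (simp add: mult.assoc)
    then have "of_nat (degree p) = (of_nat (degree q) :: 'r)" using p q by simp
    then show False using lt injD[OF inj_of_nat_CHAR_0[OF char]] by force
  qed
  define r where "r = smult (lead_coeff q) p - smult (lead_coeff p) q"
  have "degree p = degree q" if "p \<noteq> 0"
    using *[OF eq] *[of q p] eq that q by (metis mult.commute linorder_neqE_nat)
  then have "r = 0 \<or> degree r < degree q"
  proof (cases "p = 0 \<or> r = 0")
    case False
    then have deg: "degree p = degree q" using \<open>p \<noteq> 0 \<Longrightarrow> degree p = degree q\<close> by blast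
    have "degree r \<le> degree q"
      unfolding r_def using deg by (intro degree_diff_le) (auto intro: order.trans[OF degree_smult_le])
    moreover have "coeff r (degree q) = 0" unfolding r_def using deg by simp
    then have "degree r \<noteq> degree q" using False by (metis leading_coeff_0_iff)
    ultimately show ?thesis by simp
  qed (auto simp: r_def)
  moreover have "pderiv r * q = r * pderiv q"
    using eq by (simp add: r_def pderiv_diff pderiv_smult algebra_simps)
  ultimately have "r = 0" using *[of r q] q by blast
  then have "p * [:lead_coeff q:] = [:lead_coeff p:] * q" by (simp add: r_def)
  then show ?thesis using q by (simp add: eq_fract)
qed

lemma ring_derivation_pderiv: "ring_derivation (pderiv :: 'r::idom poly \<Rightarrow> 'r poly)"
  by unfold_locales (simp_all add: pderiv_add pderiv_mult algebra_simps)

text \<open>The constants of \<open>d\<close> are the second subring over which \<open>A[t]\<close> is generated by one element. \<open>A\<close> is only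
  noetherian, so there is no finite set of generators on which to test the degree. Their place is
  taken by a point \<open>x\<close> of the orbit with maximal kernel on \<open>A\<close>, whose values on \<open>A\<close> are algebraic
  over the constants of each coefficient of \<open>d\<close>, and by the finitely many elements needed to recover \<open>A\<close> from those values.\<close>

theorem derivation_degree_bounded:
  fixes d :: "'a::idom poly \<Rightarrow> 'a poly"
  assumes noeth: "noetherian_ring (ring_of_type_algebra :: 'a ring)" and char: "CHAR('a) = 0"
    and d: "ring_derivation d" and gen: "adjoin {p. d p = 0} s = UNIV"
  shows "\<exists>N. \<forall>a. degree (d [:a:]) \<le> N"
proof -
  interpret d: ring_derivation d by fact
  define \<iota> :: "'a poly \<Rightarrow> 'a poly fract alg_closure" where "\<iota> p = to_ac (Fract p 1)" for p
  define A1 where "A1 = range (\<lambda>a::'a. [:a:])"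
  have \<iota>: "ring_hom_on UNIV \<iota>"
    by (auto simp: ring_hom_on_def \<iota>_def One_fract_def[symmetric] simp flip: to_ac_add to_ac_mult)
  interpret point_orbit \<iota> A1 "{p. d p = 0}" "[:0, 1:]" s
    by unfold_locales (auto simp: A1_def adjoin_constants_X subring_set_constant_polys d.subring_set_constants gen \<iota>)
  have charM: "CHAR('a poly fract) = 0" using char by (simp add: CHAR_fract)
  have charO: "CHAR('a poly fract alg_closure) = 0" using charM by simp
  have U: "subring_set (UNIV :: 'a poly set)" by (simp add: subring_set_def)

  define \<I> where "\<I> = {{a. x [:a:] = 0} | x. orb UNIV x}"
  have "ideal I ring_of_type_algebra" if "I \<in> \<I>" for I
  proof -
    from that obtain x where x: "orb UNIV x" "I = {a. x [:a:] = 0}" unfolding \<I>_def by blast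
    note hx = ring_hom_on_simps[OF U orb_hom[OF x(1)]]
    have "x [:a + b:] = x [:a:] + x [:b:]" "x [:a * b:] = x [:a:] * x [:b:]" for a b
      using hx(3)[of "[:a:]" "[:b:]"] hx(4)[of "[:a:]" "[:b:]"] by (simp_all add: mult.commute)
    then show ?thesis unfolding ideal_type_iff x(2) using hx(1) by simp
  qed
  moreover have "\<I> \<noteq> {}" unfolding \<I>_def using orb.base[of UNIV] by blast
  ultimately obtain M where M: "M \<in> \<I>" "\<And>I. I \<in> \<I> \<Longrightarrow> M \<subseteq> I \<Longrightarrow> I = M"
    using noetherian_maximal_ideal_in[OF noeth] by metis
  obtain x where x: "orb UNIV x" "M = {a. x [:a:] = 0}" using M(1) by (auto simp: \<I>_def)

  \<comment> \<open>Otherwise the specialised point would kill \<open>a - n\<close> as well, contradicting maximality of \<open>M\<close>.\<close>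
  have alg: "algebraic_over (\<iota> ` A) (x [:a:])" if A: "A = A1 \<or> A = {p. d p = 0}" for A a
  proof (rule ccontr)
    assume "\<not> algebraic_over (\<iota> ` A) (x [:a:])"
    then obtain x' n where x': "orb UNIV x'" "\<And>p. x p = 0 \<Longrightarrow> x' p = 0"
      "x' ([:a:] - of_nat n) = 0" "x ([:a:] - of_nat n) \<noteq> 0"
      using orb_specialise[OF x(1) A _ charO] by blast
    have "{b. x' [:b:] = 0} = M"
      by (rule M(2)) (use x' x(2) in \<open>auto simp: \<I>_def\<close>)
    moreover have "[:a:] - of_nat n = [:a - of_nat n:]" by (simp add: of_nat_poly)
    ultimately show False using x'(3,4) x(2) by auto
  qed

  \<comment> \<open>The \<open>n\<close>-th coefficient of \<open>d\<close> on \<open>A\<close>, extended to \<open>A[t]\<close> by \<open>t \<mapsto> 0\<close> and then to fractions.\<close>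
  define D where "D n = fract_deriv (map_poly (deriv_coeff d n))" for n
  have Dn: "ring_derivation (map_poly (deriv_coeff d n))" for n
    by (rule ring_derivation.map_poly_derivation[OF ring_derivation_deriv_coeff[OF d]])
  have D: "ring_derivation (D n)" for n
    unfolding D_def by (rule ring_derivation_fract_deriv[OF Dn])
  have dc0: "deriv_coeff d n 0 = 0" for n
    using ring_derivation.deriv_0[OF ring_derivation_deriv_coeff[OF d]] .

  \<comment> \<open>A constant of \<open>d/dt\<close> is a fraction \<open>a/b\<close> over \<open>A\<close>; if it is also a constant of \<open>d\<close>, then
        \<open>b d(a) = a d(b)\<close>, and this equation holds coefficientwise.\<close>
  have const: "D n \<phi> = 0" if \<phi>: "fract_deriv pderiv \<phi> = 0" "fract_deriv d \<phi> = 0" for n \<phi>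
  proof -
    obtain p q where pq: "\<phi> = Fract p q" "q \<noteq> 0" by (cases \<phi>)
    define a b where "a = lead_coeff p" and "b = lead_coeff q"
    have b: "[:b:] \<noteq> 0" using pq(2) by (simp add: b_def)
    have eq: "\<phi> = Fract [:a:] [:b:]"
      unfolding pq(1) a_def b_def
      by (rule fract_constant_if_pderiv_0[OF char _ pq(2)])
        (use \<phi>(1) fract_deriv_eq_0_iff[OF ring_derivation_pderiv pq(2)] pq(1) in simp)
    have "d [:a:] * [:b:] = [:a:] * d [:b:]"
      using \<phi>(2) unfolding eq fract_deriv_eq_0_iff[OF d b] .
    from arg_cong[OF this, of "\<lambda>p. coeff p n"]
    have "b * deriv_coeff d n a = a * deriv_coeff d n b" by (simp add: deriv_coeff_def)
    then show ?thesis
      unfolding eq D_def fract_deriv_eq_0_iff[OF Dn b] by (simp add: map_poly_pCons dc0 mult.commute)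
  qed

  have algD: "algebraic_over (to_ac ` {\<phi>. D n \<phi> = 0}) l"
    if \<mu>: "is_min_poly \<mu> l" and "\<And>i. D n (coeff \<mu> i) = 0" for \<mu> l n
    unfolding algebraic_over_def
  proof (rule bexI)
    show "map_poly to_ac \<mu> \<noteq> 0 \<and> poly (map_poly to_ac \<mu>) l = 0"
      using \<mu> by (auto simp: is_min_poly_def ac_root_def map_poly_eq_0_iff)
    show "map_poly to_ac \<mu> \<in> polys_over (to_ac ` {\<phi>. D n \<phi> = 0})"
      using that(2) by (auto simp: polys_over_def coeff_map_poly)
  qed

  \<comment> \<open>The minimal polynomial of \<open>x a\<close> over the fractions of \<open>A[t]\<close> does not depend on the derivation, so
        its coefficients are constants of \<open>d/dt\<close> and of \<open>d\<close> at once.\<close>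
  have alg_point: "algebraic_over (to_ac ` {\<phi>. D n \<phi> = 0}) (x [:a:])" for n a
  proof -
    obtain \<mu> where \<mu>: "is_min_poly \<mu> (x [:a:])" using min_poly_exists by blast
    have "fract_deriv pderiv (coeff \<mu> i) = 0" for i
    proof (rule min_poly_coeffs_constant[OF ring_derivation_fract_deriv[OF ring_derivation_pderiv] charM \<mu>])
      show "algebraic_over (to_ac ` {x. fract_deriv pderiv x = 0}) (x [:a:])"
        by (rule algebraic_over_mono[OF alg[of A1]])
          (auto simp: A1_def \<iota>_def fract_deriv_eq_0_iff[OF ring_derivation_pderiv])
    qed
    moreover have "fract_deriv d (coeff \<mu> i) = 0" for i
    proof (rule min_poly_coeffs_constant[OF ring_derivation_fract_deriv[OF d] charM \<mu>])
      show "algebraic_over (to_ac ` {x. fract_deriv d x = 0}) (x [:a:])"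
        by (rule algebraic_over_mono[OF alg[of "{p. d p = 0}"]])
          (auto simp: \<iota>_def fract_deriv_eq_0_iff[OF d])
    qed
    ultimately show ?thesis using algD[OF \<mu>] const by blast
  qed

  have ev_poly: "eventually (\<lambda>n. map_poly (deriv_coeff d n) p = 0) sequentially" for p
  proof (induction p)
    case (pCons a p)
    have "eventually (\<lambda>n. degree (d [:a:]) < n) sequentially" by (rule eventually_gt_at_top)
    then have "eventually (\<lambda>n. deriv_coeff d n a = 0) sequentially"
      by eventually_elim (simp add: deriv_coeff_def coeff_eq_0)
    with pCons.IH show ?case by eventually_elim (simp add: map_poly_pCons dc0)
  qed auto
  have ev_fract: "eventually (\<lambda>n. D n \<phi> = 0) sequentially" for \<phi>
  proof -
    obtain p q where pq: "\<phi> = Fract p q" "q \<noteq> 0" by (cases \<phi>)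
    show ?thesis
      using ev_poly[of p] ev_poly[of q]
      by eventually_elim (simp add: pq D_def fract_deriv_eq_0_iff[OF Dn])
  qed
  have ev_alg: "eventually (\<lambda>n. algebraic_over (to_ac ` {\<phi>. D n \<phi> = 0}) l) sequentially" for l
  proof -
    obtain \<mu> where \<mu>: "is_min_poly \<mu> l" using min_poly_exists by blast
    have "eventually (\<lambda>n. \<forall>\<phi>\<in>insert 0 (set (coeffs \<mu>)). D n \<phi> = 0) sequentially"
      by (rule eventually_ball_finite) (use ev_fract in auto)
    then show ?thesis
    proof eventually_elim
      case (elim n)
      have "D n (coeff \<mu> i) = 0" for i using elim by (metis insertCI coeff_in_coeffs coeff_eq_0 not_le coeff_0)
      then show ?case by (rule algD[OF \<mu>])
    qed
  qed

  obtain \<Sigma> where \<Sigma>: "finite \<Sigma>" "range \<iota> \<subseteq> generated_subring (x ` A1 \<union> \<Sigma>)"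
    by (rule orb_generates_base[OF x(1)])
  have "eventually (\<lambda>n. \<forall>l\<in>\<Sigma>. algebraic_over (to_ac ` {\<phi>. D n \<phi> = 0}) l) sequentially"
    by (rule eventually_ball_finite) (use \<Sigma>(1) ev_alg in auto)
  then obtain N where N: "\<And>n l. n \<ge> N \<Longrightarrow> l \<in> \<Sigma> \<Longrightarrow> algebraic_over (to_ac ` {\<phi>. D n \<phi> = 0}) l"
    unfolding eventually_sequentially by blast
  have "deriv_coeff d n a = 0" if n: "n \<ge> N" for n a
  proof -
    have sf: "subfield_set (to_ac ` {\<phi>. D n \<phi> = 0})"
      using subfield_set_constants[OF D, of n] subring_set_image[OF _ ring_hom_on_to_ac]
      unfolding subfield_set_def by (auto simp flip: to_ac_inverse)
    have "x ` A1 \<union> \<Sigma> \<subseteq> {l. algebraic_over (to_ac ` {\<phi>. D n \<phi> = 0}) l}"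
      using N[OF n] alg_point by (auto simp: A1_def)
    from generated_subring_minimal[OF subring_set_algebraic_over_subfield[OF sf] this] \<Sigma>(2)
    have "algebraic_over (to_ac ` {\<phi>. D n \<phi> = 0}) (\<iota> [:a:])" by blast
    then have "D n (Fract [:a:] 1) = 0"
      unfolding \<iota>_def by (rule algebraic_over_constants[OF D charM])
    then show ?thesis by (simp add: D_def fract_deriv_eq_0_iff[OF Dn] map_poly_pCons dc0 ring_derivation.deriv_1[OF Dn])
  qed
  then have "degree (d [:a:]) \<le> N" for a
    unfolding deriv_coeff_def by (intro degree_le) auto
  then show ?thesis by blast
qed

section \<open>Locally nilpotent derivations\<close>

text \<open>A predicate instead of a type class, because \<open>A'\<close> is given as a commutative ring and is recognised as
  a domain of characteristic zero only through the isomorphism \<open>A[t] \<cong> A'[t']\<close>.\<close>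

definition char0_domain :: "'r::comm_ring_1 itself \<Rightarrow> bool" where
  "char0_domain _ \<longleftrightarrow> (\<forall>x y::'r. x * y = 0 \<longrightarrow> x = 0 \<or> y = 0) \<and> CHAR('r) = 0"

lemma char0_domainD:
  assumes "char0_domain TYPE('r::comm_ring_1)"
  shows "(x::'r) * y = 0 \<Longrightarrow> x = 0 \<or> y = 0"
    and "of_nat n = (0::'r) \<Longrightarrow> n = 0"
    and "of_nat n * (x::'r) = 0 \<Longrightarrow> n \<noteq> 0 \<Longrightarrow> x = 0"
proof -
  show *: "(x::'r) * y = 0 \<Longrightarrow> x = 0 \<or> y = 0" for x y
    using assms by (simp add: char0_domain_def)
  show **: "of_nat n = (0::'r) \<Longrightarrow> n = 0" for n
    using assms by (simp add: char0_domain_def of_nat_eq_0_iff_char_dvd)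
  show "of_nat n * (x::'r) = 0 \<Longrightarrow> n \<noteq> 0 \<Longrightarrow> x = 0" using * ** by blast
qed

lemma char0_domain_idom: "CHAR('r::idom) = 0 \<Longrightarrow> char0_domain TYPE('r)"
  by (simp add: char0_domain_def)

lemma char0_domain_poly:
  assumes "char0_domain TYPE('r::comm_ring_1)" shows "char0_domain TYPE('r poly)"
proof -
  have "p = 0 \<or> q = 0" if "p * q = 0" for p q :: "'r poly"
  proof -
    have "lead_coeff p * lead_coeff q = 0" using that coeff_mult_degree_sum[of p q] by simp
    then show ?thesis using char0_domainD(1)[OF assms] leading_coeff_0_iff by metis
  qed
  then show ?thesis using assms by (simp add: char0_domain_def)
qed

text \<open>The derivative of polynomials over a ring that may have zero divisors; over a domain it agrees with
  \<^const>\<open>pderiv\<close>.\<close>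

definition formal_deriv :: "'r::comm_ring_1 poly \<Rightarrow> 'r poly" where
  "formal_deriv p = (\<Sum>i<degree p. monom (of_nat (Suc i) * coeff p (Suc i)) i)"

lemma coeff_formal_deriv: "coeff (formal_deriv p) i = of_nat (Suc i) * coeff p (Suc i)"
proof -
  have "coeff (formal_deriv p) i = (\<Sum>j<degree p. if j = i then of_nat (Suc j) * coeff p (Suc j) else 0)"
    unfolding formal_deriv_def coeff_sum by (intro sum.cong) auto
  also have "\<dots> = (if i < degree p then of_nat (Suc i) * coeff p (Suc i) else 0)" by (subst sum.delta) auto
  also have "\<dots> = of_nat (Suc i) * coeff p (Suc i)" by (simp add: coeff_eq_0)
  finally show ?thesis .
qed

lemma formal_deriv_pCons: "formal_deriv (pCons a p) = p + pCons 0 (formal_deriv p)"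
  by (rule poly_eqI) (auto simp: coeff_formal_deriv coeff_pCons algebra_simps split: nat.splits)

lemma formal_deriv_simps:
  "formal_deriv 0 = 0" "formal_deriv [:a:] = 0" "formal_deriv [:0, 1:] = 1"
  "formal_deriv (p + q) = formal_deriv p + formal_deriv q"
  by (auto intro!: poly_eqI simp: coeff_formal_deriv coeff_pCons distrib_left split: nat.splits)

lemma formal_deriv_smult: "formal_deriv (smult a p) = smult a (formal_deriv p)"
  by (rule poly_eqI) (simp add: coeff_formal_deriv mult.left_commute)

lemma ring_derivation_formal_deriv: "ring_derivation formal_deriv"
proof
  show "formal_deriv (p + q) = formal_deriv p + formal_deriv q" for p q :: "'r::comm_ring_1 poly"
    by (rule formal_deriv_simps)
  show "formal_deriv (p * q) = p * formal_deriv q + formal_deriv p * q" for p q :: "'r::comm_ring_1 poly"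
    by (induction p)
      (simp_all add: formal_deriv_simps formal_deriv_pCons formal_deriv_smult algebra_simps)
qed

lemma degree_formal_deriv_le: "degree (formal_deriv p) \<le> degree p - 1"
  by (rule degree_le) (auto simp: coeff_formal_deriv coeff_eq_0)

lemma formal_deriv_eq_0_iff:
  assumes "char0_domain TYPE('r::comm_ring_1)"
  shows "formal_deriv (p :: 'r poly) = 0 \<longleftrightarrow> (\<exists>a. p = [:a:])"
proof
  assume p: "formal_deriv p = 0"
  have "coeff p (Suc i) = 0" for i
    using char0_domainD(3)[OF assms, of "Suc i" "coeff p (Suc i)"] arg_cong[OF p, of "\<lambda>q. coeff q i"]
    unfolding coeff_formal_deriv by simp
  then have "p = [:coeff p 0:]" by (intro poly_eqI) (auto simp: coeff_pCons split: nat.splits)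
  then show "\<exists>a. p = [:a:]" by blast
qed (auto simp: formal_deriv_simps)

lemma formal_deriv_nilpotent: "degree p < n \<Longrightarrow> (formal_deriv ^^ n) p = 0"
proof (induction n arbitrary: p)
  case (Suc n)
  show ?case
  proof (cases "n = 0")
    case True
    then have "formal_deriv p = 0"
      using Suc.prems by (intro poly_eqI) (simp add: coeff_formal_deriv coeff_eq_0)
    then show ?thesis using True by simp
  next
    case False
    then have "degree (formal_deriv p) < n" using Suc.prems degree_formal_deriv_le[of p] by linarith
    from Suc.IH[OF this] show ?thesis by (simp add: funpow_swap1)
  qed
qed simp

context ring_derivation
begin

lemma funpow_deriv_0 [simp]: "(d ^^ n) 0 = 0"
  by (induction n) auto

lemma funpow_deriv_add: "(d ^^ n) (x + y) = (d ^^ n) x + (d ^^ n) y"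
  by (induction n) (auto simp: deriv_add)

lemma funpow_deriv_mult:
  "(d ^^ n) (x * y) = (\<Sum>k\<le>n. of_nat (n choose k) * ((d ^^ k) x * (d ^^ (n - k)) y))"
proof (induction n)
  case (Suc n)
  let ?t = "\<lambda>k. (d ^^ k) x * (d ^^ (Suc n - k)) y"
  have "(d ^^ Suc n) (x * y) = (\<Sum>k\<le>n. d (of_nat (n choose k) * ((d ^^ k) x * (d ^^ (n - k)) y)))"
    by (simp add: Suc deriv_sum)
  also have "\<dots> = (\<Sum>k\<le>n. of_nat (n choose k) * ?t k + of_nat (n choose k) * ?t (Suc k))"
  proof (rule sum.cong)
    fix k assume "k \<in> {..n}"
    then have "Suc n - k = Suc (n - k)" by auto
    then show "d (of_nat (n choose k) * ((d ^^ k) x * (d ^^ (n - k)) y)) =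
        of_nat (n choose k) * ?t k + of_nat (n choose k) * ?t (Suc k)"
      by (simp add: deriv_mult algebra_simps)
  qed simp
  also have "\<dots> = (\<Sum>k\<le>n. of_nat (n choose k) * ?t k) + (\<Sum>k\<le>n. of_nat (n choose k) * ?t (Suc k))"
    by (rule sum.distrib)
  also have "(\<Sum>k\<le>n. of_nat (n choose k) * ?t k) = (\<Sum>k\<le>Suc n. of_nat (n choose k) * ?t k)"
    by (simp add: binomial_eq_0)
  also have "\<dots> = ?t 0 + (\<Sum>k\<le>n. of_nat (n choose Suc k) * ?t (Suc k))"
    by (subst sum.atMost_Suc_shift) simp
  also have "\<dots> + (\<Sum>k\<le>n. of_nat (n choose k) * ?t (Suc k)) =
      ?t 0 + (\<Sum>k\<le>n. of_nat (Suc n choose Suc k) * ?t (Suc k))"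
    by (simp add: sum.distrib[symmetric] algebra_simps)
  also have "\<dots> = (\<Sum>k\<le>Suc n. of_nat (Suc n choose k) * ?t k)"
    unfolding sum.atMost_Suc_shift[of _ n] by simp
  finally show ?case .
qed simp

text \<open>In the Leibniz formula for \<open>d\<^sup>i\<^sup>+\<^sup>j(x y)\<close> only the term with \<open>d\<^sup>i x\<close> and \<open>d\<^sup>j y\<close> is outside of \<open>I\<close>. Thus the
  order of nilpotency modulo a prime ideal is additive; the zero ideal gives a degree function on a
  domain.\<close>

lemma top_order_mult:
  assumes ideal: "0 \<in> I" "\<And>x y. x \<in> I \<Longrightarrow> y \<in> I \<Longrightarrow> x + y \<in> I" "\<And>x r. x \<in> I \<Longrightarrow> r * x \<in> I"
    and prime: "\<And>x y. x * y \<in> I \<Longrightarrow> x \<in> I \<or> y \<in> I" and char: "\<And>n. of_nat (Suc n) \<notin> I"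
    and x: "(d ^^ i) x \<notin> I" "\<And>k. k > i \<Longrightarrow> (d ^^ k) x \<in> I"
    and y: "(d ^^ j) y \<notin> I" "\<And>k. k > j \<Longrightarrow> (d ^^ k) y \<in> I"
  shows "(d ^^ (i + j)) (x * y) \<notin> I"
proof
  assume a: "(d ^^ (i + j)) (x * y) \<in> I"
  let ?f = "\<lambda>k. of_nat (i + j choose k) * ((d ^^ k) x * (d ^^ (i + j - k)) y)"
  have sum_in_ideal: "(\<And>k. k \<in> K \<Longrightarrow> f k \<in> I) \<Longrightarrow> sum f K \<in> I" for f :: "nat \<Rightarrow> 'r" and K
    by (induction K rule: infinite_finite_induct) (auto intro: ideal)
  have "?f k \<in> I" if "k \<noteq> i" "k \<le> i + j" for k
  proof (cases "k > i")
    case True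
    then show ?thesis using x(2)[OF True] ideal(3) by (metis mult.commute)
  next
    case False
    then have "i + j - k > j" using that by auto
    then show ?thesis using y(2) ideal(3) by (metis mult.assoc)
  qed
  then have "sum ?f ({..i + j} - {i}) \<in> I"
    by (intro sum_in_ideal) auto
  moreover have "sum ?f {..i + j} = ?f i + sum ?f ({..i + j} - {i})"
    by (rule sum.remove) auto
  ultimately have "?f i \<in> I"
    using a ideal(2)[OF a[unfolded funpow_deriv_mult] ideal(3)[of _ "- 1"]] by fastforce
  moreover obtain n where n: "i + j choose i = Suc n"
    by (metis gr0_implies_Suc le_add1 zero_less_binomial)
  ultimately show False using prime char[of n] x(1) y(1) by (metis add_diff_cancel_left')
qed

lemma top_order_exists:
  assumes "0 \<in> I" and x: "x \<notin> I" and nil: "\<exists>n. (d ^^ n) x = 0"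
  obtains i where "(d ^^ i) x \<notin> I" "\<And>k. k > i \<Longrightarrow> (d ^^ k) x \<in> I"
proof -
  obtain n where n: "(d ^^ n) x = 0" using nil by blast
  have z: "(d ^^ k) x = 0" if "k \<ge> n" for k
  proof -
    have "(d ^^ k) x = (d ^^ (k - n)) ((d ^^ n) x)"
      using that by (metis funpow_add comp_apply le_add_diff_inverse2)
    then show ?thesis using n by simp
  qed
  define K where "K = {k. (d ^^ k) x \<notin> I}"
  have "K \<subseteq> {..<n}" using z assms(1) by (force simp: K_def not_less[symmetric])
  then have K: "finite K" by (rule finite_subset) simp
  moreover have "0 \<in> K" using x by (simp add: K_def)
  ultimately have "Max K \<in> K" "\<And>k. k \<in> K \<Longrightarrow> k \<le> Max K" by (auto intro: Max_in)
  then show thesis by (intro that[of "Max K"]) (auto simp: K_def not_le[symmetric])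
qed

lemma top_order_mult_domain:
  assumes dom: "char0_domain TYPE('r)"
    and x: "(d ^^ i) x \<noteq> 0" "\<And>k. k > i \<Longrightarrow> (d ^^ k) x = 0"
    and y: "(d ^^ j) y \<noteq> 0" "\<And>k. k > j \<Longrightarrow> (d ^^ k) y = 0"
  shows "(d ^^ (i + j)) (x * y) \<noteq> 0"
proof -
  have "(d ^^ (i + j)) (x * y) \<notin> {0}"
    by (rule top_order_mult) (use x y char0_domainD(1)[OF dom] char0_domainD(2)[OF dom, of "Suc _"] in auto)
  then show ?thesis by simp
qed

text \<open>The orders of nilpotency of \<open>x\<close> and \<open>y\<close> add up to that of \<open>x y\<close>, which is zero.\<close>

lemma constant_factor:
  assumes dom: "char0_domain TYPE('r)" and nil: "\<exists>n. (d ^^ n) x = 0" "\<exists>n. (d ^^ n) y = 0"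
    and xy: "x * y \<noteq> 0" "d (x * y) = 0"
  shows "d x = 0"
proof (rule ccontr)
  assume dx: "d x \<noteq> 0"
  have "x \<noteq> 0" "y \<noteq> 0" using xy by auto
  then obtain i j where i: "(d ^^ i) x \<noteq> 0" "\<And>k. k > i \<Longrightarrow> (d ^^ k) x = 0"
    and j: "(d ^^ j) y \<noteq> 0" "\<And>k. k > j \<Longrightarrow> (d ^^ k) y = 0"
    using top_order_exists[of "{0}" x] top_order_exists[of "{0}" y] nil by (metis singleton_iff)
  have "i \<noteq> 0" using i(2)[of 1] dx by auto
  then obtain k where "i + j = Suc k" by (metis add_is_0 not0_implies_Suc)
  moreover have "(d ^^ (i + j)) (x * y) \<noteq> 0" by (rule top_order_mult_domain[OF dom i j])
  ultimately show False using xy(2) by (simp add: funpow_swap1)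
qed

lemma unit_constant:
  assumes dom: "char0_domain TYPE('r)" and nil: "\<And>x. \<exists>n. (d ^^ n) x = 0" and u: "u dvd 1"
  shows "d u = 0"
proof -
  obtain v where v: "1 = u * v" using u by (auto elim: dvdE)
  show ?thesis by (rule constant_factor[OF dom nil nil, of u v]) (simp_all flip: v)
qed

text \<open>If \<open>y \<noteq> 0\<close>, the order of \<open>x y\<close> is at least that of \<open>x\<close>, whereas \<open>d x\<close> has smaller order.\<close>

lemma deriv_multiple_of_self:
  assumes dom: "char0_domain TYPE('r)" and nil: "\<exists>n. (d ^^ n) x = 0" "\<exists>n. (d ^^ n) y = 0"
    and x: "x \<noteq> 0" "d x = x * y"
  shows "y = 0"
proof (rule ccontr)
  assume "y \<noteq> 0"
  then obtain i j where i: "(d ^^ i) x \<noteq> 0" "\<And>k. k > i \<Longrightarrow> (d ^^ k) x = 0"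
    and j: "(d ^^ j) y \<noteq> 0" "\<And>k. k > j \<Longrightarrow> (d ^^ k) y = 0"
    using top_order_exists[of "{0}" x] top_order_exists[of "{0}" y] nil x by (metis singleton_iff)
  have "(d ^^ (i + j)) (d x) \<noteq> 0" unfolding x(2) by (rule top_order_mult_domain[OF dom i j])
  then show False using i(2)[of "Suc (i + j)"] by (simp add: funpow_swap1)
qed

end

text \<open>The derivation splits into its action \<open>h\<close> on coefficients, which raises degrees by at most \<open>N\<close>, and its
  action on the variable. The bound is stated for all \<open>j \<ge> degree p\<close> so that the induction applies
  also when leading terms cancel.\<close>

lemma derivation_poly_decomposition:
  fixes d :: "'r::comm_ring_1 poly \<Rightarrow> 'r poly"
  assumes d: "ring_derivation d" and N: "\<And>a. degree (d [:a:]) \<le> N"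
  shows "\<exists>h. d p = h + formal_deriv p * d [:0, 1:] \<and>
    (\<forall>j\<ge>degree p. degree h \<le> N + j \<and> coeff h (N + j) = deriv_coeff d N (coeff p j))"
proof (induction p)
  case 0
  show ?case
    by (rule exI[of _ 0])
      (simp add: ring_derivation.deriv_0[OF d] formal_deriv_simps deriv_coeff_def)
next
  case (pCons a p)
  interpret ring_derivation d by fact
  obtain h where h: "d p = h + formal_deriv p * d [:0, 1:]"
    "\<And>j. j \<ge> degree p \<Longrightarrow> degree h \<le> N + j \<and> coeff h (N + j) = deriv_coeff d N (coeff p j)"
    using pCons.IH by blast
  have eq: "pCons a p = [:a:] + [:0, 1:] * p" by simp
  have "d (pCons a p) = (d [:a:] + pCons 0 h) + formal_deriv (pCons a p) * d [:0, 1:]"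
    unfolding eq deriv_add deriv_mult h(1) using formal_deriv_pCons[of a p]
    by (simp add: algebra_simps)
  moreover have "degree (d [:a:] + pCons 0 h) \<le> N + j \<and>
      coeff (d [:a:] + pCons 0 h) (N + j) = deriv_coeff d N (coeff (pCons a p) j)"
    if j: "j \<ge> degree (pCons a p)" for j
  proof (cases "p = 0")
    case True
    then have h0: "h = 0" using h(1) by (simp add: formal_deriv_simps)
    show ?thesis
    proof (cases j)
      case 0
      then show ?thesis using N[of a] True h0 by (simp add: deriv_coeff_def)
    next
      case (Suc j')
      then have "coeff (d [:a:]) (N + j) = 0" using N[of a] by (simp add: coeff_eq_0)
      then show ?thesis using N[of a] True h0 Suc
        by (simp add: ring_derivation.deriv_0[OF ring_derivation_deriv_coeff[OF d]] le_SucI trans_le_add1)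
    qed
  next
    case False
    then obtain j' where j': "j = Suc j'" "j' \<ge> degree p" using j by (cases j) auto
    have "degree (pCons 0 h) \<le> N + j" using h(2)[OF j'(2)] j'(1) degree_pCons_le[of 0 h] by simp
    moreover have "degree (d [:a:]) \<le> N + j" using N[of a] by simp
    moreover have "coeff (d [:a:]) (N + j) = 0" using N[of a] j'(1) by (simp add: coeff_eq_0)
    ultimately show ?thesis using h(2)[OF j'(2)] j'(1) by (auto intro: degree_add_le)
  qed
  ultimately show ?case by blast
qed

text \<open>Let \<open>\<delta>\<close> be the homogeneous part of \<open>d\<close> that raises degrees by \<open>N\<close>: it sends \<open>a \<in> A\<close> to \<open>D(a) t\<^sup>N\<close>, where
  \<open>D = deriv_coeff d N\<close>, and it sends \<open>t\<close> to \<open>f t\<^sup>N\<^sup>+\<^sup>1\<close>. No part of higher degree exists: if \<open>d t\<close> had degree above \<open>N + 1\<close>, then \<open>d\<close>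
  would map nonconstant polynomials to nonconstant ones and could not be nilpotent at \<open>t\<close>. As the top part of a locally nilpotent derivation, \<open>\<delta>\<close>
  is nilpotent on monomials. Now \<open>t\<close> divides \<open>\<delta> t\<close>, which forces \<open>f = 0\<close>, so
  \<open>\<delta>\<^sup>n a = D\<^sup>n(a) t\<^sup>n\<^sup>N\<close> and \<open>D\<close> is locally nilpotent.\<close>

lemma leading_coefficient_locally_nilpotent:
  fixes d :: "'r::comm_ring_1 poly \<Rightarrow> 'r poly"
  assumes dom: "char0_domain TYPE('r)" and d: "ring_derivation d"
    and nil: "\<And>p. \<exists>n. (d ^^ n) p = 0" and N: "\<And>a. degree (d [:a:]) \<le> N"
  shows "\<exists>n. (deriv_coeff d N ^^ n) a = 0"
proof -
  interpret d: ring_derivation d by fact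
  interpret D: ring_derivation "deriv_coeff d N" by (rule ring_derivation_deriv_coeff[OF d])
  interpret DP: ring_derivation "map_poly (deriv_coeff d N)" by (rule D.map_poly_derivation)
  interpret f: ring_derivation "formal_deriv :: 'r poly \<Rightarrow> _" by (rule ring_derivation_formal_deriv)
  let ?D = "deriv_coeff d N"
  note domP = char0_domain_poly[OF dom]
  define g where "g = d [:0, 1:]"
  have deg_g: "degree g \<le> N + 1"
  proof (rule ccontr)
    assume "\<not> degree g \<le> N + 1"
    then have m: "degree g \<ge> N + 2" by simp
    have step: "degree (d p) \<ge> 1" if p: "degree p \<ge> 1" for p
    proof -
      obtain h where h: "d p = h + formal_deriv p * g" "degree h \<le> N + degree p"
        using derivation_poly_decomposition[OF d N, of p] unfolding g_def by blast
      have "coeff (formal_deriv p * g) ((degree p - 1) + degree g) = coeff (formal_deriv p) (degree p - 1) * lead_coeff g"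
        by (rule coeff_mult_degree_bounds[OF degree_formal_deriv_le]) simp
      also have "\<dots> = of_nat (degree p) * (lead_coeff p * lead_coeff g)"
        using p by (simp add: coeff_formal_deriv mult.assoc del: of_nat_Suc)
      also have "\<dots> \<noteq> 0"
      proof
        assume "of_nat (degree p) * (lead_coeff p * lead_coeff g) = 0"
        then have "lead_coeff p = 0 \<or> lead_coeff g = 0"
          using char0_domainD(1,3)[OF dom] p by (metis One_nat_def not_one_le_zero)
        then show False using p m by auto
      qed
      finally have "coeff (d p) ((degree p - 1) + degree g) \<noteq> 0"
        using h p m by (simp add: coeff_eq_0)
      then have "(degree p - 1) + degree g \<le> degree (d p)" by (rule le_degree)
      then show ?thesis using m by simp
    qed
    have "degree ((d ^^ n) [:0, 1:]) \<ge> 1" for n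
      by (induction n) (use step in auto)
    moreover obtain n where "(d ^^ n) [:0, 1:] = 0" using nil by blast
    ultimately show False by (metis degree_0 not_one_le_zero)
  qed
  \<comment> \<open>This may be zero: \<open>N + 1\<close> is only an upper bound for the degree of \<open>g = d t\<close>.\<close>
  define f where "f = coeff g (N + 1)"
  define \<delta> where "\<delta> p = monom 1 N * (map_poly ?D p + monom f 1 * formal_deriv p)" for p
  have \<delta>: "ring_derivation \<delta>"
    by unfold_locales (simp_all add: \<delta>_def DP.deriv_add DP.deriv_mult f.deriv_add f.deriv_mult algebra_simps)
  interpret \<delta>: ring_derivation \<delta> by (rule \<delta>)
  have \<delta>_monom: "\<delta> (monom a j) = monom (?D a + of_nat j * (f * a)) (N + j)" for a j
  proof -
    have "formal_deriv (monom a j) = (if j = 0 then 0 else monom (of_nat j * a) (j - 1))"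
      by (rule poly_eqI) (auto simp: coeff_formal_deriv)
    moreover have "map_poly ?D (monom a j) = monom (?D a) j" by (rule poly_eqI) simp
    ultimately show ?thesis
      by (auto simp: \<delta>_def mult_monom add_monom distrib_left mult_ac)
  qed
  have top: "degree (d p) \<le> N + j \<and> coeff (d p) (N + j) = ?D (coeff p j) + of_nat j * (f * coeff p j)"
    if j: "degree p \<le> j" for p j
  proof -
    obtain h where h: "d p = h + formal_deriv p * g" "degree h \<le> N + j" "coeff h (N + j) = ?D (coeff p j)"
      using derivation_poly_decomposition[OF d N, of p] j unfolding g_def by blast
    show ?thesis
    proof (cases "j = 0")
      case True
      then have "formal_deriv p = 0" using j degree_formal_deriv_le[of p]
        by (intro poly_eqI) (simp add: coeff_formal_deriv coeff_eq_0)
      then show ?thesis using h True by simp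
    next
      case False
      have le: "degree (formal_deriv p) \<le> j - 1" using degree_formal_deriv_le[of p] j by simp
      have "coeff (formal_deriv p * g) ((j - 1) + (N + 1)) = coeff (formal_deriv p) (j - 1) * f"
        unfolding f_def by (rule coeff_mult_degree_bounds[OF le deg_g])
      moreover have "(j - 1) + (N + 1) = N + j" using False by simp
      moreover have "degree (formal_deriv p * g) \<le> N + j"
        using degree_mult_le[of "formal_deriv p" g] le deg_g False by linarith
      ultimately show ?thesis using h False
        by (auto simp: coeff_formal_deriv mult_ac add.commute[of j N] simp del: of_nat_Suc intro!: degree_add_le)
    qed
  qed
  have iter: "degree ((d ^^ k) (monom a j)) \<le> k * N + j \<and>
      (\<delta> ^^ k) (monom a j) = monom (coeff ((d ^^ k) (monom a j)) (k * N + j)) (k * N + j)" for k a j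
  proof (induction k)
    case 0
    show ?case by (simp add: degree_monom_le)
  next
    case (Suc k)
    from top[OF conjunct1[OF Suc]] Suc show ?case by (simp add: \<delta>_monom add.assoc)
  qed
  have \<delta>_nil: "\<exists>n. (\<delta> ^^ n) (monom a j) = 0" for a j
  proof -
    obtain n where "(d ^^ n) (monom a j) = 0" using nil by blast
    then show ?thesis using iter[of n a j] by (intro exI[of _ n]) simp
  qed
  have "\<delta> (monom 1 1) = monom 1 1 * monom f N"
    by (simp only: \<delta>_monom) (simp add: mult_monom)
  then have "monom f N = 0"
    by (rule \<delta>.deriv_multiple_of_self[OF domP \<delta>_nil \<delta>_nil, rotated]) simp
  then have f: "f = 0" by simp
  have "(\<delta> ^^ n) (monom a 0) = monom ((?D ^^ n) a) (n * N)" for n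
    by (induction n) (simp_all add: \<delta>_monom f)
  then show ?thesis using \<delta>_nil[of a 0] by simp
qed

section \<open>The second polynomial variable as a derivation of the first ring\<close>

text \<open>The derivation \<open>der\<close> below is \<open>d/dt'\<close> transported to \<open>A[t]\<close>; all arguments compare \<open>A\<close> with its
  constants, which are the image of \<open>A'\<close>.\<close>

locale poly_ring_iso =
  fixes \<phi> :: "'a::comm_ring_1 poly \<Rightarrow> 'b::comm_ring_1 poly" and \<psi> :: "'b poly \<Rightarrow> 'a poly"
  assumes iso_add: "\<phi> (p + q) = \<phi> p + \<phi> q" and iso_mult: "\<phi> (p * q) = \<phi> p * \<phi> q"
    and inv_iso [simp]: "\<psi> (\<phi> p) = p" and iso_inv [simp]: "\<phi> (\<psi> r) = r"
    and dom: "char0_domain TYPE('a)"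
begin

lemma iso_0 [simp]: "\<phi> 0 = 0"
  using iso_add[of 0 0] by simp

lemma iso_1 [simp]: "\<phi> 1 = 1"
  using iso_mult[of 1 "\<psi> 1"] by simp

lemma iso_minus: "\<phi> (- p) = - \<phi> p"
  using iso_add[of p "- p"] by (simp add: eq_neg_iff_add_eq_0 add.commute)

lemma iso_diff: "\<phi> (p - q) = \<phi> p - \<phi> q"
  using iso_add[of p "- q"] by (simp add: iso_minus)

lemma iso_of_nat: "\<phi> (of_nat n) = of_nat n"
  by (induction n) (simp_all add: iso_add)

lemma iso_inject: "\<phi> p = \<phi> q \<longleftrightarrow> p = q"
  by (metis inv_iso)

lemma iso_power: "\<phi> (p ^ n) = \<phi> p ^ n"
  by (induction n) (simp_all add: iso_mult)

lemma dom': "char0_domain TYPE('b)"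
  unfolding char0_domain_def
proof (intro conjI allI impI)
  fix x y :: 'b assume "x * y = 0"
  then have "\<phi> (\<psi> [:x:] * \<psi> [:y:]) = \<phi> 0" by (simp add: iso_mult mult.commute)
  then have "\<psi> [:x:] * \<psi> [:y:] = 0" by (simp only: iso_inject)
  then have "\<psi> [:x:] = 0 \<or> \<psi> [:y:] = 0" using char0_domainD(1)[OF char0_domain_poly[OF dom]] by blast
  then show "x = 0 \<or> y = 0" by (metis iso_inv iso_0 pCons_eq_0_iff)
next
  have "of_nat n = (0 :: 'b) \<Longrightarrow> n = 0" for n
  proof -
    assume "of_nat n = (0 :: 'b)"
    then have "\<phi> (of_nat n) = \<phi> 0" unfolding iso_of_nat by (simp add: of_nat_poly)
    then have "of_nat n = (0 :: 'a poly)" by (simp only: iso_inject)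
    then show "n = 0" using char0_domainD(2)[OF char0_domain_poly[OF dom]] by blast
  qed
  then show "CHAR('b) = 0" by (metis of_nat_CHAR)
qed

lemma inverse_iso: "poly_ring_iso \<psi> \<phi>"
proof
  show "\<psi> (p + q) = \<psi> p + \<psi> q" for p q using iso_add[of "\<psi> p" "\<psi> q"] by (metis inv_iso iso_inv)
  show "\<psi> (p * q) = \<psi> p * \<psi> q" for p q using iso_mult[of "\<psi> p" "\<psi> q"] by (metis inv_iso iso_inv)
qed (use dom' in auto)

definition der :: "'a poly \<Rightarrow> 'a poly" where
  "der p = \<psi> (formal_deriv (\<phi> p))"

lemma iso_der: "\<phi> (der p) = formal_deriv (\<phi> p)"
  by (simp add: der_def)

lemma ring_derivation_der: "ring_derivation der"
proof -
  interpret inv: poly_ring_iso \<psi> \<phi> by (rule inverse_iso)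
  interpret f: ring_derivation "formal_deriv :: 'b poly \<Rightarrow> _" by (rule ring_derivation_formal_deriv)
  show ?thesis
    by unfold_locales
      (simp_all add: der_def iso_add iso_mult inv.iso_add inv.iso_mult f.deriv_add f.deriv_mult)
qed

sublocale der: ring_derivation der by (rule ring_derivation_der)

lemma der_nilpotent: "\<exists>n. (der ^^ n) p = 0"
proof -
  have "\<phi> ((der ^^ n) p) = (formal_deriv ^^ n) (\<phi> p)" for n
    by (induction n) (simp_all add: iso_der)
  from this[of "Suc (degree (\<phi> p))"] have "\<phi> ((der ^^ Suc (degree (\<phi> p))) p) = \<phi> 0"
    unfolding formal_deriv_nilpotent[OF lessI] iso_0 .
  then show ?thesis unfolding iso_inject by blast
qed

lemma der_eq_0_iff: "der p = 0 \<longleftrightarrow> (\<exists>b. \<phi> p = [:b:])"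
  using formal_deriv_eq_0_iff[OF dom', of "\<phi> p"] iso_inject[of "der p" 0] by (simp add: iso_der)

lemma der_generator: "der (\<psi> [:0, 1:]) = 1"
proof -
  have "\<phi> (der (\<psi> [:0, 1:])) = \<phi> 1" by (simp add: iso_der formal_deriv_simps)
  then show ?thesis by (simp only: iso_inject)
qed

lemma adjoin_constants: "adjoin {p. der p = 0} (\<psi> [:0, 1:]) = UNIV"
proof (intro equalityI subset_UNIV subsetI)
  fix p :: "'a poly"
  interpret inv: poly_ring_iso \<psi> \<phi> by (rule inverse_iso)
  define r where "r = map_poly (\<lambda>b. \<psi> [:b:]) (\<phi> p)"
  have "r \<in> polys_over {p. der p = 0}"
    by (auto simp: r_def polys_over_def coeff_map_poly der_eq_0_iff)
  moreover have "poly (map_poly (\<lambda>b. \<psi> [:b:]) q) (\<psi> [:0, 1:]) = \<psi> q" for q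
  proof (induction q)
    case (pCons b q)
    have eq: "pCons b q = [:b:] + [:0, 1:] * q" by simp
    have "\<psi> (pCons b q) = \<psi> [:b:] + \<psi> [:0, 1:] * \<psi> q"
      by (subst eq) (simp only: inv.iso_add inv.iso_mult)
    then show ?case using pCons by (simp add: map_poly_pCons)
  qed simp
  then have "poly r (\<psi> [:0, 1:]) = p" by (simp add: r_def)
  ultimately show "p \<in> adjoin {p. der p = 0} (\<psi> [:0, 1:])" unfolding adjoin_def by blast
qed

text \<open>If \<open>der\<close> vanishes on \<open>A\<close>, it is the multiple \<open>der(t) \<cdot> d/dt\<close> of the derivative. It is nonzero, so its
  constants are those of \<open>d/dt\<close>, and the image of \<open>A'\<close> lies in \<open>A\<close>.\<close>

lemma constants_onto:
  assumes const: "\<And>a. der [:a:] = 0"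
  shows "\<exists>a. \<psi> [:b:] = [:a:]"
proof -
  have "der p = formal_deriv p * der [:0, 1:]" for p
  proof (induction p)
    case (pCons a p)
    have eq: "pCons a p = [:a:] + [:0, 1:] * p" by simp
    have "der (pCons a p) = [:0, 1:] * der p + der [:0, 1:] * p"
      unfolding eq der.deriv_add der.deriv_mult const by simp
    then show ?case using pCons by (simp add: formal_deriv_pCons algebra_simps)
  qed (simp add: formal_deriv_simps)
  note der_eq = this
  have nz: "der [:0, 1:] \<noteq> 0"
    using der_eq[of "\<psi> [:0, 1:]"] der_generator by auto
  have "formal_deriv (\<psi> [:b:]) * der [:0, 1:] = 0"
    using der_eq[of "\<psi> [:b:]"] der_eq_0_iff[of "\<psi> [:b:]"] by simp
  then have "formal_deriv (\<psi> [:b:]) = 0"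
    using char0_domainD(1)[OF char0_domain_poly[OF dom]] nz by blast
  then show ?thesis using formal_deriv_eq_0_iff[OF dom] by blast
qed

end

section \<open>Brackets of Poisson-Ore extensions\<close>

context poisson_algebra
begin

lemma of_nat_scale: "sc (of_nat n) x = of_nat n * x"
  by (induction n) (simp_all add: scale_left_distrib distrib_right)

lemma scale_eq_mult: "sc c x = sc c 1 * x"
  using scale_mult[of c 1 x] by simp

lemma bracket_add_left: "br (x + y) z = br x z + br y z"
  using bracket_linear_left[of z] by (simp add: Vector_Spaces.linear_iff)

lemma bracket_add_right: "br z (x + y) = br z x + br z y"
  using bracket_linear_right[of z] by (simp add: Vector_Spaces.linear_iff)

lemma bracket_scale_left: "br (sc c x) z = sc c (br x z)"
  using bracket_linear_left[of z] by (simp add: Vector_Spaces.linear_iff)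

lemma bracket_scale_right: "br z (sc c x) = sc c (br z x)"
  using bracket_linear_right[of z] by (simp add: Vector_Spaces.linear_iff)

lemma bracket_antisym: "br x y = - br y x"
proof -
  have "br (x + y) (x + y) = 0" by (rule bracket_self)
  then have "br x y + br y x = 0"
    unfolding bracket_add_left bracket_add_right by (simp add: bracket_self add.commute)
  then show ?thesis by (simp add: eq_neg_iff_add_eq_0)
qed

lemma ring_derivation_bracket_right: "ring_derivation (br x)"
  by unfold_locales (simp_all add: bracket_add_right leibniz_right)

lemma ring_derivation_bracket_left: "ring_derivation (\<lambda>y. br y x)"
  by unfold_locales (simp_all add: bracket_add_left leibniz_left)

lemma bracket_const: "br x (sc c 1) = 0" "br (sc c 1) x = 0"
  using ring_derivation.deriv_1[OF ring_derivation_bracket_right[of x]]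
    ring_derivation.deriv_1[OF ring_derivation_bracket_left[of x]]
  by (simp_all add: bracket_scale_left bracket_scale_right)

lemma scalar_dvd_1: "c \<noteq> 0 \<Longrightarrow> sc c 1 dvd 1"
  using scale_mult[of c 1 "sc (inverse c) 1"] by (intro dvdI[of _ _ "sc (inverse c) 1"]) simp

lemma subring_set_scalars: "subring_set (range (\<lambda>c. sc c 1))"
proof -
  have "sc a 1 + sc b 1 = sc (a + b) 1" "sc a 1 * sc b 1 = sc (a * b) 1" for a b
    using scale_mult[of a 1 "sc b 1"] by (simp_all add: scale_left_distrib scale_scale)
  moreover have "1 \<in> range (\<lambda>c. sc c 1)" by (metis scale_one rangeI)
  ultimately show ?thesis
    unfolding subring_set_def by (auto simp flip: scale_minus_left)
qed

end

lemma CHAR_poisson_algebra: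
  fixes sc :: "'k::field_char_0 \<Rightarrow> 'a::comm_ring_1 \<Rightarrow> 'a"
  assumes "poisson_algebra sc br" shows "CHAR('a) = 0"
proof -
  interpret poisson_algebra sc br by fact
  have "sc (of_nat CHAR('a)) 1 = 0" by (simp add: of_nat_scale)
  then show ?thesis by (simp add: scale_eq_0_iff)
qed

locale ore_extension =
  fixes sc :: "'k::field_char_0 \<Rightarrow> 'a::comm_ring_1 \<Rightarrow> 'a" and br and \<alpha> \<delta> :: "'a \<Rightarrow> 'a" and P
  assumes ore: "poisson_ore sc br \<alpha> \<delta> P" and pa: "poisson_algebra sc br"
begin

sublocale A: poisson_algebra sc br by (rule pa)
sublocale E: poisson_algebra "poly_scale sc" P using ore by (simp add: poisson_ore_def)

lemma ore_const: "P [:a:] [:b:] = [:br a b:]" and ore_X: "P [:a:] [:0, 1:] = [:\<delta> a, \<alpha> a:]"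
  using ore by (simp_all add: poisson_ore_def)

lemma ore_X_left: "P [:0, 1:] [:a:] = [:- \<delta> a, - \<alpha> a:]"
  using E.bracket_antisym[of "[:0, 1:]" "[:a:]"] by (simp add: ore_X)

lemma pCons_split: "pCons (a::'a) p = [:a:] + [:0, 1:] * p"
  by simp

lemma bracket_pCons_right: "P q (pCons a p) = P q [:a:] + pCons 0 (P q p) + P q [:0, 1:] * p"
  unfolding pCons_split[of a p] E.bracket_add_right E.leibniz_right by simp

lemma bracket_pCons_left: "P (pCons a p) q = P [:a:] q + pCons 0 (P p q) + P [:0, 1:] q * p"
  unfolding pCons_split[of a p] E.bracket_add_left E.leibniz_left by simp

lemma bracket_0: "P 0 q = 0" "P q 0 = 0"
  using ring_derivation.deriv_0[OF E.ring_derivation_bracket_right[of q]]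
    ring_derivation.deriv_0[OF E.ring_derivation_bracket_left[of q]] by simp_all

lemma bracket_X_X: "P [:0, 1:] [:0, 1:] = 0"
  by (rule E.bracket_self)

end

locale ore_extension_delta = ore_extension sc br "\<lambda>_. 0" \<delta> P
  for sc :: "'k::field_char_0 \<Rightarrow> 'a::comm_ring_1 \<Rightarrow> 'a" and br \<delta> P
begin

lemma formal_deriv_bracket: "formal_deriv (P p q) = P (formal_deriv p) q + P p (formal_deriv q)"
proof -
  interpret f: ring_derivation "formal_deriv :: 'a poly \<Rightarrow> _" by (rule ring_derivation_formal_deriv)
  have X: "P [:a:] [:0, 1:] = [:\<delta> a:]" "P [:0, 1:] [:a:] = [:- \<delta> a:]" for a
    using ore_X[of a] ore_X_left[of a] by simp_all
  have sh: "formal_deriv (pCons 0 r) = r + pCons 0 (formal_deriv r)" for r :: "'a poly"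
    by (rule formal_deriv_pCons)
  have 1: "formal_deriv (P [:a:] q) = P [:a:] (formal_deriv q)" for a q
  proof (induction q)
    case (pCons b q)
    have "formal_deriv (P [:a:] (pCons b q)) =
      P [:a:] q + pCons 0 (formal_deriv (P [:a:] q)) + [:\<delta> a:] * formal_deriv q"
      unfolding bracket_pCons_right[of "[:a:]" b q] f.deriv_add sh X ore_const f.deriv_mult by (simp add: formal_deriv_simps)
    also have "\<dots> = P [:a:] (formal_deriv (pCons b q))"
      unfolding formal_deriv_pCons E.bracket_add_right bracket_pCons_right[of "[:a:]" 0 "formal_deriv q"] X
      by (simp add: pCons bracket_0)
    finally show ?case .
  qed (simp add: bracket_0 formal_deriv_simps)
  have 2: "formal_deriv (P [:0, 1:] q) = P [:0, 1:] (formal_deriv q)" for q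
  proof (induction q)
    case (pCons b q)
    have "formal_deriv (P [:0, 1:] (pCons b q)) = P [:0, 1:] q + pCons 0 (formal_deriv (P [:0, 1:] q))"
      unfolding bracket_pCons_right[of "[:0, 1:]" b q] f.deriv_add sh X bracket_X_X by (simp add: formal_deriv_simps)
    also have "\<dots> = P [:0, 1:] (formal_deriv (pCons b q))"
      unfolding formal_deriv_pCons E.bracket_add_right bracket_pCons_right[of "[:0, 1:]" 0 "formal_deriv q"] bracket_X_X
      by (simp add: pCons bracket_0)
    finally show ?case .
  qed (simp add: bracket_0 formal_deriv_simps)
  show ?thesis
  proof (induction p)
    case (pCons a p)
    have "formal_deriv (P (pCons a p) q) =
      P [:a:] (formal_deriv q) + (P p q + pCons 0 (formal_deriv (P p q))) +
      (P [:0, 1:] q * formal_deriv p + P [:0, 1:] (formal_deriv q) * p)"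
      unfolding bracket_pCons_left[of a p q] f.deriv_add sh f.deriv_mult 1 2 by simp
    also have "\<dots> = P (formal_deriv (pCons a p)) q + P (pCons a p) (formal_deriv q)"
      unfolding formal_deriv_pCons E.bracket_add_left bracket_pCons_left[of 0 "formal_deriv p" q]
        bracket_pCons_left[of a p "formal_deriv q"] pCons
      by (simp add: bracket_0 algebra_simps)
    finally show ?case .
  qed (simp add: bracket_0 formal_deriv_simps)
qed

text \<open>With \<open>\<alpha> = 0\<close> the bracket with \<open>b\<close> acts on \<open>p\<close> as \<open>br _ b\<close> on coefficients plus terms of lower degree
  coming from \<open>\<delta>\<close>. With \<open>\<alpha> \<noteq> 0\<close> an extra term of the same degree would appear.\<close>

lemma coeff_bracket_const:
  assumes "degree p \<le> N"
  shows "coeff (P p [:b:]) N = br (coeff p N) b" "degree (P p [:b:]) \<le> N"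
proof -
  have "coeff (P p [:b:]) N = br (coeff p N) b \<and> degree (P p [:b:]) \<le> N"
    using assms
  proof (induction p arbitrary: N)
    case 0
    then show ?case
      using ring_derivation.deriv_0[OF A.ring_derivation_bracket_left[of b]] by (simp add: bracket_0)
  next
    case (pCons a p)
    have eq: "P (pCons a p) [:b:] = [:br a b:] + pCons 0 (P p [:b:]) - smult (\<delta> b) p"
      unfolding bracket_pCons_left[of a p "[:b:]"] ore_const using ore_X_left[of b] by simp
    show ?case
    proof (cases "p = 0")
      case True
      then show ?thesis unfolding eq
        using ring_derivation.deriv_0[OF A.ring_derivation_bracket_left[of b]]
        by (auto simp: bracket_0 coeff_pCons split: nat.splits)
    next
      case False
      then obtain M where N: "N = Suc M" "degree p \<le> M" using pCons.prems by (cases N) auto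
      have IH: "coeff (P p [:b:]) M = br (coeff p M) b" "degree (P p [:b:]) \<le> M"
        using pCons.IH[OF N(2)] by auto
      have "degree (pCons 0 (P p [:b:])) \<le> N" using IH(2) N(1) degree_pCons_le[of 0 "P p [:b:]"] by simp
      moreover have "degree (smult (\<delta> b) p) \<le> N" using N degree_smult_le[of "\<delta> b" p] by simp
      ultimately have "degree (P (pCons a p) [:b:]) \<le> N" unfolding eq by (intro degree_diff_le degree_add_le) auto
      then show ?thesis using IH(1) N unfolding eq by (simp add: coeff_eq_0)
    qed
  qed
  then show "coeff (P p [:b:]) N = br (coeff p N) b" "degree (P p [:b:]) \<le> N" by auto
qed

end

section \<open>Isomorphisms of Poisson-Ore extensions\<close>

locale ore_iso = L: ore_extension sc br \<alpha> \<delta> P + R: ore_extension sc' br' \<alpha>' \<delta>' P'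
  for sc :: "'k::field_char_0 \<Rightarrow> 'a::comm_ring_1 \<Rightarrow> 'a" and br \<alpha> \<delta> P
    and sc' :: "'k \<Rightarrow> 'b::comm_ring_1 \<Rightarrow> 'b" and br' \<alpha>' \<delta>' P' +
  fixes \<phi>
  assumes iso: "poisson_iso (poly_scale sc) P (poly_scale sc') P' \<phi>"
    and domain: "char0_domain TYPE('a)"
begin

lemma iso_linear: "\<phi> (p + q) = \<phi> p + \<phi> q" "\<phi> (poly_scale sc c p) = poly_scale sc' c (\<phi> p)"
  using iso by (auto simp: poisson_iso_def Vector_Spaces.linear_iff)

lemma iso_bracket: "\<phi> (P p q) = P' (\<phi> p) (\<phi> q)"
  using iso by (simp add: poisson_iso_def)

sublocale poly_ring_iso \<phi> "inv_into UNIV \<phi>"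
proof
  have "bij \<phi>" using iso by (simp add: poisson_iso_def)
  then show "inv_into UNIV \<phi> (\<phi> p) = p" "\<phi> (inv_into UNIV \<phi> r) = r" for p r
    by (simp_all add: bij_is_inj bij_is_surj surj_f_inv_f)
  show "\<phi> (p + q) = \<phi> p + \<phi> q" for p q by (rule iso_linear)
  show "\<phi> (p * q) = \<phi> p * \<phi> q" for p q using iso by (simp add: poisson_iso_def)
qed (rule domain)

text \<open>The composite of \<open>A \<subseteq> A[t]\<close>, the isomorphism \<open>\<phi>\<close> and \<open>A'[t'] \<rightarrow> A'[t']/(t') = A'\<close>. It respects sums,
  products and scalars, and will serve as the isomorphism wherever it is bijective and compatible
  with the brackets.\<close>

definition reduction :: "'a \<Rightarrow> 'b" where
  "reduction a = coeff (\<phi> [:a:]) 0"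

lemma poly_scale_const: "poly_scale sc c [:a:] = [:sc c a:]"
  using L.A.scale_eq_mult[of c a] by (simp add: poly_scale_def)

lemma reduction_hom:
  "reduction (a + b) = reduction a + reduction b" "reduction (a * b) = reduction a * reduction b"
  "reduction 1 = 1" "reduction (sc c a) = sc' c (reduction a)"
proof -
  show "reduction (a + b) = reduction a + reduction b"
    using iso_add[of "[:a:]" "[:b:]"] by (simp add: reduction_def)
  show "reduction (a * b) = reduction a * reduction b"
    using iso_mult[of "[:a:]" "[:b:]"] by (simp add: reduction_def mult.commute coeff_mult)
  show "reduction 1 = 1" using iso_1 by (simp add: reduction_def one_pCons)
  have "\<phi> [:sc c a:] = poly_scale sc' c (\<phi> [:a:])"
    using iso_linear(2)[of c "[:a:]"] by (simp add: poly_scale_const)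
  then show "reduction (sc c a) = sc' c (reduction a)"
    using R.A.scale_eq_mult[of c "coeff (\<phi> [:a:]) 0"] by (simp add: reduction_def poly_scale_def)
qed

lemma isomorphic_by_reduction:
  assumes "bij reduction" "\<And>a b. reduction (br a b) = br' (reduction a) (reduction b)"
  shows "poisson_isomorphic sc br sc' br'"
  unfolding poisson_isomorphic_def poisson_iso_def Vector_Spaces.linear_iff
  by (rule exI[of _ reduction])
    (use assms reduction_hom L.A.vector_space_axioms R.A.vector_space_axioms in auto)

lemma isomorphic_if_constants_to_constants:
  assumes const: "\<And>a. der [:a:] = 0"
  shows "poisson_isomorphic sc br sc' br'"
proof (rule isomorphic_by_reduction)
  have eq: "\<phi> [:a:] = [:reduction a:]" for a
    using const[of a] by (auto simp: der_eq_0_iff reduction_def)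
  show "reduction (br a b) = br' (reduction a) (reduction b)" for a b
    using iso_bracket[of "[:a:]" "[:b:]"] by (simp add: eq L.ore_const R.ore_const)
  show "bij reduction"
  proof (rule bijI)
    show "inj reduction"
    proof (rule injI)
      fix a b assume "reduction a = reduction b"
      then have "\<phi> [:a:] = \<phi> [:b:]" by (simp add: eq)
      then show "a = b" by (simp add: iso_inject)
    qed
    show "surj reduction"
    proof (rule surjI)
      fix b
      show "reduction (coeff (inv_into UNIV \<phi> [:b:]) 0) = b"
      proof -
        obtain a where a: "inv_into UNIV \<phi> [:b:] = [:a:]" using constants_onto[OF const] by blast
        then have "[:b:] = [:reduction a:]" using iso_inv[of "[:b:]"] by (simp only: eq)
        then show ?thesis using a by simp
      qed
    qed
  qed
qed

end

section \<open>The divisor subalgebra lies in the constants\<close>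

context ore_iso
begin

text \<open>These are the elements of \<open>A\<close> that \<open>\<phi>\<close> maps into \<open>A'\<close>.\<close>

lemma constants_poisson_subalgebra: "poisson_subalgebra sc br {a. der [:a:] = 0}"
proof -
  have add: "der [:a + b:] = 0" if "der [:a:] = 0" "der [:b:] = 0" for a b
    using der.deriv_add[of "[:a:]" "[:b:]"] that by simp
  have mult: "der [:a * b:] = 0" if "der [:a:] = 0" "der [:b:] = 0" for a b
    using der.deriv_mult[of "[:a:]" "[:b:]"] that by (simp add: mult.commute)
  have scale: "der [:sc c a:] = 0" if "der [:a:] = 0" for c a
  proof -
    from that obtain b where "\<phi> [:a:] = [:b:]" unfolding der_eq_0_iff by blast
    then have "\<phi> [:sc c a:] = poly_scale sc' c [:b:]"
      using iso_linear(2)[of c "[:a:]"] unfolding poly_scale_const by simp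
    then have "\<phi> [:sc c a:] = [:sc' c 1 * b:]" by (simp add: poly_scale_def)
    then show ?thesis unfolding der_eq_0_iff by blast
  qed
  have bracket: "der [:br a b:] = 0" if "der [:a:] = 0" "der [:b:] = 0" for a b
    using that iso_bracket[of "[:a:]" "[:b:]"] by (auto simp: der_eq_0_iff L.ore_const R.ore_const)
  show ?thesis
    unfolding poisson_subalgebra_def k_subalgebra_def L.A.subspace_def
    using add mult scale bracket der.deriv_1 by (auto simp: one_pCons)
qed

lemma divisor_step_constants: "divisor_step sc br {1} n \<subseteq> {a. der [:a:] = 0}"
proof (induction n)
  case 0
  show ?case using der.deriv_1 by (simp add: one_pCons)
next
  case (Suc n)
  have "Sw (divisor_step sc br {1} n) \<subseteq> {a. der [:a:] = 0}"
  proof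
    fix g assume "g \<in> Sw (divisor_step sc br {1} n)"
    then obtain f b where f: "f \<in> divisor_step sc br {1} n" "f \<noteq> 0" "f = g * b"
      unfolding Sw_def by blast
    have prod: "[:g:] * [:b:] = [:f:]" using f(3) by (simp add: mult.commute)
    have "der [:g:] = 0"
      by (rule der.constant_factor[OF char0_domain_poly[OF domain] der_nilpotent der_nilpotent, where y = "[:b:]"])
        (use f(1,2) Suc in \<open>auto simp only: prod pCons_eq_0_iff\<close>)
    then show "g \<in> {a. der [:a:] = 0}" by simp
  qed
  then show ?case
    unfolding divisor_step.simps using constants_poisson_subalgebra by (rule hull_minimal)
qed

lemma isomorphic_if_divisor_subalgebra_UNIV:
  assumes "divisor_subalgebra sc br {1} = UNIV"
  shows "poisson_isomorphic sc br sc' br'"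
proof (rule isomorphic_if_constants_to_constants)
  fix a
  have "a \<in> divisor_subalgebra sc br {1}" using assms by simp
  then show "der [:a:] = 0" using divisor_step_constants by (auto simp: divisor_subalgebra_def)
qed

end

section \<open>The leading coefficient as a Poisson derivation\<close>

lemma exact_degree_bound:
  fixes d :: "'r::comm_ring_1 poly \<Rightarrow> 'r poly"
  assumes b: "\<exists>N. \<forall>a. degree (d [:a:]) \<le> N" and nz: "d [:a0:] \<noteq> 0"
  obtains N a where "\<And>a. degree (d [:a:]) \<le> N" "deriv_coeff d N a \<noteq> 0"
proof -
  define N where "N = (LEAST N. \<forall>a. degree (d [:a:]) \<le> N)"
  have N: "\<forall>a. degree (d [:a:]) \<le> N" unfolding N_def using b by (rule LeastI_ex)
  have "\<exists>a. deriv_coeff d N a \<noteq> 0"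
  proof (rule ccontr)
    assume *: "\<not> (\<exists>a. deriv_coeff d N a \<noteq> 0)"
    have lt: "d [:a:] = 0 \<or> degree (d [:a:]) < N" for a
    proof (cases "degree (d [:a:]) = N")
      case True
      then have "lead_coeff (d [:a:]) = 0" using * by (simp add: deriv_coeff_def)
      then show ?thesis by simp
    next
      case False
      then show ?thesis using N by (simp add: le_neq_implies_less)
    qed
    then have "N \<noteq> 0" using nz by fastforce
    moreover have "\<forall>a. degree (d [:a:]) \<le> N - 1" using lt
      by (metis Suc_pred' bot_nat_0.not_eq_extremum calculation degree_0 le0 less_Suc_eq_le)
    then have "N \<le> N - 1" unfolding N_def[of] by (rule Least_le)
    ultimately show False by simp
  qed
  then show thesis using that N by blast
qed

locale ore_iso_delta = ore_iso sc br "\<lambda>_. 0" \<delta> P sc' br' "\<lambda>_. 0" \<delta>' P' \<phi>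
  for sc :: "'k::field_char_0 \<Rightarrow> 'a::comm_ring_1 \<Rightarrow> 'a" and br \<delta> P
    and sc' :: "'k \<Rightarrow> 'b::comm_ring_1 \<Rightarrow> 'b" and br' \<delta>' P' \<phi>
begin

sublocale LD: ore_extension_delta sc br \<delta> P by unfold_locales
sublocale RD: ore_extension_delta sc' br' \<delta>' P' by unfold_locales

lemma der_bracket: "der (P p q) = P (der p) q + P p (der q)"
proof -
  have "\<phi> (der (P p q)) = \<phi> (P (der p) q + P p (der q))"
    by (simp add: iso_der iso_bracket RD.formal_deriv_bracket iso_add)
  then show ?thesis by (simp only: iso_inject)
qed

end

context ore_iso
begin

lemma der_scale: "der (poly_scale sc c p) = poly_scale sc c (der p)"
proof -
  have "\<phi> (der (poly_scale sc c p)) = \<phi> (poly_scale sc c (der p))"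
    unfolding iso_der iso_linear(2) by (simp add: poly_scale_def formal_deriv_smult)
  then show ?thesis by (simp only: iso_inject)
qed

lemma derivation_deriv_coeff_der: "derivation_on UNIV sc (deriv_coeff der N)"
proof -
  interpret D: ring_derivation "deriv_coeff der N" by (rule ring_derivation_deriv_coeff[OF ring_derivation_der])
  have "deriv_coeff der N (sc c a) = sc c (deriv_coeff der N a)" for c a
    using der_scale[of c "[:a:]"] L.A.scale_eq_mult[of c "coeff (der [:a:]) N"]
    unfolding poly_scale_const by (simp add: deriv_coeff_def poly_scale_def)
  then show ?thesis by (simp add: derivation_on_def D.deriv_add D.deriv_mult)
qed

lemma locally_nilpotent_deriv_coeff_der:
  assumes "\<And>a. degree (der [:a:]) \<le> N"
  shows "locally_nilpotent (deriv_coeff der N)"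
  unfolding locally_nilpotent_def
proof
  fix a
  interpret D: ring_derivation "deriv_coeff der N" by (rule ring_derivation_deriv_coeff[OF ring_derivation_der])
  obtain n where n: "(deriv_coeff der N ^^ n) a = 0"
    using leading_coefficient_locally_nilpotent[OF domain ring_derivation_der der_nilpotent assms] by blast
  have "(deriv_coeff der N ^^ m) a = 0" if "m \<ge> n" for m
  proof -
    have "(deriv_coeff der N ^^ m) a = (deriv_coeff der N ^^ (m - n)) ((deriv_coeff der N ^^ n) a)"
      using that by (metis funpow_add comp_apply le_add_diff_inverse2)
    then show ?thesis using n by simp
  qed
  then show "\<exists>N'. \<forall>m\<ge>N'. (deriv_coeff der N ^^ m) a = 0" by blast
qed

end

text \<open>With \<open>\<alpha>' = 0\<close> the derivation \<open>d/dt'\<close> respects the bracket of \<open>A'[t']\<close>, hence \<open>der\<close> respects that of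
  \<open>A[t]\<close>; with \<open>\<alpha> = 0\<close> the leading coefficient of a bracket is the bracket of the leading coefficients.
  So a nonzero leading coefficient of \<open>der\<close> would be a derivation excluded by the assumption on \<open>PML\<close>.\<close>

lemma (in ore_iso_delta) isomorphic_if_PML_UNIV:
  assumes PML: "PML sc br = UNIV" and bounded: "\<exists>N. \<forall>a. degree (der [:a:]) \<le> N"
  shows "poisson_isomorphic sc br sc' br'"
proof (rule isomorphic_if_constants_to_constants, rule ccontr)
  fix a0 assume "der [:a0:] \<noteq> 0"
  then obtain N a where N: "\<And>a. degree (der [:a:]) \<le> N" and a: "deriv_coeff der N a \<noteq> 0"
    using exact_degree_bound[OF bounded] by metis
  have "deriv_coeff der N (br x y) = br (deriv_coeff der N x) y + br x (deriv_coeff der N y)" for x y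
  proof -
    have "der [:br x y:] = P (der [:x:]) [:y:] - P (der [:y:]) [:x:]"
      using der_bracket[of "[:x:]" "[:y:]"] L.E.bracket_antisym[of "[:x:]" "der [:y:]"] by (simp add: L.ore_const)
    then show ?thesis
      using LD.coeff_bracket_const(1)[OF N[of x], of y] LD.coeff_bracket_const(1)[OF N[of y], of x]
        L.A.bracket_antisym[of x] by (simp add: deriv_coeff_def)
  qed
  then have "poisson_derivation_on UNIV sc br (deriv_coeff der N)"
    using derivation_deriv_coeff_der by (simp add: poisson_derivation_on_def)
  then have "PML sc br \<subseteq> {a. deriv_coeff der N a = 0}"
    using locally_nilpotent_deriv_coeff_der[OF N] by (auto simp: PML_def)
  then show False using PML a by blast
qed

section \<open>Cancellation for Poisson simple algebras\<close>

locale ore_iso_alpha = ore_iso sc br \<alpha> "\<lambda>_. 0" P sc' br' \<alpha>' "\<lambda>_. 0" P' \<phi>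
  for sc :: "'k::field_char_0 \<Rightarrow> 'a::idom \<Rightarrow> 'a" and br \<alpha> P
    and sc' :: "'k \<Rightarrow> 'b::comm_ring_1 \<Rightarrow> 'b" and br' \<alpha>' P' \<phi>
begin

lemma X_dvd_bracket: "[:0, 1:] dvd P' r [:0, 1:]"
proof (induction r)
  case 0
  show ?case by (simp add: R.bracket_0)
next
  case (pCons b r)
  have "P' (pCons b r) [:0, 1:] = [:0, 1:] * [:\<alpha>' b:] + [:0, 1:] * P' r [:0, 1:]"
    unfolding R.bracket_pCons_left[of b r] by (simp add: R.ore_X R.bracket_X_X)
  then show ?case by (metis distrib_left dvd_triv_left)
qed

lemma coeff_0_bracket: "coeff (P' r s) 0 = br' (coeff r 0) (coeff s 0)"
proof -
  have 1: "coeff (P' r [:0, 1:]) 0 = 0" for r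
    using X_dvd_bracket[of r] by (auto elim!: dvdE simp: coeff_mult)
  have 2: "coeff (P' [:0, 1:] r) 0 = 0" for r
    using 1[of r] R.E.bracket_antisym[of "[:0, 1:]" r] by simp
  have 3: "coeff (P' [:b:] s) 0 = br' b (coeff s 0)" for b
  proof (cases s)
    case (pCons c s)
    show ?thesis unfolding pCons R.bracket_pCons_right[of "[:b:]" c s]
      by (simp add: R.ore_const R.ore_X coeff_mult)
  qed
  show ?thesis
  proof (cases r)
    case (pCons b r)
    show ?thesis unfolding pCons R.bracket_pCons_left[of b r s]
      using 2[of s] by (simp add: 3 coeff_mult)
  qed
qed

text \<open>The preimage in \<open>A[t]\<close> of the variable \<open>t'\<close>.\<close>

definition q :: "'a poly" where "q = inv_into UNIV \<phi> [:0, 1:]"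

lemma iso_q: "\<phi> q = [:0, 1:]"
  by (simp add: q_def)

text \<open>If \<open>q = c + u t\<close> with a unit \<open>u\<close>, then \<open>A[t] = A \<oplus> q A[t]\<close>, so \<open>A\<close> maps bijectively to
  \<open>A'[t']/(t') = A'\<close>. The ideal \<open>(t')\<close> is a Poisson ideal since \<open>\<delta>' = 0\<close>.\<close>

lemma isomorphic_if_q_linear:
  assumes q: "q = [:c, u:]" and u: "u dvd 1"
  shows "poisson_isomorphic sc br sc' br'"
proof (rule isomorphic_by_reduction)
  show "reduction (br a b) = br' (reduction a) (reduction b)" for a b
    using iso_bracket[of "[:a:]" "[:b:]"] coeff_0_bracket[of "\<phi> [:a:]" "\<phi> [:b:]"]
    by (simp add: L.ore_const reduction_def)
  obtain v where v: "1 = u * v" using u by (auto elim: dvdE)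
  have u0: "u \<noteq> 0" using v by auto
  have ker: "a = 0" if "reduction a = 0" for a
  proof -
    have "[:0, 1:] dvd \<phi> [:a:]" using that by (cases "\<phi> [:a:]") (auto simp: reduction_def dvd_def intro!: exI)
    then obtain r where "\<phi> [:a:] = [:0, 1:] * r" by (auto elim: dvdE)
    then have "\<phi> [:a:] = \<phi> (q * inv_into UNIV \<phi> r)" by (simp add: iso_mult iso_q)
    then have eq: "[:a:] = q * inv_into UNIV \<phi> r" by (simp only: iso_inject)
    have "inv_into UNIV \<phi> r = 0"
    proof (rule ccontr)
      assume "inv_into UNIV \<phi> r \<noteq> 0"
      then have "degree [:a:] = degree q + degree (inv_into UNIV \<phi> r)"
        unfolding eq using u0 by (intro degree_mult_eq) (simp_all add: q)
      then have "degree [:a:] = 1 + degree (inv_into UNIV \<phi> r)" using u0 by (simp add: q)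
      then show False by simp
    qed
    then show "a = 0" using eq by simp
  qed
  show "bij reduction"
  proof (rule bijI)
    show "inj reduction"
    proof (rule injI)
      fix a b assume "reduction a = reduction b"
      then have "reduction (a + - b) = 0"
        using reduction_hom(1)[of b "- b"] reduction_hom(1)[of a "- b"] reduction_hom(1)[of 0 0]
        by (simp add: add.commute)
      from ker[OF this] show "a = b" by simp
    qed
    have "\<exists>a w. p = [:a:] + q * w" for p
    proof (induction p)
      case 0
      show ?case by (rule exI[of _ 0], rule exI[of _ 0]) simp
    next
      case (pCons b p)
      then obtain a w where p: "p = [:a:] + q * w" by blast
      have X: "[:0, 1:] = q * [:v:] - [:c * v:]" using v by (simp add: q mult.commute)
      have "pCons b p = [:b:] + [:0, 1:] * ([:a:] + q * w)" using p by simp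
      also have "\<dots> = [:b - c * v * a:] + q * ([:v * a:] + [:0, 1:] * w)"
        unfolding distrib_left[of "[:0, 1:]"] by (subst (1) X) (simp add: algebra_simps)
      finally show ?case by blast
    qed
    note split = this
    show "surj reduction"
    proof (rule surjI[of _ "\<lambda>b. SOME a. reduction a = b"])
      fix b
      obtain a w where "inv_into UNIV \<phi> [:b:] = [:a:] + q * w" using split by blast
      then have "[:b:] = \<phi> [:a:] + [:0, 1:] * \<phi> w" by (metis iso_add iso_inv iso_mult iso_q)
      from arg_cong[OF this, of "\<lambda>p. coeff p 0"] have "reduction a = b" by (simp add: reduction_def coeff_mult)
      then show "reduction (SOME a. reduction a = b) = b" by (rule someI)
    qed
  qed
qed

text \<open>It has to be shown that \<open>q\<close> has degree one with scalar coefficients. As \<open>q\<close> divides \<open>{a, q}\<close>, which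
  does not have larger degree, \<open>{a, q} = \<mu>(a) q\<close> for some \<open>\<mu>(a) \<in> A\<close>. So the coefficients satisfy
  \<open>{a, q\<^sub>i} = (\<mu>(a) - i \<alpha>(a)) q\<^sub>i\<close>: each generates a Poisson ideal of \<open>A\<close>, and hence is a scalar.\<close>

lemma isomorphic_if_poisson_simple:
  assumes simple: "poisson_simple br" and units: "{u :: 'a. u dvd 1} = {sc c 1 | c. c \<noteq> 0}"
  shows "poisson_isomorphic sc br sc' br'"
proof -
  interpret inv: poly_ring_iso "inv_into UNIV \<phi>" \<phi> by (rule inverse_iso)
  have q0: "q \<noteq> 0" using iso_q by auto
  have bracket_q: "[:0, 1:] dvd \<phi> r \<Longrightarrow> q dvd r" for r
    by (metis dvd_def inv_iso inv.iso_mult q_def)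
  have q_dvd: "q dvd P r q" for r
    by (rule bracket_q) (simp add: iso_bracket iso_q X_dvd_bracket)
  have coeff_bracket: "coeff (P [:a:] r) i = br a (coeff r i) + of_nat i * (\<alpha> a * coeff r i)" for a r i
  proof (induction r arbitrary: i)
    case 0
    then show ?case using L.A.bracket_const(1)[of a 0] by (simp add: L.bracket_0)
  next
    case (pCons b r)
    show ?case
      unfolding L.bracket_pCons_right[of "[:a:]" b r]
      by (cases i) (simp_all add: L.ore_const L.ore_X pCons algebra_simps)
  qed
  have degree_bracket: "degree (P [:a:] r) \<le> degree r" for a r
    by (rule degree_le) (use L.A.bracket_const(1)[of a 0] in \<open>simp add: coeff_bracket coeff_eq_0\<close>)
  have "\<exists>l. \<forall>i. br a (coeff q i) + of_nat i * (\<alpha> a * coeff q i) = l * coeff q i" for a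
  proof -
    obtain u where u: "P [:a:] q = q * u" using q_dvd[of "[:a:]"] by (auto elim: dvdE)
    have "degree u = 0"
    proof (cases "u = 0")
      case False
      then have "degree q + degree u \<le> degree q"
        using degree_bracket[of a q] q0 unfolding u by (simp add: degree_mult_eq)
      then show ?thesis by simp
    qed simp
    then obtain l where "u = [:l:]" by (rule degree_eq_zeroE)
    then have "P [:a:] q = smult l q" using u by simp
    then show ?thesis using coeff_bracket[of a q] by (intro exI[of _ l]) (simp flip: coeff_bracket)
  qed
  then obtain \<mu> where l: "\<And>a i. br a (coeff q i) + of_nat i * (\<alpha> a * coeff q i) = \<mu> a * coeff q i"
    by metis
  have q_coeff: "\<exists>c. coeff q i = sc c 1" for i
  proof -
    define z where "z = coeff q i"
    have z: "br a z = (\<mu> a - of_nat i * \<alpha> a) * z" for a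
      using l[of a i] unfolding z_def by (simp add: algebra_simps eq_diff_eq)
    have "poisson_ideal br (range (\<lambda>x. x * z))"
      unfolding poisson_ideal_def ideal_type_iff
    proof (intro conjI ballI allI)
      show "0 \<in> range (\<lambda>x. x * z)" by (rule image_eqI[of _ _ 0]) auto
      show "x + y \<in> range (\<lambda>x. x * z)" if "x \<in> range (\<lambda>x. x * z)" "y \<in> range (\<lambda>x. x * z)" for x y
        using that by (auto simp flip: distrib_right)
      show "r * x \<in> range (\<lambda>x. x * z)" if "x \<in> range (\<lambda>x. x * z)" for x r
        using that by (auto simp flip: mult.assoc)
      show "br x a \<in> range (\<lambda>x. x * z)" if "x \<in> range (\<lambda>x. x * z)" for x a
      proof -
        from that obtain y where xy: "x = y * z" by blast
        have bz: "br z a = - ((\<mu> a - of_nat i * \<alpha> a) * z)"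
          using L.A.bracket_antisym[of z a] unfolding z .
        have "br x a = (br y a - y * (\<mu> a - of_nat i * \<alpha> a)) * z"
          unfolding xy L.A.leibniz_left bz by (simp add: algebra_simps)
        then show ?thesis by blast
      qed
    qed
    then have "range (\<lambda>x. x * z) = {0} \<or> range (\<lambda>x. x * z) = UNIV"
      using simple unfolding poisson_simple_def by blast
    then show ?thesis
    proof
      assume "range (\<lambda>x. x * z) = {0}"
      then have "1 * z = 0" by blast
      then show ?thesis unfolding z_def by (intro exI[of _ 0]) simp
    next
      assume "range (\<lambda>x. x * z) = UNIV"
      then obtain x where "1 = x * z" by blast
      then have "z dvd 1" by (metis dvd_triv_right)
      then have "z \<in> {u. u dvd 1}" by simp
      then show ?thesis unfolding units z_def by blast
    qed
  qed
  have q_unit: "coeff q i dvd 1" if "coeff q i \<noteq> 0" for i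
    using q_coeff[of i] L.A.scalar_dvd_1 that by (metis L.A.scale_zero_left)
  have deg_q: "degree q \<noteq> 0"
  proof
    assume "degree q = 0"
    then obtain a where a: "q = [:a:]" by (rule degree_eq_zeroE)
    then have "a dvd 1" using q_unit[of 0] q0 by simp
    then obtain v where "1 = a * v" by (auto elim: dvdE)
    then have "q * [:v:] = 1" using a by (simp add: one_pCons mult.commute)
    then have "[:0, 1:] * \<phi> [:v:] = 1" by (metis iso_mult iso_q iso_1)
    from arg_cong[OF this, of "\<lambda>p. coeff p 0"] show False by (simp add: coeff_mult)
  qed
  show ?thesis
  proof (cases "\<forall>a. \<alpha> a = 0")
    case False
    then obtain a where a: "\<alpha> a \<noteq> 0" by blast
    \<comment> \<open>Brackets with scalars vanish, so \<open>\<mu>(a) = i \<alpha>(a)\<close> for each \<open>i\<close> with \<open>q\<^sub>i \<noteq> 0\<close>.\<close>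
    have only: "i = degree q" if i: "coeff q i \<noteq> 0" for i
    proof -
      have zero: "br a (coeff q j) = 0" for j using q_coeff[of j] L.A.bracket_const(1) by metis
      have "of_nat j * \<alpha> a = \<mu> a" if "coeff q j \<noteq> 0" for j
        using l[of a j] that by (simp add: zero mult.assoc[symmetric])
      from this[OF i] this[of "degree q"] have "of_nat i * \<alpha> a = of_nat (degree q) * \<alpha> a"
        using q0 by simp
      then have "of_nat i = (of_nat (degree q) :: 'a)" using a by simp
      then show ?thesis using injD[OF inj_of_nat_CHAR_0[OF CHAR_poisson_algebra[OF L.pa]]] by blast
    qed
    define c where "c = lead_coeff q"
    have q_monom: "q = monom c (degree q)"
      by (rule poly_eqI) (use only in \<open>auto simp: c_def\<close>)
    have "degree q = 1"
    proof (rule ccontr)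
      assume "degree q \<noteq> 1"
      \<comment> \<open>Otherwise \<open>t' = \<phi>(q)\<close> would be a unit times a higher power of \<open>x = \<phi>(t)\<close>. Then \<open>t'\<close> divides a power
            of \<open>x\<close>, hence \<open>x\<close>, and \<open>t'\<^sup>2\<close> divides \<open>t'\<close>.\<close>
      then obtain m where m: "degree q = m + 2" using deg_q by (metis add_2_eq_Suc' not0_implies_Suc One_nat_def)
      have "q = [:c:] * [:0, 1:] ^ m * ([:0, 1:] * [:0, 1:])"
        by (subst q_monom) (simp add: m monom_altdef power_add power2_eq_square)
      from arg_cong[OF this, of \<phi>]
      have eq: "[:0, 1:] = \<phi> ([:c:] * [:0, 1:] ^ m) * (\<phi> [:0, 1:] * \<phi> [:0, 1:])"
        unfolding iso_q iso_mult .
      define w where "w = \<phi> ([:c:] * [:0, 1:] ^ m)"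
      define x where "x = \<phi> [:0, 1:]"
      have eq': "[:0, 1:] = w * (x * x)" using eq unfolding w_def x_def .
      have "q = [:c:] * [:0, 1:] ^ (m + 2)" by (subst q_monom) (simp add: m monom_altdef)
      then have eqx: "[:0, 1:] = \<phi> [:c:] * x ^ (m + 2)" by (metis iso_mult iso_power iso_q x_def)
      have "c dvd 1" using q_unit[of "degree q"] q0 by (simp add: c_def)
      then obtain v where v: "1 = c * v" by (auto elim: dvdE)
      have "\<phi> [:c:] * \<phi> [:v:] = \<phi> 1" unfolding iso_mult[symmetric] using v by (simp add: one_pCons mult.commute)
      then have cv: "\<phi> [:c:] * \<phi> [:v:] = 1" by simp
      have "x ^ (m + 2) = \<phi> [:v:] * (\<phi> [:c:] * x ^ (m + 2))"
        using cv by (simp only: mult.assoc[symmetric] mult.commute[of "\<phi> [:v:]"] mult_1)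
      then have "x ^ (m + 2) = \<phi> [:v:] * [:0, 1:]" unfolding eqx[symmetric] .
      from arg_cong[OF this, of "\<lambda>p. poly p 0"] have "poly x 0 ^ (m + 2) = 0" by (simp add: poly_power)
      then have x0: "poly x 0 = 0"
      proof (induction "m + 2" arbitrary: m)
        case (Suc k)
        show ?case
        proof (rule ccontr)
          assume nz: "poly x 0 \<noteq> 0"
          have "poly x 0 ^ n \<noteq> 0" for n
            by (induction n) (use nz char0_domainD(1)[OF dom', of "poly x 0"] in auto)
          then show False using Suc.prems by blast
        qed
      qed simp
      have "coeff (w * (x * x)) 1 = 0"
        using x0 by (simp add: coeff_mult poly_0_coeff_0)
      then show False unfolding eq'[symmetric] by simp
    qed
    then have "q = [:0, c:]" using q_monom by (simp add: monom_altdef)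
    moreover have "c dvd 1" using q_unit[of "degree q"] q0 by (simp add: c_def)
    ultimately show ?thesis by (rule isomorphic_if_q_linear)
  next
    case True
    \<comment> \<open>Now \<open>q\<close> is a polynomial over the infinite ground field; choose a scalar \<open>c\<close> with \<open>e = q(c) \<noteq> 0\<close>. Then
          \<open>q = e + (t - c) w\<close> shows that \<open>t - c\<close> is a unit modulo \<open>q\<close>. Its image \<open>\<tau>\<close> in \<open>A'[t']/(t') = A'\<close> is
          therefore a unit, and units of \<open>A[t]\<close> are constants. So modulo \<open>q\<close> the element \<open>t - c\<close> is congruent
          to a constant \<open>u\<close>, and \<open>q\<close> divides a polynomial of degree one.\<close>
    have inj: "inj (\<lambda>c. sc c (1 :: 'a))"
      by (rule injI) (simp add: L.A.scale_cancel_right)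
    have "finite {z. poly q z = 0}" by (rule poly_roots_finite[OF q0])
    then have "finite ((\<lambda>c. sc c 1) -` {z. poly q z = 0})" by (rule finite_vimageI[OF _ inj])
    moreover have "infinite (UNIV :: 'k set)" by (rule infinite_UNIV_char_0)
    ultimately obtain c where c: "poly q (sc c 1) \<noteq> 0"
      by (metis (mono_tags, lifting) UNIV_eq_I mem_Collect_eq vimageI)
    have "q \<in> polys_over (range (\<lambda>c. sc c 1))" using q_coeff by (auto simp: polys_over_def)
    then have "poly q (sc c 1) \<in> range (\<lambda>c. sc c 1)" by (rule poly_polys_over_closed[OF L.A.subring_set_scalars]) simp
    then obtain e where e: "poly q (sc c 1) = sc e 1" by blast
    have "e \<noteq> 0" using c e by auto
    define w where "w = synthetic_div q (sc c 1)"
    have qw: "q = [:sc e 1:] + [:- sc c 1, 1:] * w"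
      using synthetic_div_correct'[of "sc c 1" q] unfolding w_def e by (simp only: add.commute)
    define \<tau> where "\<tau> = coeff (\<phi> [:- sc c 1, 1:]) 0"
    have scale_iso: "\<phi> [:sc e 1:] = [:sc' e 1:]" for e
      using iso_linear(2)[of e 1] unfolding iso_1 by (simp add: poly_scale_def one_pCons)
    have "[:0, 1:] = [:sc' e 1:] + \<phi> [:- sc c 1, 1:] * \<phi> w"
      using arg_cong[OF qw, of \<phi>] unfolding iso_q iso_add iso_mult scale_iso .
    from arg_cong[OF this, of "\<lambda>p. coeff p 0"]
    have "sc' e 1 + \<tau> * coeff (\<phi> w) 0 = 0" by (simp add: \<tau>_def coeff_mult)
    then have "\<tau> * coeff (\<phi> w) 0 = - sc' e 1" by (simp add: eq_neg_iff_add_eq_0 add.commute)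
    moreover have "sc' e 1 * sc' (inverse e) 1 = 1"
      using \<open>e \<noteq> 0\<close> by (simp add: R.A.scale_mult[symmetric] R.A.scale_scale)
    ultimately have \<tau>_unit: "\<tau> * (- coeff (\<phi> w) 0 * sc' (inverse e) 1) = 1"
      by (simp add: mult.assoc[symmetric])
    define y where "y = - coeff (\<phi> w) 0 * sc' (inverse e) 1"
    have "[:\<tau>:] * [:y:] = 1" using \<tau>_unit by (simp add: y_def one_pCons mult.commute)
    then have "inv_into UNIV \<phi> [:\<tau>:] * inv_into UNIV \<phi> [:y:] = 1" by (metis inv.iso_mult inv.iso_1)
    then have "inv_into UNIV \<phi> [:\<tau>:] dvd 1" by (metis dvd_triv_left)
    then obtain u where u: "inv_into UNIV \<phi> [:\<tau>:] = [:u:]"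
      by (auto simp: is_unit_poly_iff)
    have "[:0, 1:] dvd \<phi> [:- sc c 1, 1:] - [:\<tau>:]"
      by (rule dvdI[of _ _ "poly_shift 1 (\<phi> [:- sc c 1, 1:])"])
        (auto intro!: poly_eqI simp: \<tau>_def coeff_pCons coeff_poly_shift split: nat.splits)
    moreover have "\<phi> ([:- sc c 1, 1:] - [:u:]) = \<phi> [:- sc c 1, 1:] - [:\<tau>:]"
      unfolding iso_diff by (metis u iso_inv)
    ultimately have "q dvd [:- sc c 1, 1:] - [:u:]" using bracket_q by metis
    then have "degree q \<le> degree ([:- sc c 1, 1:] - [:u:])" by (rule dvd_imp_degree_le) auto
    then have "degree q = 1" using deg_q by simp
    then have "q = [:coeff q 0, coeff q 1:]"
      by (intro poly_eqI) (auto simp: coeff_pCons coeff_eq_0 split: nat.splits)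
    moreover have "lead_coeff q dvd 1" by (rule q_unit) (use q0 in simp)
    then have "coeff q 1 dvd 1" by (simp only: \<open>degree q = 1\<close>)
    ultimately show ?thesis by (rule isomorphic_if_q_linear)
  qed
qed

end

section \<open>Rings whose locally nilpotent derivation has a field of constants\<close>

lemma (in ring_derivation) deriv_poly_constants:
  assumes "p \<in> polys_over {x. d x = 0}"
  shows "d (poly p s) = poly (formal_deriv p) s * d s"
  using assms
proof (induction p)
  case (pCons a p)
  have "coeff (pCons a p) i \<in> {x. d x = 0}" for i using pCons.prems by (simp add: polys_over_def)
  from this[of 0] this[of "Suc _"] have "d a = 0" "p \<in> polys_over {x. d x = 0}"
    by (auto simp: polys_over_def)
  then show ?case using pCons.IH
    by (simp add: deriv_add deriv_mult formal_deriv_pCons algebra_simps)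
qed (simp add: formal_deriv_simps)

lemma formal_deriv_polys_over:
  "subring_set S \<Longrightarrow> p \<in> polys_over S \<Longrightarrow> formal_deriv p \<in> polys_over S"
  by (simp add: polys_over_def coeff_formal_deriv subring_set_simps subring_set_of_nat del: of_nat_Suc)

text \<open>For \<open>p\<close> of least degree with \<open>p(x) = 0\<close>, differentiating gives \<open>p'(x) d x = 0\<close>, and \<open>p'(x) \<noteq> 0\<close> by
  minimality.\<close>

lemma (in ring_derivation) deriv_algebraic_eq_0:
  assumes dom: "char0_domain TYPE('r)" and alg: "algebraic_over S x"
    and S: "S \<subseteq> {x. d x = 0}" "subring_set S"
  shows "d x = 0"
proof (rule ccontr)
  assume dx: "d x \<noteq> 0"
  define Q where "Q p \<longleftrightarrow> p \<in> polys_over S \<and> p \<noteq> 0 \<and> poly p x = 0" for p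
  obtain p0 where "Q p0" using alg unfolding algebraic_over_def Q_def by blast
  then obtain p where p: "Q p" and min: "\<And>q. Q q \<Longrightarrow> degree p \<le> degree q"
    using ex_has_least_nat[of Q p0 degree] by blast
  have "p \<in> polys_over {x. d x = 0}" using p polys_over_mono[OF S(1)] by (auto simp: Q_def)
  from deriv_poly_constants[OF this, of x] have "poly (formal_deriv p) x * d x = 0"
    using p by (simp add: Q_def)
  then have "poly (formal_deriv p) x = 0" using char0_domainD(1)[OF dom] dx by blast
  moreover have fd: "formal_deriv p \<noteq> 0"
  proof
    assume "formal_deriv p = 0"
    then obtain a where "p = [:a:]" using formal_deriv_eq_0_iff[OF dom] by blast
    then show False using p by (simp add: Q_def)
  qed
  ultimately have "Q (formal_deriv p)" using p formal_deriv_polys_over[OF S(2)] by (simp add: Q_def)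
  then have "degree p \<le> degree (formal_deriv p)" by (rule min)
  then have "degree p = 0" using degree_formal_deriv_le[of p] by linarith
  then obtain a where "p = [:a:]" by (rule degree_eq_zeroE)
  then show False using fd by (simp add: formal_deriv_simps)
qed

text \<open>An element with \<open>d x \<noteq> 0\<close> has a last nonzero iterated derivative; this is a constant, hence
  invertible, and dividing the preceding derivative by it gives \<open>s\<close> with \<open>d s = 1\<close>. On polynomials in
  \<open>s\<close> over the constants \<open>d\<close> is the derivative, and since nonzero integers are invertible an antiderivative
  exists. Induction on the order of nilpotency expresses every element as such a polynomial.\<close>

lemma (in ring_derivation) polynomial_ring_over_constants:
  assumes dom: "char0_domain TYPE('r)" and nil: "\<And>x. \<exists>n. (d ^^ n) x = 0" and nz: "\<exists>x. d x \<noteq> 0"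
    and units: "\<And>x. d x = 0 \<Longrightarrow> x \<noteq> 0 \<Longrightarrow> x dvd 1"
  obtains s where "\<And>x. \<exists>!p. p \<in> polys_over {x. d x = 0} \<and> poly p s = x"
proof -
  note K = subring_set_constants
  have inverse: "\<exists>v. d v = 0 \<and> u * v = 1" if u: "d u = 0" "u \<noteq> 0" for u
  proof -
    obtain v where v: "1 = u * v" using units[OF u] by (auto elim: dvdE)
    then have "u * d v = 0" using deriv_mult[of u v] u deriv_1 by simp
    then have "d v = 0" using char0_domainD(1)[OF dom] u by blast
    then show ?thesis using v by auto
  qed
  obtain x where x: "d x \<noteq> 0" using nz by blast
  obtain i where i: "(d ^^ i) x \<noteq> 0" "\<And>k. k > i \<Longrightarrow> (d ^^ k) x = 0"
    using top_order_exists[of "{0}" x] nil[of x] x deriv_0 by (metis singleton_iff)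
  have "i \<noteq> 0" using i(2)[of 1] x by auto
  then obtain j where j: "i = Suc j" by (cases i) auto
  have "d ((d ^^ i) x) = 0" using i(2)[of "Suc i"] by simp
  then obtain v where v: "d v = 0" "(d ^^ i) x * v = 1" using inverse i(1) by blast
  define s where "s = (d ^^ j) x * v"
  have s: "d s = 1" using v by (simp add: s_def deriv_mult j)
  have ex: "\<exists>p\<in>polys_over {x. d x = 0}. poly p s = x" if "(d ^^ n) x = 0" for n x
    using that
  proof (induction n arbitrary: x)
    case 0
    then show ?case using polys_over_simps(1)[OF K] by force
  next
    case (Suc n)
    have "(d ^^ n) (d x) = 0" using Suc.prems by (simp add: funpow_swap1)
    from Suc.IH[OF this] obtain p where p: "p \<in> polys_over {x. d x = 0}" "poly p s = d x" by blast
    have "\<exists>v. d v = 0 \<and> of_nat (Suc m) * v = 1" for m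
      using inverse[OF deriv_of_nat[of "Suc m"]] char0_domainD(2)[OF dom, of "Suc m"] by blast
    then obtain iv where iv: "\<And>m. d (iv m) = 0" "\<And>m. of_nat (Suc m) * iv m = 1" by metis
    define P where "P = (\<Sum>m\<le>degree p. monom (iv m * coeff p m) (Suc m))"
    have P: "coeff P (Suc m) = iv m * coeff p m" for m
    proof -
      have "coeff P (Suc m) = (\<Sum>l\<le>degree p. if l = m then iv l * coeff p l else 0)"
        unfolding P_def coeff_sum by (intro sum.cong) auto
      also have "\<dots> = iv m * coeff p m" by (subst sum.delta) (auto simp: coeff_eq_0)
      finally show ?thesis .
    qed
    have PK: "P \<in> polys_over {x. d x = 0}"
    proof -
      have "d (coeff P m) = 0" for m
      proof (cases m)
        case 0
        then show ?thesis by (simp add: P_def coeff_sum)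
      next
        case (Suc m)
        then show ?thesis using p(1) iv by (simp add: P deriv_mult polys_over_def)
      qed
      then show ?thesis by (simp add: polys_over_def)
    qed
    have "formal_deriv P = p"
      by (rule poly_eqI) (simp add: coeff_formal_deriv P iv mult.assoc[symmetric] del: of_nat_Suc)
    then have "d (x - poly P s) = 0" using deriv_poly_constants[OF PK, of s] p(2) s by (simp add: deriv_diff)
    then have "[:x - poly P s:] + P \<in> polys_over {x. d x = 0}"
      by (intro polys_over_simps[OF K] PK) (auto simp: polys_over_simps[OF K])
    then show ?case by (rule bexI[rotated]) simp
  qed
  have uniq: "p = 0" if "p \<in> polys_over {x. d x = 0}" "poly p s = 0" for p
    using that
  proof (induction "degree p" arbitrary: p rule: less_induct)
    case less
    show ?case
    proof (cases "degree p = 0")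
      case True
      then obtain a where "p = [:a:]" by (rule degree_eq_zeroE)
      then show ?thesis using less.prems by simp
    next
      case False
      then have "degree (formal_deriv p) < degree p" using degree_formal_deriv_le[of p] by linarith
      moreover have "poly (formal_deriv p) s = 0"
        using deriv_poly_constants[OF less.prems(1), of s] less.prems(2) s by simp
      ultimately have "formal_deriv p = 0" using less.hyps less.prems(1) formal_deriv_polys_over[OF K] by blast
      then obtain a where "p = [:a:]" using formal_deriv_eq_0_iff[OF dom] by blast
      then show ?thesis using less.prems by simp
    qed
  qed
  show thesis
  proof (rule that, rule ex_ex1I)
    show "\<exists>p. p \<in> polys_over {x. d x = 0} \<and> poly p s = x" for x using ex nil by blast
    show "p = p'" if "p \<in> polys_over {x. d x = 0} \<and> poly p s = x" "p' \<in> polys_over {x. d x = 0} \<and> poly p' s = x" for x p p'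
      using uniq[of "p - p'"] that polys_over_simps(4)[OF K] by simp
  qed
qed

text \<open>Clearing denominators, algebraic over \<open>S\<close> is the same as algebraic over its field of fractions \<open>F\<close>.\<close>

lemma subring_set_algebraic_over_field_type:
  fixes S :: "'r::field set"
  assumes S: "subring_set S"
  shows "subring_set {x. algebraic_over S x}"
proof -
  define F where "F = {a / b | a b. a \<in> S \<and> b \<in> S \<and> b \<noteq> 0}"
  note * = subring_set_simps[OF S]
  have FI: "a / b \<in> F" if "a \<in> S" "b \<in> S" "b \<noteq> 0" for a b using that by (auto simp: F_def)
  have FE: "\<exists>a b. x = a / b \<and> a \<in> S \<and> b \<in> S \<and> b \<noteq> 0" if "x \<in> F" for x using that by (simp add: F_def)
  have SF: "S \<subseteq> F"
  proof
    fix a assume "a \<in> S" then show "a \<in> F" using FI[of a 1] *(1) by simp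
  qed
  have F: "subring_set F"
  proof -
    have "1 \<in> F" using SF *(1) by blast
    moreover have "x + y \<in> F" "x * y \<in> F" "- x \<in> F" if xy: "x \<in> F" "y \<in> F" for x y
    proof -
      obtain a b c e where e: "x = a / b" "y = c / e" "a \<in> S" "b \<in> S" "c \<in> S" "e \<in> S" "b \<noteq> 0" "e \<noteq> 0"
        using FE[OF xy(1)] FE[OF xy(2)] by metis
      have "x + y = (a * e + c * b) / (b * e)" "x * y = (a * c) / (b * e)" "- x = (- a) / b"
        using e by (simp_all add: add_frac_eq)
      moreover have "a * e + c * b \<in> S" "b * e \<in> S" "a * c \<in> S" "- a \<in> S" "b * e \<noteq> 0"
        using e by (auto intro!: *(3,4,5))
      ultimately show "x + y \<in> F" "x * y \<in> F" "- x \<in> F" using e FI by metis+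
    qed
    ultimately show ?thesis unfolding subring_set_def by simp
  qed
  have "inverse x \<in> F" if x: "x \<in> F" for x
  proof -
    obtain a b where ab: "x = a / b" "a \<in> S" "b \<in> S" "b \<noteq> 0" using FE[OF x] by metis
    show ?thesis
    proof (cases "a = 0")
      case True
      then show ?thesis using ab x by simp
    next
      case False
      then have "inverse x = b / a" using ab by simp
      then show ?thesis using ab False FI by simp
    qed
  qed
  then have "subfield_set F" using F by (simp add: subfield_set_def)
  moreover have "algebraic_over F x \<longleftrightarrow> algebraic_over S x" for x
  proof
    assume "algebraic_over F x"
    then obtain p where p: "p \<in> polys_over F" "p \<noteq> 0" "poly p x = 0" by (auto simp: algebraic_over_def)
    have "\<exists>b\<in>S. b \<noteq> 0 \<and> smult b p \<in> polys_over S" if "p \<in> polys_over F" for p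
      using that
    proof (induction p)
      case 0
      show ?case by (rule bexI[of _ 1]) (auto simp: * polys_over_simps[OF S])
    next
      case (pCons f p)
      have "coeff (pCons f p) i \<in> F" for i using pCons.prems by (simp add: polys_over_def)
      from this[of 0] this[of "Suc _"] have f: "f \<in> F" "p \<in> polys_over F" by (auto simp: polys_over_def)
      obtain b where b: "b \<in> S" "b \<noteq> 0" "smult b p \<in> polys_over S" using pCons.IH[OF f(2)] by blast
      obtain a c where ac: "f = a / c" "a \<in> S" "c \<in> S" "c \<noteq> 0" using FE[OF f(1)] by metis
      have "smult (c * b) (pCons f p) = pCons (b * a) (smult c (smult b p))" using ac by simp
      also have "\<dots> \<in> polys_over S" 
        using ac b by (intro polys_over_simps(8)[OF S] polys_over_simps(7)[OF S, of c "smult b p"] *(4))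
      finally show ?case using ac b * by (intro bexI[of _ "c * b"]) auto
    qed
    from this[OF p(1)] obtain b where "b \<in> S" "b \<noteq> 0" "smult b p \<in> polys_over S" by blast
    then show "algebraic_over S x" using p unfolding algebraic_over_def by (intro bexI[of _ "smult b p"]) auto
  qed (use algebraic_over_mono SF in blast)
  ultimately show ?thesis using subring_set_algebraic_over_subfield[of F] by simp
qed

lemma to_fract_simps:
  "Fract (a + b) 1 = Fract a 1 + Fract b (1::'r::idom)" "Fract (a * b) 1 = Fract a 1 * Fract b (1::'r)"
  "Fract a 1 = Fract b (1::'r) \<longleftrightarrow> a = b"
  by (simp_all add: eq_fract)

lemma ring_hom_on_to_fract: "ring_hom_on S (\<lambda>a::'r::idom. Fract a 1)"
  by (simp add: ring_hom_on_def One_fract_def)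

lemma algebraic_over_image:
  assumes S: "subring_set S" and h: "ring_hom_on UNIV h" "inj h"
  shows "algebraic_over (h ` S) (h x) \<longleftrightarrow> algebraic_over S x"
proof -
  have U: "subring_set UNIV" by (simp add: subring_set_def)
  have ev: "h (poly p x) = poly (map_poly h p) (h x)" for p
    by (rule poly_map_poly_ring_hom_on[OF U h(1)]) (simp_all add: polys_over_def)
  note h0 = ring_hom_on_simps(1)[OF U h(1)]
  have h0_iff: "h a = 0 \<longleftrightarrow> a = 0" for a using h(2) h0 by (metis injD)
  show ?thesis
  proof
    assume "algebraic_over (h ` S) (h x)"
    then obtain p where p: "p \<in> polys_over (h ` S)" "p \<noteq> 0" "poly p (h x) = 0" by (auto simp: algebraic_over_def)
    define q where "q = map_poly (inv_into UNIV h) p"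
    have i0: "inv_into UNIV h 0 = 0" using h(2) h0 by (metis inv_f_f)
    have c: "coeff q i \<in> S \<and> h (coeff q i) = coeff p i" for i
    proof -
      obtain a where "a \<in> S" "coeff p i = h a" using p(1) unfolding polys_over_def by blast
      then show ?thesis using h(2) by (simp add: q_def coeff_map_poly i0)
    qed
    then have "map_poly h q = p" by (intro poly_eqI) (simp add: coeff_map_poly h0)
    then have "h (poly q x) = 0" "q \<noteq> 0" using p ev[of q] by auto
    then have "poly q x = 0" by (simp add: h0_iff)
    then show "algebraic_over S x" using c \<open>q \<noteq> 0\<close> unfolding algebraic_over_def by (intro bexI[of _ q]) (auto simp: polys_over_def)
  next
    assume "algebraic_over S x"
    then obtain p where p: "p \<in> polys_over S" "p \<noteq> 0" "poly p x = 0" by (auto simp: algebraic_over_def)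
    have "map_poly h p \<in> polys_over (h ` S)" using p(1) by (simp add: polys_over_def coeff_map_poly h0)
    moreover have "map_poly h p \<noteq> 0" using p(2) by (simp add: map_poly_eq_0_iff h0 h0_iff)
    moreover have "poly (map_poly h p) (h x) = 0" using ev[of p] p(3) h0 by simp
    ultimately show "algebraic_over (h ` S) (h x)" unfolding algebraic_over_def by blast
  qed
qed

lemma subring_set_algebraic_over:
  fixes S :: "'r::idom set"
  assumes S: "subring_set S"
  shows "subring_set {x. algebraic_over S x}"
proof -
  let ?h = "\<lambda>a::'r. Fract a 1"
  have inj: "inj ?h" by (rule injI) (simp add: to_fract_simps)
  have eq: "algebraic_over S x \<longleftrightarrow> algebraic_over (?h ` S) (Fract x 1)" for x
    using algebraic_over_image[OF S ring_hom_on_to_fract inj, of x] by simp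
  note * = subring_set_algebraic_over_field_type[OF subring_set_image[OF S ring_hom_on_to_fract]]
  note c = subring_set_simps(1,3,4,5)[OF *, unfolded mem_Collect_eq One_fract_def]
  show ?thesis
    unfolding subring_set_def eq mem_Collect_eq to_fract_simps(1,2) minus_fract[symmetric]
    using c by blast
qed

section \<open>Affine curves\<close>

context poisson_algebra
begin

lemma k_subalgebraI:
  assumes S: "subring_set S" and "range (\<lambda>c. sc c 1) \<subseteq> S"
  shows "k_subalgebra sc S"
proof -
  have "sc c x \<in> S" if "x \<in> S" for c x
    using subring_set_simps(4)[OF S _ that, of "sc c 1"] assms(2) scale_eq_mult[of c x] by auto
  then show ?thesis unfolding k_subalgebra_def subspace_def using subring_set_simps[OF S] by auto
qed

lemma affine_finitely_generated:
  assumes "affine_algebra sc"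
  obtains G where "finite G" "generated_subring (range (\<lambda>c. sc c 1) \<union> G) = UNIV"
proof -
  obtain G where G: "finite G" "k_subalgebra sc hull G = UNIV" using assms by (auto simp: affine_algebra_def)
  have "k_subalgebra sc (generated_subring (range (\<lambda>c. sc c 1) \<union> G))"
    by (rule k_subalgebraI[OF subring_set_generated]) (auto intro: generated_subring.base)
  then have "k_subalgebra sc hull G \<subseteq> generated_subring (range (\<lambda>c. sc c 1) \<union> G)"
    by (intro hull_minimal) (auto intro: generated_subring.base)
  then show thesis using that G by blast
qed

text \<open>A derivation that vanishes on scalars vanishes on all elements algebraic over them. So the bracket
  with any element vanishes on \<open>K[s]\<close> as soon as it vanishes on \<open>s\<close>; apply this twice.\<close>

lemma bracket_eq_0:
  assumes dom: "char0_domain TYPE('a)" and K: "\<And>x. x \<in> K \<Longrightarrow> algebraic_over (range (\<lambda>c. sc c 1)) x"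
    and gen: "\<And>x. \<exists>p\<in>polys_over K. poly p s = x"
  shows "br x y = 0"
proof -
  have ind: "\<beta> x = 0" if \<beta>: "ring_derivation \<beta>" "\<And>c. \<beta> (sc c 1) = 0" "\<beta> s = 0" for \<beta> x
  proof -
    interpret ring_derivation \<beta> by fact
    have "\<beta> z = 0" if "z \<in> K" for z
      by (rule deriv_algebraic_eq_0[OF dom K[OF that] _ subring_set_scalars]) (auto simp: \<beta>)
    moreover obtain p where p: "p \<in> polys_over K" "poly p s = x" using gen by blast
    ultimately have "p \<in> polys_over {x. \<beta> x = 0}" by (auto simp: polys_over_def)
    from deriv_poly_constants[OF this, of s] show ?thesis using \<beta>(3) p(2) by simp
  qed
  have s: "br x s = 0" for x
    by (rule ind[OF ring_derivation_bracket_left]) (simp_all add: bracket_const bracket_self)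
  show ?thesis
    by (rule ind[OF ring_derivation_bracket_right]) (simp_all add: bracket_const s)
qed

text \<open>In an equation of least degree the constant term is nonzero, hence an invertible scalar.\<close>

lemma algebraic_imp_unit:
  assumes dom: "char0_domain TYPE('a)" and f: "algebraic_over (range (\<lambda>c. sc c 1)) f" "f \<noteq> 0"
  shows "f dvd 1"
proof -
  define Q where "Q p \<longleftrightarrow> p \<in> polys_over (range (\<lambda>c. sc c 1)) \<and> p \<noteq> 0 \<and> poly p f = 0" for p
  obtain p0 where "Q p0" using f(1) unfolding algebraic_over_def Q_def by blast
  then obtain p where p: "Q p" and min: "\<And>q. Q q \<Longrightarrow> degree p \<le> degree q"
    using ex_has_least_nat[of Q p0 degree] by blast
  obtain a r where pr: "p = pCons a r" by (cases p)
  have "coeff p i \<in> range (\<lambda>c. sc c 1)" for i using p by (simp add: Q_def polys_over_def)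
  from this[of 0] this[of "Suc _"] have a: "a \<in> range (\<lambda>c. sc c 1)" "r \<in> polys_over (range (\<lambda>c. sc c 1))"
    by (auto simp: pr polys_over_def)
  have eq: "a + f * poly r f = 0" using p by (simp add: Q_def pr)
  have "a \<noteq> 0"
  proof
    assume a0: "a = 0"
    then have "poly r f = 0" using eq f(2) char0_domainD(1)[OF dom] by auto
    moreover have "r \<noteq> 0" using p a0 by (auto simp: Q_def pr)
    ultimately have "Q r" using a(2) by (simp add: Q_def)
    from min[OF this] \<open>r \<noteq> 0\<close> show False by (simp add: pr)
  qed
  moreover obtain c where c: "a = sc c 1" using a(1) by blast
  ultimately have "c \<noteq> 0" by auto
  then have "sc c 1 * sc (inverse c) 1 = 1" using scale_mult[of c 1 "sc (inverse c) 1"] by simp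
  then have "f * (- poly r f * sc (inverse c) 1) = 1"
    using eq c by (simp add: eq_neg_iff_add_eq_0[symmetric] mult.assoc[symmetric])
  then show ?thesis by (metis dvd_triv_left)
qed

end

text \<open>Were \<open>f\<close> transcendental over the ground field, it could be specialised to almost every scalar by a
  homomorphism of the finitely generated algebra \<open>A\<close>, and then \<open>f - c\<close> would not be a unit for these
  \<open>c\<close>. The value \<open>c = 0\<close> is left out for the sake of the application, where \<open>f\<close> is known not to be a unit.\<close>

lemma affine_algebraic_if_units:
  fixes sc :: "'k::field_char_0 \<Rightarrow> 'a::idom \<Rightarrow> 'a"
  assumes pa: "poisson_algebra sc br" and aff: "affine_algebra sc"
    and unit: "\<And>c. c \<noteq> 0 \<Longrightarrow> f - sc c 1 = 0 \<or> f - sc c 1 dvd 1"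
  shows "algebraic_over (range (\<lambda>c. sc c 1)) f"
proof (rule ccontr)
  assume trans: "\<not> algebraic_over (range (\<lambda>c. sc c 1)) f"
  interpret poisson_algebra sc br by fact
  define S where "S = range (\<lambda>c. sc c (1::'a))"
  define \<iota> :: "'a \<Rightarrow> 'a fract alg_closure" where "\<iota> a = to_ac (Fract a 1)" for a
  have U: "subring_set (UNIV :: 'a set)" by (simp add: subring_set_def)
  have hom: "ring_hom_on T \<iota>" for T
    by (auto simp: ring_hom_on_def \<iota>_def One_fract_def[symmetric] simp flip: to_ac_add to_ac_mult)
  have inj: "inj \<iota>" by (rule injI) (simp add: \<iota>_def eq_fract)
  have S: "subring_set S" unfolding S_def by (rule subring_set_scalars)
  have K: "subring_set (\<iota> ` S)" by (rule subring_set_image[OF S hom])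
  have tr: "\<not> algebraic_over (\<iota> ` S) (\<iota> f)"
    using trans algebraic_over_image[OF S hom inj, of f] by (simp add: S_def)
  obtain G where G: "finite G" "generated_subring (S \<union> G) = UNIV"
    using affine_finitely_generated[OF aff] unfolding S_def by blast
  define T where "T = generated_subring (adjoin (\<iota> ` S) (\<iota> f) \<union> \<iota> ` G)"
  have T: "subring_set T" unfolding T_def by (rule subring_set_generated)
  have range: "\<iota> a \<in> T" for a
  proof -
    note h = ring_hom_on_simps[OF U hom]
    have "subring_set {a. \<iota> a \<in> T}"
      unfolding subring_set_def using subring_set_simps[OF T] by (auto simp: h)
    moreover have "S \<union> G \<subseteq> {a. \<iota> a \<in> T}"
      using adjoin_superset(1)[OF K, of "\<iota> f"] by (auto simp: T_def intro: generated_subring.base)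
    ultimately show ?thesis using generated_subring_minimal G(2) by blast
  qed
  obtain p where p: "p \<noteq> 0" and spec: "\<And>z. poly p z \<noteq> 0 \<Longrightarrow>
      \<exists>\<xi>. ring_hom_on T \<xi> \<and> (\<forall>u\<in>\<iota> ` S. \<xi> u = u) \<and> \<xi> (\<iota> f) = z"
    using specialise_transcendental[OF K tr finite_imageI[OF G(1)]] unfolding T_def by metis
  have injc: "inj (\<lambda>c. \<iota> (sc c 1))"
    by (rule injI) (use inj in \<open>simp add: inj_eq scale_cancel_right\<close>)
  have "finite ((\<lambda>c. \<iota> (sc c 1)) -` {z. poly p z = 0})"
    by (rule finite_vimageI[OF poly_roots_finite[OF p] injc])
  then have "finite (insert 0 ((\<lambda>c. \<iota> (sc c 1)) -` {z. poly p z = 0}))" by (simp only: finite_insert)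
  then obtain c where "c \<notin> insert 0 ((\<lambda>c. \<iota> (sc c 1)) -` {z. poly p z = 0})"
    using infinite_UNIV_char_0[where 'a = 'k] by (metis UNIV_eq_I)
  then have c: "c \<noteq> 0" "poly p (\<iota> (sc c 1)) \<noteq> 0" by auto
  obtain \<xi>' where \<xi>': "ring_hom_on T \<xi>'" "\<And>u. u \<in> \<iota> ` S \<Longrightarrow> \<xi>' u = u" and f: "\<xi>' (\<iota> f) = \<iota> (sc c 1)"
    using spec[OF c(2)] by blast
  have c': "\<xi>' (\<iota> (sc c 1)) = \<iota> (sc c 1)" by (rule \<xi>'(2)) (simp add: S_def)
  note hT = ring_hom_on_simps[OF T \<xi>'(1)] and h = ring_hom_on_simps[OF U hom]
  define g where "g = f - sc c 1"
  have "\<iota> f = \<iota> (g + sc c 1)" by (simp add: g_def)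
  then have "\<iota> f = \<iota> g + \<iota> (sc c 1)" using h(3)[of g "sc c 1"] by simp
  then have "\<xi>' (\<iota> f) = \<xi>' (\<iota> g) + \<xi>' (\<iota> (sc c 1))" using hT(3)[OF range range] by simp
  then have g0: "\<xi>' (\<iota> g) = 0" using f c' by simp
  have "g \<noteq> 0"
  proof
    assume "g = 0"
    then have "f \<in> S" by (simp add: g_def S_def)
    then show False using algebraic_over_self[OF S] trans by (simp add: S_def)
  qed
  then have "g dvd 1" using unit[OF c(1)] by (simp add: g_def)
  then obtain w where "1 = g * w" by (auto elim: dvdE)
  then have "\<iota> 1 = \<iota> g * \<iota> w" using h(4)[of g w] by simp
  then have "\<xi>' (\<iota> 1) = \<xi>' (\<iota> g) * \<xi>' (\<iota> w)" using hT(4)[OF range range] by simp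
  then show False using g0 h(2) hT(2) by simp
qed

lemma no_prime_chain_of_length_2:
  assumes dim: "krull_dim R = 1"
    and P: "primeideal P0 R" "primeideal P1 R" "primeideal P2 R" "P0 \<subset> P1" "P1 \<subset> P2"
  shows False
proof -
  define Q where "Q i = (if i = 0 then P0 else if i = 1 then P1 else P2)" for i :: nat
  have "(\<forall>i\<le>2. primeideal (Q i) R) \<and> (\<forall>i<2. Q i \<subset> Q (Suc i))"
    using P by (auto simp: Q_def less_2_cases_iff)
  then have "enat 2 \<le> krull_dim R"
    unfolding krull_dim_def by (intro Sup_upper) blast
  then show False unfolding dim by (simp add: one_enat_def)
qed

text \<open>Here \<open>x\<close> itself may lie in \<open>I\<close> although some iterated derivative does not.\<close>

lemma (in ring_derivation) top_order_exists_above: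
  assumes "0 \<in> I" and x: "(d ^^ m) x \<notin> I" and nil: "\<forall>x. \<exists>n. (d ^^ n) x = 0"
  obtains i where "(d ^^ i) x \<notin> I" "\<And>k. k > i \<Longrightarrow> (d ^^ k) x \<in> I"
proof -
  obtain i where i: "(d ^^ i) ((d ^^ m) x) \<notin> I" "\<And>k. k > i \<Longrightarrow> (d ^^ k) ((d ^^ m) x) \<in> I"
    using top_order_exists[OF assms(1) x nil[rule_format]] by blast
  show thesis
  proof (rule that[of "i + m"])
    show "(d ^^ (i + m)) x \<notin> I" using i(1) by (simp add: funpow_add)
    show "(d ^^ k) x \<in> I" if "k > i + m" for k
      using i(2)[of "k - m"] that by (metis funpow_add comp_apply le_add_diff_inverse2 less_diff_conv less_imp_le add_lessD1 trans_less_add2 le_add2 order.trans)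
  qed
qed

text \<open>Let \<open>r\<close> be a nonzero constant that is not a unit and \<open>m\<close> a maximal ideal containing \<open>r\<close>. The elements
  whose iterated derivatives all lie in \<open>m\<close> form a prime ideal \<open>\<pp> \<subseteq> m\<close>, nonzero as it contains \<open>r\<close>.
  In dimension one \<open>\<pp> = m\<close>, so \<open>D\<close> induces a locally nilpotent derivation on the field \<open>A/m\<close>. Nonzero
  elements of a field are units and thus constants, so \<open>D\<close> maps \<open>A\<close> into \<open>m\<close>.

  Let \<open>f\<close> be a nonzero constant in the image of \<open>D\<close>, so that \<open>f \<in> m\<close>. For a nonzero scalar \<open>c\<close> the constant
  \<open>f - c\<close> is zero or a unit: otherwise the same reasoning gives a proper ideal containing \<open>f - c\<close> and
  the image of \<open>D\<close>, hence \<open>f\<close> and \<open>c\<close>. So \<open>f\<close> is algebraic over the ground field and is a unit,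
  contradicting \<open>f \<in> m\<close>.\<close>

lemma constants_are_units:
  fixes sc :: "'k::field_char_0 \<Rightarrow> 'a::idom \<Rightarrow> 'a" and D :: "'a \<Rightarrow> 'a"
  assumes pa: "poisson_algebra sc br" and noeth: "noetherian_ring (ring_of_type_algebra :: 'a ring)"
    and aff: "affine_algebra sc" and dim: "krull_dim (ring_of_type_algebra :: 'a ring) = 1"
    and D: "ring_derivation D" "\<And>x. \<exists>n. (D ^^ n) x = 0" "\<exists>x. D x \<noteq> 0"
    and r: "D r = 0" "r \<noteq> 0"
  shows "r dvd 1"
proof -
  interpret poisson_algebra sc br by fact
  interpret D: ring_derivation D by fact
  let ?R = "ring_of_type_algebra :: 'a ring"
  have dom: "char0_domain TYPE('a)" by (rule char0_domain_idom[OF CHAR_poisson_algebra[OF pa]])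
  have D2: "\<forall>x. \<exists>n. (D ^^ n) x = 0" using D(2) by blast
  have key: "\<exists>m. ideal m ?R \<and> 1 \<notin> m \<and> r \<in> m \<and> (\<forall>a. D a \<in> m)" if r: "D r = 0" "r \<noteq> 0" "\<not> r dvd 1" for r
  proof -
    define \<I> where "\<I> = {I. ideal I ?R \<and> r \<in> I \<and> 1 \<notin> I}"
    have "range (\<lambda>x. x * r) \<in> \<I>"
    proof -
      have "x * r + y * r \<in> range (\<lambda>x. x * r)" for x y by (metis distrib_right rangeI)
      moreover have "z * (x * r) \<in> range (\<lambda>x. x * r)" for x z by (metis mult.assoc rangeI)
      moreover have "0 \<in> range (\<lambda>x. x * r)" by (metis mult_zero_left rangeI)
      moreover have "r \<in> range (\<lambda>x. x * r)" by (metis mult_1 rangeI)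
      moreover have "1 \<notin> range (\<lambda>x. x * r)" using r(3) by (metis dvd_triv_right rangeE)
      ultimately show ?thesis unfolding \<I>_def ideal_type_iff by auto
    qed
    then have "\<I> \<noteq> {}" by blast
    then obtain m where m: "m \<in> \<I>" and max: "\<And>I. I \<in> \<I> \<Longrightarrow> m \<subseteq> I \<Longrightarrow> I = m"
      using noetherian_maximal_ideal_in[OF noeth, of \<I>] unfolding \<I>_def by blast
    have mI: "0 \<in> m" "\<And>x y. x \<in> m \<Longrightarrow> y \<in> m \<Longrightarrow> x + y \<in> m" "\<And>x z. x \<in> m \<Longrightarrow> z * x \<in> m" "1 \<notin> m" "r \<in> m"
      and m_ideal: "ideal m ?R"
      using m unfolding \<I>_def ideal_type_iff by auto
    have sum_m: "(\<And>k. k \<in> K \<Longrightarrow> f k \<in> m) \<Longrightarrow> sum f K \<in> m" for f :: "nat \<Rightarrow> 'a" and K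
      by (induction K rule: infinite_finite_induct) (auto intro: mI)
    have inverse: "\<exists>i b. i \<in> m \<and> 1 = i + x * b" if x: "x \<notin> m" for x
    proof (rule ccontr)
      assume none: "\<not> ?thesis"
      define J where "J = {i + x * b | i b. i \<in> m}"
      have "J \<in> \<I>"
        unfolding \<I>_def ideal_type_iff mem_Collect_eq
      proof (intro conjI ballI allI)
        have mJ: "i \<in> J" if "i \<in> m" for i unfolding J_def using that by (intro CollectI exI[of _ i] exI[of _ 0]) simp
        show "0 \<in> J" "r \<in> J" using mJ mI by auto
        show "1 \<notin> J" using none unfolding J_def by blast
        show "y + z \<in> J" if yz: "y \<in> J" "z \<in> J" for y z
        proof -
          obtain i b i' b' where "y = i + x * b" "z = i' + x * b'" "i \<in> m" "i' \<in> m"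
            using yz unfolding J_def mem_Collect_eq by metis
          then show ?thesis unfolding J_def using mI(2)
            by (intro CollectI exI[of _ "i + i'"] exI[of _ "b + b'"]) (simp add: algebra_simps)
        qed
        show "w * y \<in> J" if y: "y \<in> J" for y w
        proof -
          obtain i b where "y = i + x * b" "i \<in> m" using y unfolding J_def mem_Collect_eq by metis
          then show ?thesis unfolding J_def using mI(3)
            by (intro CollectI exI[of _ "w * i"] exI[of _ "w * b"]) (simp add: algebra_simps)
        qed
      qed
      moreover have "m \<subseteq> J" unfolding J_def by (force intro: exI[of _ 0])
      ultimately have "J = m" by (rule max)
      moreover have "x \<in> J" unfolding J_def using mI(1) by (intro CollectI exI[of _ 0] exI[of _ 1]) simp
      ultimately show False using x by blast
    qed
    have prime: "x \<in> m \<or> y \<in> m" if xy: "x * y \<in> m" for x y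
    proof (cases "x \<in> m")
      case False
      then obtain i b where ib: "i \<in> m" "1 = i + x * b" using inverse by blast
      have "y = y * i + b * (x * y)" using ib(2) by (metis distrib_right mult.commute mult.left_commute mult_1)
      then have "y \<in> m" using mI(2)[OF mI(3)[OF ib(1), of y] mI(3)[OF xy, of b]] by simp
      then show ?thesis ..
    qed simp
    have char: "of_nat (Suc n) \<notin> m" for n
    proof
      assume a: "of_nat (Suc n) \<in> m"
      have "sc (of_nat (Suc n)) 1 dvd (1::'a)" by (rule scalar_dvd_1) (simp del: of_nat_Suc)
      then have "of_nat (Suc n) dvd (1::'a)" unfolding of_nat_scale by (simp only: mult_1_right)
      then obtain v :: 'a where "1 = of_nat (Suc n) * v" unfolding dvd_def by blast
      then show False using mI(3)[OF a, of v] mI(4) by (simp only: mult.commute)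
    qed
    have top: "(D ^^ (i + j)) (x * y) \<notin> m"
      if "(D ^^ i) x \<notin> m" "\<forall>k>i. (D ^^ k) x \<in> m" "(D ^^ j) y \<notin> m" "\<forall>k>j. (D ^^ k) y \<in> m" for i j x y
      by (rule D.top_order_mult) (use mI prime char that in \<open>auto simp del: of_nat_Suc\<close>)
    define \<pp> where "\<pp> = {a. \<forall>i. (D ^^ i) a \<in> m}"
    have r0: "(D ^^ i) r \<in> m" for i
      by (cases i) (use mI(1,5) r(1) in \<open>simp_all add: funpow_swap1\<close>)
    have pp_prime: "primeideal \<pp> ?R"
      unfolding primeideal_type_iff ideal_type_iff
    proof (intro conjI allI impI ballI)
      show "0 \<in> \<pp>" using mI by (simp add: \<pp>_def)
      show "x + y \<in> \<pp>" if "x \<in> \<pp>" "y \<in> \<pp>" for x y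
        using that mI by (simp add: \<pp>_def D.funpow_deriv_add)
      show "z * x \<in> \<pp>" if x: "x \<in> \<pp>" for x z
      proof -
        have "(D ^^ n) (z * x) \<in> m" for n
          unfolding D.funpow_deriv_mult by (intro sum_m mI(3)) (use x in \<open>simp add: \<pp>_def\<close>)
        then show ?thesis by (simp add: \<pp>_def)
      qed
      show "\<pp> \<noteq> UNIV"
      proof
        assume "\<pp> = UNIV"
        then have "(D ^^ 0) 1 \<in> m" unfolding \<pp>_def by blast
        then show False using mI by simp
      qed
      show "x \<in> \<pp> \<or> y \<in> \<pp>" if xy: "x * y \<in> \<pp>" for x y
      proof (rule ccontr)
        assume "\<not> (x \<in> \<pp> \<or> y \<in> \<pp>)"
        then obtain i0 j0 where "(D ^^ i0) x \<notin> m" "(D ^^ j0) y \<notin> m" unfolding \<pp>_def by blast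
        then obtain i j where i: "(D ^^ i) x \<notin> m" "\<And>k. k > i \<Longrightarrow> (D ^^ k) x \<in> m"
          and j: "(D ^^ j) y \<notin> m" "\<And>k. k > j \<Longrightarrow> (D ^^ k) y \<in> m"
          using D.top_order_exists_above[OF mI(1) _ D2] by metis
        have "(D ^^ (i + j)) (x * y) \<notin> m" by (rule top) (use i j in auto)
        then show False using xy by (simp add: \<pp>_def)
      qed
    qed
    have m_prime: "primeideal m ?R"
      unfolding primeideal_type_iff using m_ideal prime mI(4) by auto
    have "(1::'a) \<notin> {0}" by simp
    then have "{0::'a} \<noteq> UNIV" by blast
    then have zero_prime: "primeideal {0} ?R" unfolding primeideal_type_iff ideal_type_iff by auto
    have "\<pp> \<subseteq> m" unfolding \<pp>_def by (force dest: spec[of _ 0])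
    moreover have "{0} \<subset> \<pp>" using r0 r(2) mI(1) by (auto simp: \<pp>_def)
    ultimately have "\<pp> = m"
      using no_prime_chain_of_length_2[OF dim zero_prime pp_prime m_prime] by blast
    then have stable: "(D ^^ i) a \<in> m" if "a \<in> m" for a i using that unfolding \<pp>_def by blast
    have "D a \<in> m" for a
    proof (rule ccontr)
      assume Da: "D a \<notin> m"
      then have "a \<notin> m" using stable[of a 1] by auto
      then obtain e b where eb: "e \<in> m" "1 = e + a * b" using inverse by blast
      have "b \<notin> m" using eb mI by (metis)
      obtain i where i: "(D ^^ i) a \<notin> m" "\<And>k. k > i \<Longrightarrow> (D ^^ k) a \<in> m"
        using D.top_order_exists_above[of m 0 a, OF mI(1) _ D2] \<open>a \<notin> m\<close> by auto
      obtain j where j: "(D ^^ j) b \<notin> m" "\<And>k. k > j \<Longrightarrow> (D ^^ k) b \<in> m"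
        using D.top_order_exists_above[of m 0 b, OF mI(1) _ D2] \<open>b \<notin> m\<close> by auto
      have "(D ^^ (i + j)) (a * b) \<notin> m" by (rule top) (use i j in auto)
      moreover have "i \<noteq> 0" using i(2)[of 1] Da by auto
      then obtain k where k: "i + j = Suc k" by (cases i) auto
      have "a * b = 1 + (- 1) * e" using eb(2) by (simp add: algebra_simps)
      then have "(D ^^ Suc k) (a * b) = (D ^^ Suc k) ((- 1) * e)"
        by (simp only: D.funpow_deriv_add) (simp add: funpow_swap1)
      then have "(D ^^ (i + j)) (a * b) \<in> m" unfolding k using stable[OF mI(3)[OF eb(1), of "- 1"], of "Suc k"] by (simp only:)
      ultimately show False by blast
    qed
    then show ?thesis using m_ideal mI(4,5) by blast
  qed
  obtain x where x: "D x \<noteq> 0" using D(3) by blast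
  obtain i where i: "(D ^^ i) x \<noteq> 0" "\<And>k. k > i \<Longrightarrow> (D ^^ k) x = 0"
    using D.top_order_exists_above[of "{0}" 1 x, OF _ _ D2] x by auto
  have "i \<noteq> 0" using i(2)[of 1] x by auto
  then obtain j where j: "i = Suc j" by (cases i) auto
  define f where "f = (D ^^ i) x"
  have f: "D f = 0" "f \<noteq> 0" "f = D ((D ^^ j) x)" using i(1) i(2)[of "Suc i"] by (simp_all add: f_def j)
  show ?thesis
  proof (rule ccontr)
    assume "\<not> r dvd 1"
    then obtain m where m: "ideal m ?R" "1 \<notin> m" "\<And>a. D a \<in> m" using key[OF r] by blast
    have "f - sc c 1 = 0 \<or> f - sc c 1 dvd 1" if c: "c \<noteq> 0" for c
    proof (rule ccontr)
      assume *: "\<not> ?thesis"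
      have "D (sc c 1) = 0" by (rule D.unit_constant[OF dom D(2) scalar_dvd_1[OF c]])
      then have "D (f - sc c 1) = 0" using f(1) by (simp add: D.deriv_diff)
      then obtain m' where m': "ideal m' ?R" "1 \<notin> m'" "f - sc c 1 \<in> m'" "\<And>a. D a \<in> m'"
        using key[of "f - sc c 1"] * by auto
      obtain v where v: "1 = sc c 1 * v" using scalar_dvd_1[OF c] by (auto elim: dvdE)
      have "1 = v * (f + (- 1) * (f - sc c 1))" using v by (simp add: mult.commute)
      moreover have "f \<in> m'" using m'(4) f(3) by metis
      ultimately show False using m'(1-3) unfolding ideal_type_iff by metis
    qed
    then have "algebraic_over (range (\<lambda>c. sc c 1)) f" by (rule affine_algebraic_if_units[OF pa aff])
    then have "f dvd 1" using algebraic_imp_unit[OF dom] f(2) by blast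
    then obtain v where "1 = f * v" by (rule dvdE)
    then have "1 = v * f" by (simp only: mult.commute)
    moreover have "f \<in> m" using m(3) f(3) by metis
    ultimately show False using m(1,2) unfolding ideal_type_iff by metis
  qed
qed

section \<open>Cancellation for affine curves\<close>

text \<open>This bound is applied to \<open>A'\<close>, where finite generation is inherited from \<open>A\<close>.\<close>

lemma derivation_degree_bounded_finitely_generated:
  fixes d :: "'r::comm_ring_1 poly \<Rightarrow> 'r poly"
  assumes d: "ring_derivation d" and S: "\<And>c. c \<in> S \<Longrightarrow> d [:c:] = 0"
    and G: "finite G" "generated_subring (S \<union> G) = UNIV"
  shows "\<exists>N. \<forall>a. degree (d [:a:]) \<le> N"
proof -
  interpret ring_derivation d by fact
  define N where "N = Max (insert 0 ((\<lambda>g. degree (d [:g:])) ` G))"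
  have "subring_set {a. degree (d [:a:]) \<le> N}"
    unfolding subring_set_def
  proof (intro conjI ballI)
    show "1 \<in> {a. degree (d [:a:]) \<le> N}" using deriv_1 by (simp add: one_pCons)
    fix x assume x: "x \<in> {a. degree (d [:a:]) \<le> N}"
    show "- x \<in> {a. degree (d [:a:]) \<le> N}" using x deriv_minus[of "[:x:]"] by simp
    fix y assume y: "y \<in> {a. degree (d [:a:]) \<le> N}"
    show "x + y \<in> {a. degree (d [:a:]) \<le> N}"
      using x y deriv_add[of "[:x:]" "[:y:]"] by (simp add: degree_add_le)
    have "d [:x * y:] = smult x (d [:y:]) + smult y (d [:x:])"
      using deriv_mult[of "[:x:]" "[:y:]"] by (simp add: mult.commute)
    then show "x * y \<in> {a. degree (d [:a:]) \<le> N}"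
      using x y by (auto intro!: degree_add_le intro: order.trans[OF degree_smult_le])
  qed
  moreover have "S \<union> G \<subseteq> {a. degree (d [:a:]) \<le> N}"
    using S G(1) by (auto simp: N_def)
  ultimately show ?thesis using generated_subring_minimal G(2) by blast
qed

lemma (in ore_iso) isomorphic_polynomial_rings:
  fixes K :: "'a set" and K' :: "'b set"
  assumes K: "subring_set K" "\<And>x. \<exists>!p. p \<in> polys_over K \<and> poly p s = x"
    and K': "subring_set K'" "\<And>y. \<exists>!p. p \<in> polys_over K' \<and> poly p s' = y"
    and bij: "bij_betw reduction K K'" and scalars: "range (\<lambda>c. sc c 1) \<subseteq> K"
    and br: "\<And>x y. br x y = 0" "\<And>x y. br' x y = 0"
  shows "poisson_isomorphic sc br sc' br'"
proof -
  define R where "R x = (THE p. p \<in> polys_over K \<and> poly p s = x)" for x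
  have R: "R x \<in> polys_over K" "poly (R x) s = x" for x
    using theI'[OF K(2)[of x]] unfolding R_def by auto
  have R_eq: "R (poly p s) = p" if "p \<in> polys_over K" for p
    unfolding R_def by (rule the1_equality[OF K(2)]) (use that in auto)
  have hom: "ring_hom_on UNIV reduction" by (simp add: ring_hom_on_def reduction_hom)
  have U: "subring_set (UNIV :: 'a set)" by (simp add: subring_set_def)
  have UP: "p \<in> polys_over (UNIV :: 'a set)" for p by (simp add: polys_over_def)
  note mp = map_poly_ring_hom_on[OF U hom UP UP]
  note red0 = ring_hom_on_simps(1)[OF U hom]
  define \<Theta> where "\<Theta> x = poly (map_poly reduction (R x)) s'" for x
  have R_add: "R (x + y) = R x + R y" and R_mult: "R (x * y) = R x * R y" for x y
    using R_eq[of "R x + R y"] R_eq[of "R x * R y"] R polys_over_simps[OF K(1)] by simp_all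
  have R_const: "R a = [:a:]" if "a \<in> K" for a
    using R_eq[of "[:a:]"] that polys_over_simps[OF K(1)] by simp
  have \<Theta>_const: "\<Theta> a = reduction a" if "a \<in> K" for a
    using that by (simp add: \<Theta>_def R_const map_poly_pCons red0)
  have \<Theta>_hom: "\<Theta> (x + y) = \<Theta> x + \<Theta> y" "\<Theta> (x * y) = \<Theta> x * \<Theta> y" for x y
    by (simp_all add: \<Theta>_def R_add R_mult mp)
  have inK: "sc c 1 \<in> K" for c using scalars by blast
  have \<Theta>_1: "\<Theta> 1 = 1"
    using \<Theta>_const[OF subring_set_simps(1)[OF K(1)]] reduction_hom(3) by simp
  have \<Theta>_scale: "\<Theta> (sc c x) = sc' c (\<Theta> x)" for c x
  proof -
    have "\<Theta> (sc c 1 * x) = reduction (sc c 1) * \<Theta> x" by (simp only: \<Theta>_hom \<Theta>_const[OF inK])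
    then show ?thesis
      using L.A.scale_eq_mult[of c x] R.A.scale_eq_mult[of c "\<Theta> x"] by (simp add: reduction_hom)
  qed
  have image: "map_poly reduction p \<in> polys_over K'" if "p \<in> polys_over K" for p
    using that bij by (auto simp: polys_over_def coeff_map_poly red0 bij_betw_def)
  have "bij \<Theta>"
  proof (rule bijI)
    show "inj \<Theta>"
    proof (rule injI)
      fix x y assume eq: "\<Theta> x = \<Theta> y"
      have "map_poly reduction (R x) = map_poly reduction (R y)"
        using K'(2)[of "\<Theta> x"] image[OF R(1)] eq unfolding \<Theta>_def by metis
      then have "reduction (coeff (R x) i) = reduction (coeff (R y) i)" for i
        by (metis coeff_map_poly red0)
      moreover have "coeff (R x) i \<in> K" "coeff (R y) i \<in> K" for i using R(1) by (simp_all add: polys_over_def)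
      ultimately have "R x = R y" using bij by (intro poly_eqI) (meson bij_betw_imp_inj_on inj_onD)
      then show "x = y" using R(2) by metis
    qed
    show "surj \<Theta>"
    proof (rule surjI[of _ "\<lambda>y. SOME x. \<Theta> x = y"])
      fix y
      obtain p where p: "p \<in> polys_over K'" "poly p s' = y" using K'(2)[of y] by blast
      define q where "q = map_poly (inv_into K reduction) p"
      have red0': "reduction 0 = 0" by (rule red0)
      have i0: "inv_into K reduction 0 = 0"
        using inv_into_f_f[OF bij_betw_imp_inj_on[OF bij] subring_set_simps(2)[OF K(1)]] by (simp add: red0')
      have c: "inv_into K reduction (coeff p i) \<in> K" "reduction (inv_into K reduction (coeff p i)) = coeff p i" for i
      proof -
        have "coeff p i \<in> reduction ` K" using p(1) bij by (simp add: polys_over_def bij_betw_def)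
        then show "inv_into K reduction (coeff p i) \<in> K" "reduction (inv_into K reduction (coeff p i)) = coeff p i"
          by (rule inv_into_into, rule f_inv_into_f)
      qed
      have "q \<in> polys_over K" using c(1) by (simp add: q_def polys_over_def coeff_map_poly i0)
      moreover have "map_poly reduction q = p"
        by (rule poly_eqI) (simp add: q_def coeff_map_poly i0 red0 c(2))
      ultimately have "\<Theta> (poly q s) = y" unfolding \<Theta>_def by (simp add: R_eq p(2))
      then show "\<Theta> (SOME x. \<Theta> x = y) = y" by (rule someI)
    qed
  qed
  moreover have "\<Theta> 0 = 0" using \<Theta>_hom(1)[of 0 0] by simp
  ultimately show ?thesis
    unfolding poisson_isomorphic_def poisson_iso_def Vector_Spaces.linear_iff
    by (intro exI[of _ \<Theta>])
      (use \<Theta>_hom \<Theta>_1 \<Theta>_scale br L.A.vector_space_axioms R.A.vector_space_axioms in simp)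
qed

text \<open>Assume that \<open>der\<close> does not vanish on \<open>A\<close>. Its leading coefficient \<open>D\<close> is a nonzero locally nilpotent derivation of
  \<open>A\<close>, with a field \<open>K\<close> of constants, and \<open>A = K[s]\<close>. Exchanging the two algebras gives a locally
  nilpotent \<open>E\<close> on \<open>A'\<close> with constants \<open>K'\<close>. Units are constants, so the reduction maps \<open>K\<close> to \<open>K'\<close>.
  For surjectivity a homomorphism \<open>\<rho>\<close> in the other direction is used, evaluation of \<open>\<psi>(b)\<close> at a
  suitable value of \<open>t\<close>: it is injective and inverts the reduction on \<open>K\<close>. If \<open>\<rho>\<close> mapped an element of
  \<open>K'\<close> outside of \<open>K\<close>, then \<open>K[s]\<close> would be algebraic over \<open>\<rho>(K')\<close>, so \<open>A'\<close> would be algebraic over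
  \<open>K'\<close> and \<open>E = 0\<close>.\<close>

lemma (in ore_iso_alpha) isomorphic_if_affine_curve:
  assumes noeth: "noetherian_ring (ring_of_type_algebra :: 'a ring)"
    and aff: "affine_algebra sc" and dim: "krull_dim (ring_of_type_algebra :: 'a ring) = 1"
  shows "poisson_isomorphic sc br sc' br'"
proof (cases "\<forall>a. der [:a:] = 0")
  case True
  then show ?thesis using isomorphic_if_constants_to_constants by blast
next
  case False
  then obtain a1 where a1: "der [:a1:] \<noteq> 0" by blast
  let ?\<psi> = "inv_into UNIV \<phi>"
  let ?k = "range (\<lambda>c. sc c (1::'a))" and ?k' = "range (\<lambda>c. sc' c (1::'b))"
  interpret I: poly_ring_iso ?\<psi> \<phi> by (rule inverse_iso)

  have bounded: "\<exists>N. \<forall>a. degree (der [:a:]) \<le> N"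
    by (rule derivation_degree_bounded[OF noeth CHAR_poisson_algebra[OF L.pa] ring_derivation_der adjoin_constants])
  obtain N x0 where N: "\<And>a. degree (der [:a:]) \<le> N" and x0: "deriv_coeff der N x0 \<noteq> 0"
    using exact_degree_bound[OF bounded a1] by metis
  define D where "D = deriv_coeff der N"
  have D: "ring_derivation D" unfolding D_def by (rule ring_derivation_deriv_coeff[OF ring_derivation_der])
  interpret D: ring_derivation D by (rule D)
  have D_nil: "\<exists>n. (D ^^ n) x = 0" for x
    unfolding D_def by (rule leading_coefficient_locally_nilpotent[OF domain ring_derivation_der der_nilpotent N])
  have D_nz: "\<exists>x. D x \<noteq> 0" using x0 by (auto simp: D_def)
  define K where "K = {x. D x = 0}"
  have K: "subring_set K" unfolding K_def by (rule D.subring_set_constants)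
  have K_unit: "x dvd 1" if "x \<in> K" "x \<noteq> 0" for x
    using constants_are_units[OF L.pa noeth aff dim D D_nil D_nz] that by (simp add: K_def)
  have unit_K: "x \<in> K" if "x dvd 1" for x
    using D.unit_constant[OF domain D_nil that] by (simp add: K_def)
  have scalar_K: "sc c 1 \<in> K" for c
    using unit_K[OF L.A.scalar_dvd_1[of c]] subring_set_simps(2)[OF K] by (cases "c = 0") auto
  have K_alg: "algebraic_over ?k x" if "x \<in> K" for x
    by (rule affine_algebraic_if_units[OF L.pa aff])
      (use K_unit subring_set_simps(6)[OF K that scalar_K] in blast)
  obtain s where s: "\<And>x. \<exists>!p. p \<in> polys_over K \<and> poly p s = x"
    using D.polynomial_ring_over_constants[OF domain D_nil D_nz] K_unit unfolding K_def by blast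

  have hom_red: "ring_hom_on UNIV reduction" by (simp add: ring_hom_on_def reduction_hom)
  have reduction_unit: "reduction u dvd 1" if "u dvd 1" for u
  proof -
    obtain v where "1 = u * v" using \<open>u dvd 1\<close> by (rule dvdE)
    then have "1 = reduction u * reduction v" using reduction_hom(2)[of u v] reduction_hom(3) by simp
    then show ?thesis by (rule dvdI)
  qed
  have K_const: "\<phi> [:a:] = [:reduction a:]" if aK: "a \<in> K" for a
  proof (cases "a = 0")
    case False
    with aK have "a dvd 1" by (rule K_unit)
    then obtain v where "1 = a * v" by (rule dvdE)
    then have "1 = [:a:] * [:v:]" by (simp add: one_pCons mult.commute)
    then have "[:a:] dvd 1" by (rule dvdI)
    then have "der [:a:] = 0" by (rule der.unit_constant[OF char0_domain_poly[OF domain] der_nilpotent])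
    then show ?thesis by (auto simp: der_eq_0_iff reduction_def)
  qed (simp add: reduction_def)
  have scale_iso: "\<phi> [:sc c 1:] = [:sc' c 1:]" for c
    using K_const[OF scalar_K[of c]] reduction_hom(3,4) by metis

  obtain G where G: "finite G" "generated_subring (?k \<union> G) = UNIV"
    by (rule L.A.affine_finitely_generated[OF aff])
  define \<tau> where "\<tau> = coeff (\<phi> [:0, 1:]) 0"
  \<comment> \<open>\<open>A'\<close> is the quotient of \<open>A[t]\<close> by \<open>\<psi>(t')\<close>, so it is generated by the images of \<open>t\<close> and of the
        generators of \<open>A\<close>.\<close>
  have gen': "generated_subring (?k' \<union> insert \<tau> (reduction ` G)) = UNIV" (is "?T = UNIV")
  proof (intro equalityI subset_UNIV subsetI)
    fix b
    note T = subring_set_generated[of "?k' \<union> insert \<tau> (reduction ` G)"]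
    have "subring_set {a. reduction a \<in> ?T}"
    proof -
      have U: "subring_set (UNIV :: 'a set)" by (simp add: subring_set_def)
      show ?thesis unfolding subring_set_def using subring_set_simps[OF T]
        by (auto simp: reduction_hom ring_hom_on_simps(5)[OF U hom_red])
    qed
    moreover have "?k \<union> G \<subseteq> {a. reduction a \<in> ?T}"
      by (auto simp: reduction_hom intro!: generated_subring.base)
    ultimately have red: "reduction a \<in> ?T" for a using generated_subring_minimal G(2) by blast
    have "coeff (\<phi> p) 0 \<in> ?T" for p
    proof (induction p)
      case (pCons a p)
      have "\<phi> (pCons a p) = \<phi> ([:a:] + [:0, 1:] * p)" by simp
      also have "\<dots> = \<phi> [:a:] + \<phi> [:0, 1:] * \<phi> p" by (simp only: iso_add iso_mult)
      finally have "coeff (\<phi> (pCons a p)) 0 = reduction a + \<tau> * coeff (\<phi> p) 0"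
        by (simp add: reduction_def \<tau>_def coeff_mult)
      moreover have "\<tau> \<in> ?T" by (auto intro: generated_subring.base)
      ultimately show ?case using red[of a] pCons.IH subring_set_simps(3,4)[OF T] by simp
    qed (use subring_set_simps(2)[OF T] in simp)
    from this[of "?\<psi> [:b:]"] show "b \<in> ?T" by simp
  qed

  have "\<exists>M. \<forall>b. degree (I.der [:b:]) \<le> M"
  proof (rule derivation_degree_bounded_finitely_generated[OF I.ring_derivation_der _ _ gen'])
    show "I.der [:c:] = 0" if c: "c \<in> ?k'" for c
    proof -
      obtain e where "c = sc' e 1" using c by blast
      then have "?\<psi> [:c:] = [:sc e 1:]" by (metis inv_iso scale_iso)
      then show ?thesis unfolding I.der_eq_0_iff by blast
    qed
  qed (use G(1) in simp)
  moreover have "\<exists>b. I.der [:b:] \<noteq> 0"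
  proof (rule ccontr)
    assume "\<not> ?thesis"
    then obtain b where "\<phi> [:a1:] = [:b:]" using I.constants_onto[of a1] by blast
    then show False using a1 by (simp add: der_eq_0_iff)
  qed
  ultimately obtain M y0 where M: "\<And>b. degree (I.der [:b:]) \<le> M" and y0: "deriv_coeff I.der M y0 \<noteq> 0"
    using exact_degree_bound[of I.der] by metis
  define E where "E = deriv_coeff I.der M"
  have E: "ring_derivation E" unfolding E_def by (rule ring_derivation_deriv_coeff[OF I.ring_derivation_der])
  interpret E: ring_derivation E by (rule E)
  have E_nil: "\<exists>n. (E ^^ n) y = 0" for y
    unfolding E_def by (rule leading_coefficient_locally_nilpotent[OF dom' I.ring_derivation_der I.der_nilpotent M])
  have E_nz: "\<exists>y. E y \<noteq> 0" using y0 by (auto simp: E_def)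
  define K' where "K' = {y. E y = 0}"
  have K': "subring_set K'" unfolding K'_def by (rule E.subring_set_constants)
  have unit_K': "y \<in> K'" if "y dvd 1" for y
    using E.unit_constant[OF dom' E_nil that] by (simp add: K'_def)
  have red_K': "reduction a \<in> K'" if "a \<in> K" for a
  proof (cases "a = 0")
    case True
    then show ?thesis using subring_set_simps(2)[OF K'] reduction_hom(1)[of 0 0] by simp
  next
    case False
    then show ?thesis using unit_K' reduction_unit K_unit[OF that] by blast
  qed

  \<comment> \<open>Evaluation at \<open>t = - a0\<close> is injective on the constants of \<open>der\<close> if \<open>t + a0\<close> is not a constant, for a
        nonzero constant divisible by \<open>t + a0\<close> would make \<open>t + a0\<close> a constant as well.\<close>
  have "\<exists>a0. der [:a0, 1:] \<noteq> 0"
  proof (rule ccontr)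
    assume *: "\<not> ?thesis"
    have "der [:a1, 1:] = der [:a1:] + der [:0, 1:]" using der.deriv_add[of "[:a1:]" "[:0, 1:]"] by simp
    then show False using * a1 by (metis add_0_right)
  qed
  then obtain a0 where a0: "der [:a0, 1:] \<noteq> 0" by blast
  define \<rho> where "\<rho> b = poly (?\<psi> [:b:]) (- a0)" for b
  have \<rho>_add: "\<rho> (x + y) = \<rho> x + \<rho> y" and \<rho>_mult: "\<rho> (x * y) = \<rho> x * \<rho> y" for x y
    using I.iso_add[of "[:x:]" "[:y:]"] I.iso_mult[of "[:x:]" "[:y:]"] by (simp_all add: \<rho>_def mult.commute)
  have \<rho>: "ring_hom_on UNIV \<rho>"
    using I.iso_1 by (simp add: ring_hom_on_def \<rho>_add \<rho>_mult) (simp add: \<rho>_def flip: one_pCons)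
  have \<rho>_0: "b = 0" if "\<rho> b = 0" for b
  proof (rule ccontr)
    assume "b \<noteq> 0"
    have "[:a0, 1:] dvd ?\<psi> [:b:]" using that unfolding \<rho>_def poly_eq_0_iff_dvd by simp
    then obtain w where w: "?\<psi> [:b:] = [:a0, 1:] * w" by (rule dvdE)
    have "\<phi> ([:a0, 1:] * w) = [:b:]" by (simp only: w[symmetric] iso_inv)
    then have "[:a0, 1:] * w \<noteq> 0" "der ([:a0, 1:] * w) = 0"
      using \<open>b \<noteq> 0\<close> iso_0 unfolding der_eq_0_iff by (metis pCons_eq_0_iff, blast)
    then have "der [:a0, 1:] = 0"
      by (rule der.constant_factor[OF char0_domain_poly[OF domain] der_nilpotent der_nilpotent])
    then show False using a0 by blast
  qed
  have \<rho>_inj: "inj \<rho>"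
  proof (rule injI)
    fix x y assume "\<rho> x = \<rho> y"
    then have "\<rho> (x - y) = 0" using \<rho>_add[of "x - y" y] by simp
    then show "x = y" using \<rho>_0 by fastforce
  qed
  have \<rho>_red: "\<rho> (reduction a) = a" if "a \<in> K" for a
    unfolding \<rho>_def K_const[OF that, symmetric] by simp
  have K_sub: "K \<subseteq> \<rho> ` K'" using \<rho>_red red_K' by (metis image_eqI subsetI)
  note \<rho>K' = subring_set_image[OF K' ring_hom_on_subset[OF \<rho> subset_UNIV]]
  have in_K: "\<rho> r \<in> K" if r: "r \<in> K'" for r
  proof (rule ccontr)
    assume nK: "\<rho> r \<notin> K"
    let ?F = "\<rho> ` K'"
    obtain p where p: "p \<in> polys_over K" "poly p s = \<rho> r" using s[of "\<rho> r"] by blast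
    have pF: "p \<in> polys_over ?F" using p(1) K_sub polys_over_mono by blast
    have rF: "\<rho> r \<in> ?F" using r by blast
    have "p - [:\<rho> r:] \<noteq> 0"
    proof
      assume "p - [:\<rho> r:] = 0"
      then have "coeff p 0 = \<rho> r" by simp
      then show False using p(1) nK by (metis polys_over_def mem_Collect_eq)
    qed
    moreover have "p - [:\<rho> r:] \<in> polys_over ?F"
      using pF rF by (intro polys_over_simps[OF \<rho>K'])
    ultimately have sF: "algebraic_over ?F s" unfolding algebraic_over_def using p(2)
      by (intro bexI[of _ "p - [:\<rho> r:]"]) auto
    note C = subring_set_algebraic_over[OF \<rho>K']
    have "K \<subseteq> {x. algebraic_over ?F x}" using K_sub algebraic_over_self[OF \<rho>K'] by blast
    then have "polys_over K \<subseteq> polys_over {x. algebraic_over ?F x}" by (rule polys_over_mono)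
    then have all: "algebraic_over ?F x" for x
      using s[of x] poly_polys_over_closed[OF C, of _ s] sF by blast
    have "E y = 0" for y
    proof (rule E.deriv_algebraic_eq_0[OF dom' _ _ K'])
      show "algebraic_over K' y" using all[of "\<rho> y"] algebraic_over_image[OF K' \<rho> \<rho>_inj] by blast
    qed (simp add: K'_def)
    then show False using E_nz by blast
  qed
  have red_\<rho>: "reduction (\<rho> r) = r" if "r \<in> K'" for r
    using \<rho>_red[OF in_K[OF that]] \<rho>_inj by (simp add: inj_eq)
  have K'_unit: "r dvd 1" if r: "r \<in> K'" "r \<noteq> 0" for r
  proof -
    have "\<rho> r \<noteq> 0" using \<rho>_0 r(2) by blast
    then have "reduction (\<rho> r) dvd 1" by (intro reduction_unit K_unit in_K r(1))
    then show ?thesis by (simp add: red_\<rho>[OF r(1)])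
  qed
  have \<rho>_scalars: "\<rho> ` ?k' = ?k"
  proof -
    have "\<rho> (sc' c 1) = sc c 1" for c
      using \<rho>_red[OF scalar_K[of c]] reduction_hom(3,4) by metis
    then show ?thesis by (simp add: image_image)
  qed
  have K'_alg: "algebraic_over ?k' r" if "r \<in> K'" for r
    using K_alg[OF in_K[OF that]] algebraic_over_image[OF R.A.subring_set_scalars \<rho> \<rho>_inj, of r]
    by (simp add: \<rho>_scalars)
  obtain s' where s': "\<And>y. \<exists>!p. p \<in> polys_over K' \<and> poly p s' = y"
    using E.polynomial_ring_over_constants[OF dom' E_nil E_nz] K'_unit unfolding K'_def by blast
  have "bij_betw reduction K K'"
    by (rule bij_betw_byWitness[where f' = \<rho>]) (use \<rho>_red red_\<rho> red_K' in_K in auto)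
  moreover have "br x y = 0" for x y
    by (rule L.A.bracket_eq_0[OF domain, of K s]) (use K_alg s in blast)+
  moreover have "br' x y = 0" for x y
    by (rule R.A.bracket_eq_0[OF dom', of K' s']) (use K'_alg s' in blast)+
  ultimately show ?thesis
    using isomorphic_polynomial_rings[OF K s K' s'] scalar_K by blast
qed

section \<open>Conclusion\<close>

theorem theorem1p2:
  fixes sc :: "'k::field_char_0 \<Rightarrow> 'a::idom \<Rightarrow> 'a"
    and br :: "'a \<Rightarrow> 'a \<Rightarrow> 'a"
  assumes "poisson_algebra sc br"
    and "noetherian_ring (ring_of_type_algebra :: 'a ring)"
  shows
    "((poisson_simple br \<and> krull_dim (ring_of_type_algebra :: 'a ring) < \<infinity> \<and>
         {u :: 'a. u dvd 1} = {sc c 1 | c. c \<noteq> 0}) \<or>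
       (affine_algebra sc \<and> krull_dim (ring_of_type_algebra :: 'a ring) = 1)
       \<longrightarrow> poisson_alpha_cancellative TYPE('b::comm_ring_1) sc br)
     \<and> (PML sc br = UNIV \<longrightarrow> poisson_delta_cancellative TYPE('b) sc br)
     \<and> (krull_dim (ring_of_type_algebra :: 'a ring) < \<infinity> \<and> divisor_subalgebra sc br {1} = UNIV
       \<longrightarrow> poisson_skew_cancellative TYPE('b) sc br)
     \<and> (poisson_stratiform_domain sc br \<and> divisor_subalgebra sc br {1} = UNIV
       \<longrightarrow> poisson_skew_cancellative_in
             (noetherian_poisson_stratiform_domain :: ('k \<Rightarrow> 'c::idom \<Rightarrow> 'c) \<Rightarrow> _) sc br)"
proof -
  have dom: "char0_domain TYPE('a)" by (rule char0_domain_idom[OF CHAR_poisson_algebra[OF assms(1)]])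
  have alpha: "poisson_alpha_cancellative TYPE('b) sc br"
    if "(poisson_simple br \<and> {u :: 'a. u dvd 1} = {sc c 1 | c. c \<noteq> 0}) \<or>
       (affine_algebra sc \<and> krull_dim (ring_of_type_algebra :: 'a ring) = 1)"
    unfolding poisson_alpha_cancellative_def
  proof (intro allI impI, unfold poisson_isomorphic_def[of "poly_scale _"], erule exE)
    fix sc' :: "'k \<Rightarrow> 'b \<Rightarrow> 'b" and br' \<alpha> \<alpha>' P P' \<phi>
    assume "poisson_algebra sc' br'" "poisson_ore sc br \<alpha> (\<lambda>_. 0) P" "poisson_ore sc' br' \<alpha>' (\<lambda>_. 0) P'"
      "poisson_iso (poly_scale sc) P (poly_scale sc') P' \<phi>"
    then interpret ore_iso_alpha sc br \<alpha> P sc' br' \<alpha>' P' \<phi>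
      using assms(1) dom by (intro ore_iso_alpha.intro ore_iso.intro ore_iso_axioms.intro ore_extension.intro)
    show "poisson_isomorphic sc br sc' br'"
      using that
    proof (elim disjE conjE)
      assume "poisson_simple br" "{u :: 'a. u dvd 1} = {sc c 1 | c. c \<noteq> 0}"
      then show ?thesis by (rule isomorphic_if_poisson_simple)
    next
      assume "affine_algebra sc" "krull_dim (ring_of_type_algebra :: 'a ring) = 1"
      then show ?thesis by (rule isomorphic_if_affine_curve[OF assms(2)])
    qed
  qed
  have delta: "poisson_delta_cancellative TYPE('b) sc br" if PML: "PML sc br = UNIV"
    unfolding poisson_delta_cancellative_def
  proof (intro allI impI, unfold poisson_isomorphic_def[of "poly_scale _"], erule exE)
    fix sc' :: "'k \<Rightarrow> 'b \<Rightarrow> 'b" and br' \<delta> \<delta>' P P' \<phi>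
    assume "poisson_algebra sc' br'" "poisson_ore sc br (\<lambda>_. 0) \<delta> P" "poisson_ore sc' br' (\<lambda>_. 0) \<delta>' P'"
      "poisson_iso (poly_scale sc) P (poly_scale sc') P' \<phi>"
    then interpret ore_iso_delta sc br \<delta> P sc' br' \<delta>' P' \<phi>
      using assms(1) dom by (intro ore_iso_delta.intro ore_iso.intro ore_iso_axioms.intro ore_extension.intro)
    show "poisson_isomorphic sc br sc' br'"
      by (rule isomorphic_if_PML_UNIV[OF PML
            derivation_degree_bounded[OF assms(2) CHAR_poisson_algebra[OF assms(1)] ring_derivation_der adjoin_constants]])
  qed
  have skew: "poisson_isomorphic sc br sc' br'"
    if D: "divisor_subalgebra sc br {1} = UNIV" and pa: "poisson_algebra sc' br'"
      "poisson_ore sc br \<alpha> \<delta> P" "poisson_ore sc' br' \<alpha>' \<delta>' P'"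
      and iso: "poisson_isomorphic (poly_scale sc) P (poly_scale sc') P'"
    for sc' :: "'k \<Rightarrow> 'd::comm_ring_1 \<Rightarrow> 'd" and br' \<alpha> \<delta> \<alpha>' \<delta>' P P'
  proof -
    obtain \<phi> where \<phi>: "poisson_iso (poly_scale sc) P (poly_scale sc') P' \<phi>"
      using iso by (auto simp: poisson_isomorphic_def)
    interpret ore_iso sc br \<alpha> \<delta> P sc' br' \<alpha>' \<delta>' P' \<phi>
      using assms(1) dom pa \<phi> by (intro ore_iso.intro ore_iso_axioms.intro ore_extension.intro)
    show ?thesis by (rule isomorphic_if_divisor_subalgebra_UNIV[OF D])
  qed
  show ?thesis
  proof (intro conjI impI)
    show "poisson_skew_cancellative TYPE('b) sc br"
      if "krull_dim (ring_of_type_algebra :: 'a ring) < \<infinity> \<and> divisor_subalgebra sc br {1} = UNIV"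
      unfolding poisson_skew_cancellative_def poisson_skew_cancellative_in_def
      by (intro allI impI) (rule skew, use that in simp)
    show "poisson_skew_cancellative_in (noetherian_poisson_stratiform_domain :: ('k \<Rightarrow> 'c::idom \<Rightarrow> 'c) \<Rightarrow> _) sc br"
      if "poisson_stratiform_domain sc br \<and> divisor_subalgebra sc br {1} = UNIV"
      unfolding poisson_skew_cancellative_in_def
      by (intro allI impI) (rule skew, use that in simp)
  qed (use alpha delta in auto)
qed

end
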